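(* Let $X\subset\mathbb R^n$ be open, let $F\subset\operatorname{Sym}^2(\mathbb R^n)$ be a convex Dirichlet set, and let $\psi:X\times\mathbb R^m\to\mathbb R\cup\{-\infty\}$ be $F\star\mathcal P$-subharmonic. Then the function $$x\mapsto-\log\int_{\mathbb R^m}e^{-\psi(x,y)}\,dy$$ is $F$-subharmonic on $X$.
   Context: $\operatorname{Sym}^2(\mathbb R^n)$ is the space of real symmetric $n\times n$ matrices and $\mathcal P=\mathcal P_n$ its subset of positive semidefinite matrices. A Dirichlet set is a non-empty, proper, closed subset $F\subset\operatorname{Sym}^2(\mathbb R^n)$ with $F+\mathcal P_n\subset F$; it is a convex Dirichlet set if it is also convex. For $X\subset\mathbb R^n$ open and $f:X\to\mathbb R\cup\{-\infty\}$ upper-semicontinuous, a test function for $f$ at $x_0\in X$ is a smooth function $g$ on a neighbourhood of $x_0$ with $g\ge f$ there and $g(x_0)=f(x_0)$. The function $f$ is $F$-subharmonic if $\operatorname{Hess}_{x_0}(g)\in F$ for every $x_0\in X$ and every test function $g$ for $f$ at $x_0$. (In particular $f\equiv-\infty$ is $F$-subharmonic.) Write $A\in\operatorname{Sym}^2(\mathbb R^{n+m})$ in blocks as $A=\begin{pmatrix}B&C\\C^T&D\end{pmatrix}$ with $B\in\operatorname{Sym}^2(\mathbb R^n)$, $D\in\operatorname{Sym}^2(\mathbb R^m)$. For a real $m\times n$ matrix $\Gamma$ put $i_\Gamma^*A=\begin{pmatrix}I\\ \Gamma\end{pmatrix}^TA\begin{pmatrix}I\\ \Gamma\end{pmatrix}=B+C\Gamma+\Gamma^TC^T+\Gamma^TD\Gamma$.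 Then $F\star\mathcal P\subset\operatorname{Sym}^2(\mathbb R^{n+m})$ is the Dirichlet set of all $A$ with $D\in\mathcal P_m$ and $i_\Gamma^*A\in F$ for all $m\times n$ matrices $\Gamma$. The convention $-\log(+\infty)=-\infty$ is used. *)

theory Defs
  imports "HOL-Analysis.Analysis"
begin

section \<open>Dirichlet sets\<close>

definition sym_matrices :: "(real^'n^'n) set" where
  "sym_matrices = {A. transpose A = A}"

definition psd_matrices :: "(real^'n^'n) set" where
  "psd_matrices = {A \<in> sym_matrices. \<forall>v. 0 \<le> v \<bullet> (A *v v)}"

text \<open>The symmetric matrices are closed in the space of all matrices, so being closed there is
  the same as being closed in the symmetric matrices.\<close>

definition dirichlet_set :: "(real^'n^'n) set \<Rightarrow> bool" where
  "dirichlet_set F \<longleftrightarrow>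
     F \<subset> sym_matrices \<and> F \<noteq> {} \<and> closed F \<and> (\<forall>A\<in>F. \<forall>P\<in>psd_matrices. A + P \<in> F)"

definition convex_dirichlet_set :: "(real^'n^'n) set \<Rightarrow> bool" where
  "convex_dirichlet_set F \<longleftrightarrow> dirichlet_set F \<and> convex F"


section \<open>Subharmonic functions\<close>

text \<open>Continuous differentiability of order \<open>k\<close>; it is only meant for open sets \<open>U\<close>, where all
  Frechet derivatives are unique.\<close>

fun Ck_on :: "nat \<Rightarrow> (real^'n \<Rightarrow> real) \<Rightarrow> (real^'n) set \<Rightarrow> bool" where
  "Ck_on 0 g U \<longleftrightarrow> continuous_on U g"
| "Ck_on (Suc k) g U \<longleftrightarrow>
     (\<forall>x\<in>U. g differentiable at x) \<and> (\<forall>v. Ck_on k (\<lambda>x. frechet_derivative g (at x) v) U)"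

definition smooth_on :: "(real^'n \<Rightarrow> real) \<Rightarrow> (real^'n) set \<Rightarrow> bool" where
  "smooth_on g U \<longleftrightarrow> (\<forall>k. Ck_on k g U)"

definition partial_deriv :: "'n \<Rightarrow> (real^'n \<Rightarrow> real) \<Rightarrow> real^'n \<Rightarrow> real" where
  "partial_deriv i g x = frechet_derivative g (at x) (axis i 1)"

definition hessian :: "(real^'n \<Rightarrow> real) \<Rightarrow> real^'n \<Rightarrow> real^'n^'n" where
  "hessian g x = (\<chi> i j. partial_deriv i (partial_deriv j g) x)"

definition usc_on :: "('a::topological_space) set \<Rightarrow> ('a \<Rightarrow> ereal) \<Rightarrow> bool" where
  "usc_on X f \<longleftrightarrow> (\<forall>c. openin (top_of_set X) {x\<in>X. f x < c})"

definition test_function ::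
  "(real^'n) set \<Rightarrow> (real^'n \<Rightarrow> ereal) \<Rightarrow> real^'n \<Rightarrow> (real^'n \<Rightarrow> real) \<Rightarrow> bool" where
  "test_function X f x0 g \<longleftrightarrow>
     (\<exists>U. open U \<and> x0 \<in> U \<and> U \<subseteq> X \<and> smooth_on g U \<and> (\<forall>x\<in>U. f x \<le> ereal (g x))) \<and>
     ereal (g x0) = f x0"

text \<open>A function \<open>X \<rightarrow> \<real> \<union> {-\<infinity>}\<close> is represented by an \<^typ>\<open>ereal\<close>-valued function on the whole
  space that avoids \<open>\<infinity>\<close> on \<open>X\<close>; its values outside \<open>X\<close> are irrelevant. Both \<open>f x \<noteq> \<infinity>\<close> and
  upper semicontinuity are part of being subharmonic.\<close>

definition subharmonic_on ::
  "(real^'n^'n) set \<Rightarrow> (real^'n) set \<Rightarrow> (real^'n \<Rightarrow> ereal) \<Rightarrow> bool" where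
  "subharmonic_on F X f \<longleftrightarrow>
     (\<forall>x\<in>X. f x \<noteq> \<infinity>) \<and> usc_on X f \<and>
     (\<forall>x0\<in>X. \<forall>g. test_function X f x0 g \<longrightarrow> hessian g x0 \<in> F)"


section \<open>Products\<close>

text \<open>\<open>\<real>\<^sup>n\<^sup>+\<^sup>m\<close> is \<^typ>\<open>real^('n + 'm)\<close>; the coordinates \<open>Inl i\<close> are those of \<open>\<real>\<^sup>n\<close> and the
  coordinates \<open>Inr j\<close> are those of \<open>\<real>\<^sup>m\<close>.\<close>

definition vjoin :: "real^'n \<Rightarrow> real^'m \<Rightarrow> real^('n::finite + 'm::finite)" where
  "vjoin x y = (\<chi> k. case k of Inl i \<Rightarrow> x $ i | Inr j \<Rightarrow> y $ j)"

definition times_space :: "(real^'n) set \<Rightarrow> (real^('n::finite + 'm::finite)) set" where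
  "times_space X = {vjoin x y | x y. x \<in> X}"

definition lower_block :: "real^('n::finite + 'm::finite)^('n + 'm) \<Rightarrow> real^'m^'m" where
  "lower_block A = (\<chi> i j. A $ Inr i $ Inr j)"

text \<open>The matrix with the identity stacked on top of \<open>\<Gamma>\<close>.\<close>

definition graph_matrix :: "real^'n^'m \<Rightarrow> real^'n^('n::finite + 'm::finite)" where
  "graph_matrix \<Gamma> = (\<chi> k. case k of Inl i \<Rightarrow> mat 1 $ i | Inr j \<Rightarrow> \<Gamma> $ j)"

definition graph_pullback ::
  "real^'n^'m \<Rightarrow> real^('n::finite + 'm::finite)^('n + 'm) \<Rightarrow> real^'n^'n" where
  "graph_pullback \<Gamma> A = transpose (graph_matrix \<Gamma>) ** A ** graph_matrix \<Gamma>"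

definition star_psd :: "(real^'n^'n) set \<Rightarrow> (real^('n::finite + 'm::finite)^('n + 'm)) set" where
  "star_psd F = {A \<in> sym_matrices. lower_block A \<in> psd_matrices \<and> (\<forall>\<Gamma>. graph_pullback \<Gamma> A \<in> F)}"


section \<open>Extended exponential and logarithm\<close>

text \<open>\<open>exp_neg t\<close> is \<open>e\<^sup>-\<^sup>t\<close> with \<open>e\<^sup>\<infinity> = \<infinity>\<close>, and \<open>neg_log t\<close> is \<open>- log t\<close> with
  \<open>- log \<infinity> = -\<infinity>\<close>. The values \<open>exp_neg \<infinity> = 0\<close> and \<open>neg_log 0 = \<infinity>\<close> are not needed when
  \<open>\<psi> < \<infinity>\<close>.\<close>

definition exp_neg :: "ereal \<Rightarrow> ennreal" where
  "exp_neg t =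
     (if t = -\<infinity> then \<infinity> else if t = \<infinity> then 0 else ennreal (exp (- real_of_ereal t)))"

definition neg_log :: "ennreal \<Rightarrow> ereal" where
  "neg_log t = (if t = \<infinity> then -\<infinity> else if t = 0 then \<infinity> else ereal (- ln (enn2real t)))"

end

(*
A closed convex F with F + P <= F is an intersection of half-spaces {A. c <= Q . A} with Q
non-negative on P, so it suffices to contradict a test function g for the marginal at a with
Q . Hess g(a) < c. By Taylor expansion g may be taken to be a quadratic polynomial, with constant
Q . Hess g < c.

On a ball around a, let p_i be finitely many non-negative polynomials with sum 1 and
Q . Hess p_i = 0 that on the sphere behave like a partition of unity concentrated near points z_i.
For arbitrary y_i, the function gamma = sum p_i y_i solves the same linear equation, so
z |-> psi(z, gamma(z)) obeys a comparison principle: the viscosity inequality for psi is used with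
the penalty n |y - gamma(z)|^2 and with Gamma = D gamma, for which the penalty drops out. On the
sphere the comparison holds because psi is convex in y. Up to arbitrarily small errors the outcome is
  psi(a, sum p_i(a) y_i) - g(a) <= sum p_i(a) sup {psi(z, y_i) - g(z) | z near z_i} - beta
with beta > 0 depending only on g and the ball. This is the hypothesis of the Prekopa-Leindler
inequality with weights p_i(a), whose conclusion is incompatible with g touching the marginal at a.
*)
theory Submission
  imports Defs "HOL-Library.Function_Algebras"
begin

section \<open>Second-order calculus\<close>

text \<open>For smooth \<psi> one could differentiate under the integral and pick the best
  \<open>\<Gamma>\<close> at each point. Here \<psi> is only upper semicontinuous and may be
  -\<infinity>, so \<open>\<Gamma>\<close> has to come from a graph fixed beforehand. The substitute
  is a mean value inequality: the numbers p_i(a) are a discretised harmonic measure of Q, and the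
  graph of gamma joins the fibre over a to the fibres over the sphere with just the weights that
  Prekopa-Leindler asks for.

  Q may be degenerate; all that is known is that it is non-negative on P and positive on the
  identity. Polynomial data on a ball avoid questions of regularity: by the maximum principle and a
  dimension count the solution is again a polynomial. The partition of unity on the sphere is
  therefore built from Bernstein polynomials, which leaves a small weight away from the grid points.

  The gap c - Q . Hess g pays for all errors. It provides \<open>\<beta>\<close>; one quarter
  absorbs the far weights, another the fact that regularised integrals fall slightly below 1. The
  final contradiction is exp (-\<beta>/4) \<le> exp (-3\<beta>/4).\<close>

definition gradient :: "(real^'n \<Rightarrow> real) \<Rightarrow> real^'n \<Rightarrow> real^'n" where
  "gradient f x = (\<chi> j. partial_deriv j f x)"

lemma frechet_derivative_eq_gradient:
  assumes "f differentiable at x"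
  shows "frechet_derivative f (at x) v = gradient f x \<bullet> v"
proof -
  interpret bounded_linear "frechet_derivative f (at x)"
    using assms frechet_derivative_works has_derivative_bounded_linear by blast
  have "frechet_derivative f (at x) v = frechet_derivative f (at x) (\<Sum>i\<in>UNIV. v $ i *\<^sub>R axis i 1)"
    using basis_expansion[of v] by (simp add: scalar_mult_eq_scaleR)
  also have "\<dots> = gradient f x \<bullet> v"
    by (simp add: sum scaleR gradient_def partial_deriv_def inner_vec_def mult.commute)
  finally show ?thesis .
qed

lemma has_derivative_gradient:
  assumes "f differentiable at x"
  shows "(f has_derivative (\<lambda>v. gradient f x \<bullet> v)) (at x)"
  using assms frechet_derivative_works[of f "at x"] frechet_derivative_eq_gradient[OF assms]
  by (metis (no_types, lifting) ext)

lemma Ck_on_2D: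
  assumes "Ck_on (Suc (Suc 0)) f U" "x \<in> U"
  shows "f differentiable at x" "partial_deriv j f differentiable at x"
  using assms by (auto simp: partial_deriv_def[abs_def])

text \<open>Entry (i, j) of \<open>hessian\<close> differentiates the j-th partial derivative in
  direction i, so the differential of the gradient is the transpose. Symmetry is available only from
  \<open>transpose_hessian\<close> on.\<close>

lemma gradient_has_derivative:
  assumes "Ck_on (Suc (Suc 0)) f U" "x \<in> U"
  shows "(gradient f has_derivative (\<lambda>h. transpose (hessian f x) *v h)) (at x)"
proof -
  have "((\<lambda>y. partial_deriv j f y) has_derivative (\<lambda>h. (transpose (hessian f x) *v h) $ j)) (at x)" for j
  proof -
    have "(partial_deriv j f has_derivative (\<lambda>v. gradient (partial_deriv j f) x \<bullet> v)) (at x)"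
      by (intro has_derivative_gradient Ck_on_2D[OF assms])
    moreover have "gradient (partial_deriv j f) x \<bullet> v = (transpose (hessian f x) *v v) $ j" for v
      by (simp add: gradient_def hessian_def transpose_def inner_vec_def matrix_vector_mult_def mult.commute)
    ultimately show ?thesis by simp
  qed
  then show ?thesis
    unfolding gradient_def[abs_def] 
    by (subst has_derivative_componentwise_within)
       (auto simp: Basis_vec_def inner_axis)
qed

lemma gradient_expansion:
  assumes "open U" "x \<in> U" "Ck_on (Suc (Suc 0)) f U" "e > 0"
  obtains d where "d > 0" "ball x d \<subseteq> U"
    "\<And>w. norm w < d \<Longrightarrow> norm (gradient f (x + w) - gradient f x - transpose (hessian f x) *v w) \<le> e * norm w"
proof -
  obtain d1 where d1: "d1 > 0" "ball x d1 \<subseteq> U" using assms openE by blast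
  obtain d2 where d2: "d2 > 0" "\<And>y. norm (y - x) < d2 \<Longrightarrow>
      norm (gradient f y - gradient f x - transpose (hessian f x) *v (y - x)) \<le> e * norm (y - x)"
    using gradient_has_derivative[OF assms(3,2)] \<open>e > 0\<close>
    unfolding has_derivative_at_alt by metis
  show thesis
    by (rule that[of "min d1 d2"]) (use d1 d2(1) d2(2)[of "x + _"] in auto)
qed

text \<open>The double difference is symmetric in \<open>h\<close> and \<open>k\<close>, its leading
  term not visibly so; this is the source of the symmetry of the Hessian. The mean value theorem in
  direction \<open>k\<close> is applied to the difference in direction \<open>h\<close>, and both
  gradients that appear are expanded at \<open>x\<close>.\<close>

lemma second_mixed_difference_estimate:
  assumes "open U" "x \<in> U" "Ck_on (Suc (Suc 0)) f U" "e > 0"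
  obtains d where "d > 0"
    "\<And>t. 0 < t \<Longrightarrow> t < d \<Longrightarrow>
      \<bar>f (x + t *\<^sub>R h + t *\<^sub>R k) - f (x + t *\<^sub>R k) - f (x + t *\<^sub>R h) + f x
        - t\<^sup>2 * ((transpose (hessian f x) *v h) \<bullet> k)\<bar> \<le> e * t\<^sup>2"
proof -
  \<comment> \<open>Both displacements have norm at most \<open>t * (norm h + norm k + 1)\<close>.
    With relative error \<open>e / c\<close> the two remainders, paired with \<open>k\<close>, add
    up to at most \<open>e * t\<^sup>2\<close>. The summands 1 keep the denominators
    positive.\<close>
  define c where "c = 2 * (norm h + norm k + 1) * (norm k + 1)"
  have c: "c > 0" unfolding c_def by (intro mult_pos_pos) (auto intro: add_nonneg_pos)
  obtain d where d: "d > 0" "ball x d \<subseteq> U"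
    "\<And>w. norm w < d \<Longrightarrow> norm (gradient f (x + w) - gradient f x - transpose (hessian f x) *v w) \<le> e / c * norm w"
    using gradient_expansion[OF assms(1-3), of "e / c"] \<open>e > 0\<close> c by auto
  define d' where "d' = d / (norm h + norm k + 1)"
  have pos: "norm h + norm k + 1 > 0" by (auto intro: add_nonneg_pos)
  have "d' > 0" using d(1) pos by (simp add: d'_def)
  moreover have "\<bar>f (x + t *\<^sub>R h + t *\<^sub>R k) - f (x + t *\<^sub>R k) - f (x + t *\<^sub>R h) + f x
        - t\<^sup>2 * ((transpose (hessian f x) *v h) \<bullet> k)\<bar> \<le> e * t\<^sup>2" if t: "0 < t" "t < d'" for t
  proof -
    let ?H = "transpose (hessian f x)"
    define R where "R w = gradient f (x + w) - gradient f x - ?H *v w" for w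
    define w1 where "w1 s = t *\<^sub>R h + (s * t) *\<^sub>R k" for s :: real
    define w2 where "w2 s = (s * t) *\<^sub>R k" for s :: real
    define \<phi> where "\<phi> s = f (x + w1 s) - f (x + w2 s)" for s
    have small: "norm (w1 s) \<le> t * (norm h + norm k + 1)" "norm (w2 s) \<le> t * (norm h + norm k + 1)"
      if "0 \<le> s" "s \<le> 1" for s
    proof -
      have "s * t * norm k \<le> t * norm k"
        using that t by (simp add: mult_left_le_one_le mult.assoc)
      then show "norm (w2 s) \<le> t * (norm h + norm k + 1)"
        unfolding w2_def using that t by (simp add: algebra_simps add_increasing)
      have "norm (w1 s) \<le> t * norm h + s * t * norm k"
        unfolding w1_def using norm_triangle_ineq[of "t *\<^sub>R h" "(s * t) *\<^sub>R k"] that t by (simp add: abs_mult)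
      with \<open>s * t * norm k \<le> t * norm k\<close> show "norm (w1 s) \<le> t * (norm h + norm k + 1)"
        using t by (simp only: distrib_left)
    qed
    have td: "t * (norm h + norm k + 1) < d"
      using t pos by (simp add: d'_def pos_less_divide_eq)
    have der: "(\<phi> has_real_derivative (t * ((gradient f (x + w1 s) - gradient f (x + w2 s)) \<bullet> k))) (at s)"
      if s: "0 \<le> s" "s \<le> 1" for s
    proof -
      have "x + w1 s \<in> U" "x + w2 s \<in> U"
        using small[OF s] td d(2) by (auto simp: subset_iff dist_norm)
      then have D: "(f has_derivative (\<lambda>v. gradient f (x + w1 s) \<bullet> v)) (at (x + w1 s))"
        "(f has_derivative (\<lambda>v. gradient f (x + w2 s) \<bullet> v)) (at (x + w2 s))"
        using Ck_on_2D[OF assms(3)] by (auto intro: has_derivative_gradient)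
      have L: "((\<lambda>s. x + w1 s) has_derivative (\<lambda>r. (r * t) *\<^sub>R k)) (at s)"
        "((\<lambda>s. x + w2 s) has_derivative (\<lambda>r. (r * t) *\<^sub>R k)) (at s)"
        unfolding w1_def w2_def by (auto intro!: derivative_eq_intros)
      have "(\<phi> has_derivative (\<lambda>r. gradient f (x + w1 s) \<bullet> ((r * t) *\<^sub>R k) - gradient f (x + w2 s) \<bullet> ((r * t) *\<^sub>R k))) (at s)"
        unfolding \<phi>_def
        by (intro has_derivative_diff has_derivative_compose[OF L(1) D(1)] has_derivative_compose[OF L(2) D(2)])
      then show ?thesis
        unfolding has_field_derivative_def
        by (rule has_derivative_eq_rhs) (simp add: fun_eq_iff inner_diff_left algebra_simps)
    qed
    obtain s where s: "0 < s" "s < 1" "\<phi> 1 - \<phi> 0 = t * ((gradient f (x + w1 s) - gradient f (x + w2 s)) \<bullet> k)"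
      using MVT2[of 0 1 \<phi>, OF _ der] by auto
    have "gradient f (x + w1 s) - gradient f (x + w2 s) = ?H *v (t *\<^sub>R h) + (R (w1 s) - R (w2 s))"
      unfolding R_def w1_def w2_def by (simp add: matrix_vector_right_distrib)
    then have "\<phi> 1 - \<phi> 0 = t * ((?H *v (t *\<^sub>R h) + (R (w1 s) - R (w2 s))) \<bullet> k)"
      using s(3) by simp
    then have "\<phi> 1 - \<phi> 0 - t\<^sup>2 * ((?H *v h) \<bullet> k) = t * ((R (w1 s) - R (w2 s)) \<bullet> k)"
      by (simp add: inner_add_left matrix_vector_mult_scaleR power2_eq_square distrib_left mult.assoc
        del: transpose_matrix_vector)
    also have "\<bar>\<dots>\<bar> \<le> t * ((norm (R (w1 s)) + norm (R (w2 s))) * norm k)"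
      using t by (simp add: abs_mult) 
        (meson Cauchy_Schwarz_ineq2 mult_right_mono norm_ge_zero norm_triangle_ineq4 order_trans)
    also have "\<dots> \<le> t * ((e / c * (t * (norm h + norm k + 1)) + e / c * (t * (norm h + norm k + 1))) * (norm k + 1))"
    proof -
      have "norm (R (w1 s)) \<le> e / c * (t * (norm h + norm k + 1))"
        unfolding R_def using d(3)[of "w1 s"] small(1)[of s] s td \<open>e > 0\<close> c
        by (intro order_trans[OF d(3)] mult_left_mono) auto
      moreover have "norm (R (w2 s)) \<le> e / c * (t * (norm h + norm k + 1))"
        unfolding R_def using d(3)[of "w2 s"] small(2)[of s] s td \<open>e > 0\<close> c
        by (intro order_trans[OF d(3)] mult_left_mono) auto
      ultimately show ?thesis using t \<open>e > 0\<close> c pos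
        by (intro mult_left_mono mult_mono add_mono add_nonneg_nonneg mult_nonneg_nonneg[of "e / c"]
          mult_nonneg_nonneg[of t]) auto
    qed
    also have "\<dots> = e / c * c * t\<^sup>2"
      unfolding c_def power2_eq_square by algebra
    also have "\<dots> = e * t\<^sup>2" using c by simp
    also have "\<phi> 1 - \<phi> 0 = f (x + t *\<^sub>R h + t *\<^sub>R k) - f (x + t *\<^sub>R k) - f (x + t *\<^sub>R h) + f x"
      by (simp add: \<phi>_def w1_def w2_def add.assoc)
    finally show ?thesis .
  qed
  ultimately show thesis by (rule that)
qed

text \<open>Schwarz's theorem: exchanging \<open>h\<close> and \<open>k\<close> does not change the
  double difference, so the two leading terms agree up to \<open>e * t\<^sup>2\<close> for every
  \<open>e\<close>.\<close>

lemma transpose_hessian: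
  assumes "open U" "x \<in> U" "Ck_on (Suc (Suc 0)) f U"
  shows "transpose (hessian f x) = hessian f x"
proof -
  let ?H = "transpose (hessian f x)"
  have "(?H *v h) \<bullet> k \<le> (?H *v k) \<bullet> h + e" if "e > 0" for h k and e :: real
  proof -
    have e2: "e / 2 > 0" using that by simp
    obtain d1 where d1: "d1 > 0" "\<And>t. 0 < t \<Longrightarrow> t < d1 \<Longrightarrow>
      \<bar>f (x + t *\<^sub>R h + t *\<^sub>R k) - f (x + t *\<^sub>R k) - f (x + t *\<^sub>R h) + f x
        - t\<^sup>2 * ((?H *v h) \<bullet> k)\<bar> \<le> e/2 * t\<^sup>2"
      using second_mixed_difference_estimate[where h=h and k=k, OF assms e2] by blast
    obtain d2 where d2: "d2 > 0" "\<And>t. 0 < t \<Longrightarrow> t < d2 \<Longrightarrow>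
      \<bar>f (x + t *\<^sub>R k + t *\<^sub>R h) - f (x + t *\<^sub>R h) - f (x + t *\<^sub>R k) + f x
        - t\<^sup>2 * ((?H *v k) \<bullet> h)\<bar> \<le> e/2 * t\<^sup>2"
      using second_mixed_difference_estimate[where h=k and k=h, OF assms e2] by blast
    define t where "t = min d1 d2 / 2"
    have t: "0 < t" "t < d1" "t < d2" using d1 d2 by (auto simp: t_def)
    have "x + t *\<^sub>R k + t *\<^sub>R h = x + t *\<^sub>R h + t *\<^sub>R k" by (simp add: algebra_simps)
    then have "t\<^sup>2 * ((?H *v h) \<bullet> k) \<le> t\<^sup>2 * ((?H *v k) \<bullet> h) + e * t\<^sup>2"
      using d1(2)[OF t(1,2)] d2(2)[OF t(1,3)] by (simp only:)
    then have "t\<^sup>2 * ((?H *v h) \<bullet> k) \<le> t\<^sup>2 * ((?H *v k) \<bullet> h + e)" by (simp add: algebra_simps)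
    then show ?thesis using t by simp
  qed
  then have le: "(?H *v h) \<bullet> k \<le> (?H *v k) \<bullet> h" for h k by (rule field_le_epsilon)
  have "(?H *v axis i 1) \<bullet> axis j 1 = (?H *v axis j 1) \<bullet> axis i 1" for i j
    by (rule antisym) (rule le)+
  then show ?thesis
    by (simp add: vec_eq_iff inner_axis matrix_vector_mult_basis column_def transpose_def)
qed

text \<open>Along the segment from \<open>x\<close> to \<open>x + w\<close>, the difference of
  \<open>f\<close> and its quadratic model has as derivative the error of the first-order expansion
  of the gradient, paired with \<open>w\<close>. The mean value theorem turns this into the
  bound.\<close>

lemma second_order_taylor:
  assumes "open U" "x \<in> U" "Ck_on (Suc (Suc 0)) f U" "e > 0"
  obtains d where "d > 0" "ball x d \<subseteq> U" "\<And>w. norm w < d \<Longrightarrow>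
    \<bar>f (x + w) - f x - gradient f x \<bullet> w - (w \<bullet> (hessian f x *v w)) / 2\<bar> \<le> e * (norm w)\<^sup>2"
proof -
  let ?H = "hessian f x"
  have sym: "transpose ?H = ?H" by (rule transpose_hessian[OF assms(1-3)])
  obtain d where d: "d > 0" "ball x d \<subseteq> U"
    "\<And>w. norm w < d \<Longrightarrow> norm (gradient f (x + w) - gradient f x - ?H *v w) \<le> e * norm w"
    using gradient_expansion[OF assms] unfolding sym by blast
  have "\<bar>f (x + w) - f x - gradient f x \<bullet> w - (w \<bullet> (?H *v w)) / 2\<bar> \<le> e * (norm w)\<^sup>2" if w: "norm w < d" for w
  proof -
    define \<phi> where "\<phi> s = f (x + s *\<^sub>R w) - s * (gradient f x \<bullet> w) - s\<^sup>2 * ((w \<bullet> (?H *v w)) / 2)" for s :: real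
    have sd: "norm (s *\<^sub>R w) \<le> norm w" "norm (s *\<^sub>R w) < d" if "0 \<le> s" "s \<le> 1" for s
    proof -
      show "norm (s *\<^sub>R w) \<le> norm w" using that by (simp add: mult_left_le_one_le)
      with w show "norm (s *\<^sub>R w) < d" by simp
    qed
    have der: "(\<phi> has_real_derivative (gradient f (x + s *\<^sub>R w) - gradient f x - ?H *v (s *\<^sub>R w)) \<bullet> w) (at s)"
      if s: "0 \<le> s" "s \<le> 1" for s
    proof -
      have "x + s *\<^sub>R w \<in> U" using sd[OF s] d(2) by (auto simp: subset_iff dist_norm)
      then have D: "(f has_derivative (\<lambda>v. gradient f (x + s *\<^sub>R w) \<bullet> v)) (at (x + s *\<^sub>R w))"
        using Ck_on_2D[OF assms(3)] by (auto intro: has_derivative_gradient)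
      have L: "((\<lambda>s. x + s *\<^sub>R w) has_derivative (\<lambda>r. r *\<^sub>R w)) (at s)"
        by (auto intro!: derivative_eq_intros)
      have "(\<phi> has_derivative (\<lambda>r. gradient f (x + s *\<^sub>R w) \<bullet> (r *\<^sub>R w) - r * (gradient f x \<bullet> w) - (2 * s * r) * ((w \<bullet> (?H *v w)) / 2))) (at s)"
        unfolding \<phi>_def
        by (rule derivative_eq_intros has_derivative_compose[OF L D] | simp add: mult_ac)+
      moreover have "gradient f (x + s *\<^sub>R w) \<bullet> (r *\<^sub>R w) - r * (gradient f x \<bullet> w) - (2 * s * r) * ((w \<bullet> (?H *v w)) / 2)
          = (gradient f (x + s *\<^sub>R w) - gradient f x - ?H *v (s *\<^sub>R w)) \<bullet> w * r" for r
        by (simp add: inner_diff_left matrix_vector_mult_scaleR inner_commute[of w] algebra_simps)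
      ultimately show ?thesis
        unfolding has_field_derivative_def by simp
    qed
    obtain s where s: "0 < s" "s < 1" "\<phi> 1 - \<phi> 0 = (gradient f (x + s *\<^sub>R w) - gradient f x - ?H *v (s *\<^sub>R w)) \<bullet> w"
      using MVT2[of 0 1 \<phi>, OF _ der] by auto
    have "\<bar>\<phi> 1 - \<phi> 0\<bar> \<le> norm (gradient f (x + s *\<^sub>R w) - gradient f x - ?H *v (s *\<^sub>R w)) * norm w"
      unfolding s(3) by (rule Cauchy_Schwarz_ineq2)
    also have "\<dots> \<le> (e * norm (s *\<^sub>R w)) * norm w"
      using s sd[of s] by (intro mult_right_mono d(3)) auto
    also have "\<dots> \<le> (e * norm w) * norm w"
      using s sd[of s] \<open>e > 0\<close> by (intro mult_right_mono mult_left_mono) auto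
    finally show ?thesis by (simp add: \<phi>_def power2_eq_square algebra_simps)
  qed
  with d show thesis by (intro that)
qed

text \<open>Hessians of concrete functions are identified below as limits of this quotient, which
  spares the computation of partial derivatives.\<close>

definition second_difference :: "(real^'n \<Rightarrow> real) \<Rightarrow> real^'n \<Rightarrow> real^'n \<Rightarrow> real \<Rightarrow> real" where
  "second_difference f x v s = (f (x + s *\<^sub>R v) + f (x - s *\<^sub>R v) - 2 * f x) / s\<^sup>2"

lemma second_difference_tendsto:
  assumes "open U" "x \<in> U" "Ck_on (Suc (Suc 0)) f U"
  shows "(second_difference f x v \<longlongrightarrow> v \<bullet> (hessian f x *v v)) (at 0)"
proof (rule LIM_I)
  fix e :: real assume "e > 0"
  define e' where "e' = e / (4 * ((norm v)\<^sup>2 + 1))"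
  have np: "(norm v)\<^sup>2 + 1 > 0" by (simp add: add_nonneg_pos)
  have "e' > 0" using \<open>e > 0\<close> np by (simp add: e'_def)
  obtain d where d: "d > 0" "\<And>w. norm w < d \<Longrightarrow>
    \<bar>f (x + w) - f x - gradient f x \<bullet> w - (w \<bullet> (hessian f x *v w)) / 2\<bar> \<le> e' * (norm w)\<^sup>2"
    using second_order_taylor[OF assms \<open>e' > 0\<close>] by metis
  show "\<exists>r>0. \<forall>s. s \<noteq> 0 \<and> norm (s - 0) < r \<longrightarrow> norm (second_difference f x v s - v \<bullet> (hessian f x *v v)) < e"
  proof (intro exI[of _ "d / (norm v + 1)"] conjI allI impI)
    show "0 < d / (norm v + 1)" using d by (auto intro!: divide_pos_pos add_nonneg_pos)
    fix s :: real assume s: "s \<noteq> 0 \<and> norm (s - 0) < d / (norm v + 1)"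
    then have "\<bar>s\<bar> * (norm v + 1) < d" by (simp add: pos_less_divide_eq add_nonneg_pos)
    then have n: "norm (s *\<^sub>R v) < d" by (simp add: algebra_simps)
    let ?q = "v \<bullet> (hessian f x *v v)"
    have "\<bar>f (x + s *\<^sub>R v) + f (x - s *\<^sub>R v) - 2 * f x - s\<^sup>2 * ?q\<bar> \<le> 2 * (e' * (norm (s *\<^sub>R v))\<^sup>2)"
    proof -
      have "\<bar>f (x + s *\<^sub>R v) - f x - s * (gradient f x \<bullet> v) - s\<^sup>2 * ?q / 2\<bar> \<le> e' * (norm (s *\<^sub>R v))\<^sup>2"
        using d(2)[OF n] by (simp add: matrix_vector_mult_scaleR power2_eq_square mult.assoc)
      moreover have "\<bar>f (x - s *\<^sub>R v) - f x + s * (gradient f x \<bullet> v) - s\<^sup>2 * ?q / 2\<bar> \<le> e' * (norm (s *\<^sub>R v))\<^sup>2"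
        using d(2)[of "(- s) *\<^sub>R v"] n
        by (simp add: matrix_vector_mult_scaleR power2_eq_square mult.assoc del: scaleR_minus_left) simp
      ultimately show ?thesis by linarith
    qed
    also have "\<dots> = s\<^sup>2 * (2 * e' * (norm v)\<^sup>2)" by (simp add: power_mult_distrib mult_ac)
    also have "\<dots> < s\<^sup>2 * e"
    proof -
      have "2 * e' * (norm v)\<^sup>2 < e"
        using \<open>e > 0\<close> np by (simp add: e'_def field_simps) (intro add_pos_nonneg; simp)
      then show ?thesis using s by simp
    qed
    finally have "\<bar>f (x + s *\<^sub>R v) + f (x - s *\<^sub>R v) - 2 * f x - s\<^sup>2 * ?q\<bar> / s\<^sup>2 < e"
      using s by (simp add: divide_less_eq mult.commute)
    moreover have "second_difference f x v s - ?q = (f (x + s *\<^sub>R v) + f (x - s *\<^sub>R v) - 2 * f x - s\<^sup>2 * ?q) / s\<^sup>2"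
      using s by (simp add: second_difference_def diff_divide_distrib)
    ultimately show "norm (second_difference f x v s - ?q) < e" by (simp add: abs_divide)
  qed
qed

text \<open>Polarisation: a symmetric matrix is determined by its quadratic form, and the quadratic
  form is all that second differences detect.\<close>

lemma sym_matrix_eqI:
  fixes A B :: "real^'n^'n"
  assumes "transpose A = A" "transpose B = B" "\<And>v. v \<bullet> (A *v v) = v \<bullet> (B *v v)"
  shows "A = B"
proof -
  have pol: "v \<bullet> (C *v w) = ((v + w) \<bullet> (C *v (v + w)) - v \<bullet> (C *v v) - w \<bullet> (C *v w)) / 2"
    if "transpose C = C" for C :: "real^'n^'n" and v w
  proof -
    have "w \<bullet> (C *v v) = v \<bullet> (C *v w)"
      using dot_lmul_matrix[of w C v] that by (metis inner_commute transpose_matrix_vector)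
    then show ?thesis by (simp add: matrix_vector_right_distrib inner_add_left inner_add_right)
  qed
  have "v \<bullet> (A *v w) = v \<bullet> (B *v w)" for v w
    using pol[OF assms(1), of v w] pol[OF assms(2), of v w] assms(3) by simp
  then have "axis i 1 \<bullet> (A *v axis j 1) = axis i 1 \<bullet> (B *v axis j 1)" for i j by blast
  then show ?thesis by (simp add: vec_eq_iff inner_axis' matrix_vector_mult_basis column_def)
qed

lemma hessian_eqI:
  assumes "open U" "x \<in> U" "Ck_on (Suc (Suc 0)) f U" "transpose B = B"
    and "\<And>v. (second_difference f x v \<longlongrightarrow> v \<bullet> (B *v v)) (at 0)"
  shows "hessian f x = B"
proof (rule sym_matrix_eqI)
  show "transpose (hessian f x) = hessian f x" by (rule transpose_hessian[OF assms(1-3)])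
  show "v \<bullet> (hessian f x *v v) = v \<bullet> (B *v v)" for v
    by (rule LIM_unique[OF second_difference_tendsto[OF assms(1-3)] assms(5)])
qed (fact assms(4))

section \<open>Real polynomials are smooth\<close>

lemma polynomial_has_derivative:
  fixes f :: "real^'n \<Rightarrow> real"
  assumes "real_polynomial_function f"
  shows "\<exists>D. (\<forall>x. (f has_derivative D x) (at x)) \<and> (\<forall>v. real_polynomial_function (\<lambda>x. D x v))"
  using assms
proof induction
  case (linear f)
  then show ?case
    by (intro exI[of _ "\<lambda>_. f"]) (auto intro: bounded_linear_imp_has_derivative)
next
  case (const c)
  then show ?case by (intro exI[of _ "\<lambda>_ _. 0"]) auto
next
  case (add f g)
  then obtain D E where "\<forall>x. (f has_derivative D x) (at x)" "\<forall>v. real_polynomial_function (\<lambda>x. D x v)"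
    "\<forall>x. (g has_derivative E x) (at x)" "\<forall>v. real_polynomial_function (\<lambda>x. E x v)" by blast
  then show ?case
    by (intro exI[of _ "\<lambda>x v. D x v + E x v"]) (auto intro!: has_derivative_add)
next
  case (mult f g)
  then obtain D E where "\<forall>x. (f has_derivative D x) (at x)" "\<forall>v. real_polynomial_function (\<lambda>x. D x v)"
    "\<forall>x. (g has_derivative E x) (at x)" "\<forall>v. real_polynomial_function (\<lambda>x. E x v)" by blast
  with mult.hyps show ?case
    by (intro exI[of _ "\<lambda>x v. f x * E x v + D x v * g x"])
      (auto intro!: has_derivative_mult real_polynomial_function.intros(3,4))
qed

lemma polynomial_differentiable:
  fixes f :: "real^'n \<Rightarrow> real"
  assumes "real_polynomial_function f"
  shows "f differentiable at x"
  using polynomial_has_derivative[OF assms] differentiableI by blast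

lemma polynomial_frechet_derivative:
  fixes f :: "real^'n \<Rightarrow> real"
  assumes "real_polynomial_function f"
  shows "real_polynomial_function (\<lambda>x. frechet_derivative f (at x) v)"
proof -
  obtain D where D: "\<And>x. (f has_derivative D x) (at x)" "\<And>v. real_polynomial_function (\<lambda>x. D x v)"
    using polynomial_has_derivative[OF assms] by blast
  have "frechet_derivative f (at x) = D x" for x
    using frechet_derivative_at[OF D(1)] by simp
  with D(2) show ?thesis by simp
qed

lemma polynomial_Ck_on:
  fixes f :: "real^'n \<Rightarrow> real"
  assumes "real_polynomial_function f"
  shows "Ck_on k f U"
  using assms
proof (induction k arbitrary: f)
  case 0
  then show ?case
    by (auto intro!: continuous_at_imp_continuous_on differentiable_imp_continuous_within polynomial_differentiable)
next
  case (Suc k)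
  then show ?case
    by (auto intro: polynomial_differentiable polynomial_frechet_derivative)
qed

lemma polynomial_smooth_on:
  fixes f :: "real^'n \<Rightarrow> real"
  shows "real_polynomial_function f \<Longrightarrow> smooth_on f U"
  by (simp add: smooth_on_def polynomial_Ck_on)

lemma polynomial_continuous_on:
  fixes f :: "real^'n \<Rightarrow> real"
  shows "real_polynomial_function f \<Longrightarrow> continuous_on S f"
  using polynomial_Ck_on[of f 0 S] by simp

lemmas poly_second_difference_tendsto =
  second_difference_tendsto[OF open_UNIV UNIV_I polynomial_Ck_on]

lemmas poly_hessian_eqI =
  hessian_eqI[OF open_UNIV UNIV_I polynomial_Ck_on]

lemmas poly_transpose_hessian =
  transpose_hessian[OF open_UNIV UNIV_I polynomial_Ck_on]

section \<open>Polynomials, the maximum principle and the Dirichlet problem\<close>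

lemma polynomial_cmult [intro]:
  "real_polynomial_function f \<Longrightarrow> real_polynomial_function (\<lambda>x. c * f x)"
  by (intro real_polynomial_function.intros(2,4))

lemma polynomial_vec_nth [intro]:
  "real_polynomial_function (\<lambda>x::real^'n. x $ i)"
  by (rule real_polynomial_function.intros(1)[OF bounded_linear_vec_nth])

lemma polynomial_norm_sq [intro]:
  "real_polynomial_function (\<lambda>x::real^'n. (norm (x - a))\<^sup>2)"
proof -
  have "(\<lambda>x. (norm (x - a))\<^sup>2) = (\<lambda>x. \<Sum>i\<in>UNIV. (x $ i + (- a $ i)) * (x $ i + (- a $ i)))"
    by (simp add: power2_norm_eq_inner inner_vec_def)
  moreover have "real_polynomial_function (\<lambda>x. \<Sum>i\<in>UNIV. (x $ i + (- a $ i)) * (x $ i + (- a $ i)))"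
    by (intro real_polynomial_function_sum real_polynomial_function.intros(2-4) polynomial_vec_nth finite)
  ultimately show ?thesis by simp
qed

lemma hessian_add:
  assumes "real_polynomial_function f" "real_polynomial_function g"
  shows "hessian (\<lambda>x. f x + g x) x = hessian f x + hessian g x"
proof (rule poly_hessian_eqI)
  show "transpose (hessian f x + hessian g x) = hessian f x + hessian g x"
    using poly_transpose_hessian[OF assms(1), of x] poly_transpose_hessian[OF assms(2), of x]
    by (simp add: transpose_def vec_eq_iff)
  show "(second_difference (\<lambda>x. f x + g x) x v \<longlongrightarrow> v \<bullet> ((hessian f x + hessian g x) *v v)) (at 0)" for v
  proof -
    have "second_difference (\<lambda>x. f x + g x) x v = (\<lambda>s. second_difference f x v s + second_difference g x v s)"
      by (simp add: fun_eq_iff second_difference_def add_divide_distrib diff_divide_distrib)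
    then show ?thesis
      using tendsto_add[OF poly_second_difference_tendsto[OF assms(1)] poly_second_difference_tendsto[OF assms(2)], of x v x v]
      by (simp add: matrix_vector_mult_add_rdistrib inner_add_right)
  qed
qed (use assms in auto)

lemma hessian_cmult:
  assumes "real_polynomial_function f"
  shows "hessian (\<lambda>x. c * f x) x = c *\<^sub>R hessian f x"
proof (rule poly_hessian_eqI)
  show "transpose (c *\<^sub>R hessian f x) = c *\<^sub>R hessian f x"
    using poly_transpose_hessian[OF assms(1), of x]
    by (simp add: transpose_def vec_eq_iff)
  show "(second_difference (\<lambda>x. c * f x) x v \<longlongrightarrow> v \<bullet> ((c *\<^sub>R hessian f x) *v v)) (at 0)" for v
  proof -
    have "second_difference (\<lambda>x. c * f x) x v = (\<lambda>s. c * second_difference f x v s)"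
      by (simp add: fun_eq_iff second_difference_def algebra_simps)
    then show ?thesis
      using tendsto_mult_left[OF poly_second_difference_tendsto[OF assms(1)], of c x v]
      by (simp add: scaleR_matrix_vector_assoc[symmetric])
  qed
qed (use assms in auto)

lemma hessian_const [simp]: "hessian (\<lambda>x. c) x = 0"
  by (rule poly_hessian_eqI) (auto simp: transpose_def vec_eq_iff second_difference_def[abs_def] intro: real_polynomial_function.intros(2))

lemma hessian_sum:
  assumes "finite I" "\<And>i. i \<in> I \<Longrightarrow> real_polynomial_function (f i)"
  shows "hessian (\<lambda>x. \<Sum>i\<in>I. f i x) x = (\<Sum>i\<in>I. hessian (f i) x)"
  using assms
proof (induction I)
  case (insert j I)
  have "hessian (\<lambda>x. f j x + (\<Sum>i\<in>I. f i x)) x = hessian (f j) x + hessian (\<lambda>x. \<Sum>i\<in>I. f i x) x"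
    using insert by (intro hessian_add real_polynomial_function_sum) auto
  with insert show ?case by simp
qed simp

lemma hessian_norm_sq: "hessian (\<lambda>x::real^'n. (norm (x - a))\<^sup>2) x = 2 *\<^sub>R mat 1"
proof (rule poly_hessian_eqI)
  show "transpose (2 *\<^sub>R mat 1) = (2 *\<^sub>R mat 1 :: real^'n^'n)"
    by (simp add: transpose_def vec_eq_iff mat_def)
  have "second_difference (\<lambda>x. (norm (x - a))\<^sup>2) x v s = v \<bullet> ((2 *\<^sub>R mat 1) *v v)" if "s \<noteq> 0" for v s
  proof -
    have q: "(norm (y + w))\<^sup>2 + (norm (y - w))\<^sup>2 - 2 * (norm y)\<^sup>2 = 2 * (w \<bullet> w)" for y w :: "real^'n"
      by (simp add: power2_norm_eq_inner inner_add_left inner_add_right inner_diff_left inner_diff_right)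
    have "x + s *\<^sub>R v - a = (x - a) + s *\<^sub>R v" "x - s *\<^sub>R v - a = (x - a) - s *\<^sub>R v" by auto
    with q[of "x - a" "s *\<^sub>R v"]
    have "(norm (x + s *\<^sub>R v - a))\<^sup>2 + (norm (x - s *\<^sub>R v - a))\<^sup>2 - 2 * (norm (x - a))\<^sup>2 = s\<^sup>2 * (2 * (v \<bullet> v))"
      by (simp only:) (simp add: power2_eq_square)
    then show ?thesis using that
      by (simp add: second_difference_def scaleR_matrix_vector_assoc[symmetric])
  qed
  then show "(second_difference (\<lambda>x. (norm (x - a))\<^sup>2) x v \<longlongrightarrow> v \<bullet> ((2 *\<^sub>R mat 1) *v v)) (at 0)" for v
    by (intro tendsto_eventually) (auto simp: eventually_at_filter)
qed (rule polynomial_norm_sq)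

lemma hessian_quadratic:
  fixes a :: "real^'n"
  assumes A: "transpose A = A"
  shows "real_polynomial_function (\<lambda>x. k + b \<bullet> (x - a) + ((x - a) \<bullet> (A *v (x - a))) / 2)" (is ?poly)
    and "hessian (\<lambda>x. k + b \<bullet> (x - a) + ((x - a) \<bullet> (A *v (x - a))) / 2) x = A"
proof -
  let ?f = "\<lambda>x. k + b \<bullet> (x - a) + ((x - a) \<bullet> (A *v (x - a))) / 2"
  have lin: "real_polynomial_function (\<lambda>x. c \<bullet> (x - a))" for c
  proof -
    have "real_polynomial_function (\<lambda>x. c \<bullet> x + (- c \<bullet> a))"
      by (intro real_polynomial_function.intros(3) real_polynomial_function.intros(2)
        real_polynomial_function.intros(1)[OF bounded_linear_inner_right])
    then show ?thesis by (simp add: inner_diff_right)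
  qed
  have "real_polynomial_function (\<lambda>x. \<Sum>i\<in>UNIV. (axis i 1 \<bullet> (x - a)) * (A $ i \<bullet> (x - a)))"
    by (intro real_polynomial_function_sum real_polynomial_function.intros(4) lin finite)
  moreover have "(x - a) \<bullet> (A *v (x - a)) = (\<Sum>i\<in>UNIV. (axis i 1 \<bullet> (x - a)) * (A $ i \<bullet> (x - a)))" for x
    by (subst inner_vec_def) (simp add: inner_axis' matrix_vector_mul_component)
  ultimately have "real_polynomial_function (\<lambda>x. (x - a) \<bullet> (A *v (x - a)))" by simp
  then show p: "real_polynomial_function ?f"
    by (intro real_polynomial_function.intros(3) real_polynomial_function.intros(2) lin real_polynomial_function_divide)
  show "hessian ?f x = A"
  proof (rule poly_hessian_eqI[OF p A])
    have comm: "v \<bullet> (A *v w) = w \<bullet> (A *v v)" for v w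
      using dot_lmul_matrix[of w A v] A by (metis inner_commute transpose_matrix_vector)
    have "second_difference ?f x v s = v \<bullet> (A *v v)" if "s \<noteq> 0" for v s
    proof -
      have q: "(y + w) \<bullet> (A *v (y + w)) + (y - w) \<bullet> (A *v (y - w)) - 2 * (y \<bullet> (A *v y)) = 2 * (w \<bullet> (A *v w))" for y w
        by (simp add: matrix_vector_right_distrib matrix_vector_mult_diff_distrib inner_add_left inner_diff_left
          inner_add_right inner_diff_right)
      have "x + s *\<^sub>R v - a = (x - a) + s *\<^sub>R v" "x - s *\<^sub>R v - a = (x - a) - s *\<^sub>R v" by auto
      then have "?f (x + s *\<^sub>R v) + ?f (x - s *\<^sub>R v) - 2 * ?f x = s\<^sup>2 * (v \<bullet> (A *v v))"
        using q[of "x - a" "s *\<^sub>R v"]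
        by (simp only: inner_add_right inner_diff_right[of b "x - a"])
          (simp add: matrix_vector_mult_scaleR power2_eq_square field_simps)
      then show ?thesis using that by (simp add: second_difference_def)
    qed
    then show "(second_difference ?f x v \<longlongrightarrow> v \<bullet> (A *v v)) (at 0)" for v
      by (intro tendsto_eventually) (auto simp: eventually_at_filter)
  qed
qed

lemma local_max_hessian:
  assumes "real_polynomial_function u" "open U" "x \<in> U" "\<And>y. y \<in> U \<Longrightarrow> u y \<le> u x"
  shows "- hessian u x \<in> psd_matrices"
proof -
  have "v \<bullet> (hessian u x *v v) \<le> 0" for v
  proof (rule tendsto_upperbound[OF poly_second_difference_tendsto[OF assms(1)]])
    have "((\<lambda>s. x + s *\<^sub>R v) \<longlongrightarrow> x) (at 0)" "((\<lambda>s. x - s *\<^sub>R v) \<longlongrightarrow> x) (at 0)"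
      by (auto intro!: tendsto_eq_intros)
    then have "\<forall>\<^sub>F s in at 0. x + s *\<^sub>R v \<in> U" "\<forall>\<^sub>F s in at 0. x - s *\<^sub>R v \<in> U"
      using assms(2,3) by (auto dest: topological_tendstoD)
    then show "\<forall>\<^sub>F s in at 0. second_difference u x v s \<le> 0"
    proof eventually_elim
      case (elim s)
      then have "u (x + s *\<^sub>R v) + u (x - s *\<^sub>R v) - 2 * u x \<le> 0"
        using assms(4) by (smt (verit))
      then show ?case by (simp add: second_difference_def divide_nonpos_nonneg)
    qed
  qed simp
  then have "0 \<le> v \<bullet> ((- hessian u x) *v v)" for v
    using matrix_vector_mult_diff_rdistrib[of 0 "hessian u x" v] by (simp add: inner_diff_right)
  moreover have "transpose (- hessian u x) = - hessian u x"
    using poly_transpose_hessian[OF assms(1), of x] by (simp add: transpose_def vec_eq_iff)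
  ultimately show ?thesis by (simp add: psd_matrices_def sym_matrices_def)
qed

text \<open>The operator u |-> Q . Hess u is degenerate elliptic. Positivity on the identity is the
  one non-degeneracy that is kept: it makes the squared distance to a point a strict
  subsolution.\<close>

locale trace_operator =
  fixes Q :: "real^'n^'n"
  assumes Q_psd: "\<And>P. P \<in> psd_matrices \<Longrightarrow> 0 \<le> Q \<bullet> P"
    and Q_trace: "0 < Q \<bullet> mat 1"
begin

text \<open>A small multiple of the squared distance makes the operator strictly positive, which is
  impossible at an interior maximum, where the Hessian is negative semidefinite.\<close>

lemma maximum_principle:
  assumes u: "real_polynomial_function u"
    and L: "\<And>z. z \<in> ball a R \<Longrightarrow> 0 \<le> Q \<bullet> hessian u z"
    and bd: "\<And>z. z \<in> sphere a R \<Longrightarrow> u z \<le> 0"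
    and z: "z \<in> cball a R"
  shows "u z \<le> 0"
proof (rule ccontr)
  assume "\<not> u z \<le> 0"
  \<comment> \<open>Small enough that \<open>e * R\<^sup>2 < u z\<close>: the perturbation vanishes
    on the sphere and leaves \<open>v z\<close> positive.\<close>
  define e where "e = u z / (R\<^sup>2 + 1)"
  have "e > 0" using \<open>\<not> u z \<le> 0\<close> by (simp add: e_def add_nonneg_pos)
  define v where "v x = u x + e * ((norm (x - a))\<^sup>2 + (- R\<^sup>2))" for x
  have pv: "real_polynomial_function v"
    unfolding v_def[abs_def] by (intro real_polynomial_function.intros(2-4) u polynomial_norm_sq)
  have "e * R\<^sup>2 < u z"
    using \<open>\<not> u z \<le> 0\<close> add_nonneg_pos[of "R\<^sup>2" 1] by (simp add: e_def divide_less_eq)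
  moreover have "0 \<le> e * (norm (z - a))\<^sup>2" using \<open>e > 0\<close> by simp
  ultimately have "v z > 0" unfolding v_def ring_distribs by linarith
  have "cball a R \<noteq> {}" using z by blast
  then obtain x where x: "x \<in> cball a R" "\<And>y. y \<in> cball a R \<Longrightarrow> v y \<le> v x"
    using continuous_attains_sup[OF compact_cball _ polynomial_continuous_on[OF pv]] by blast
  have "x \<notin> sphere a R"
  proof
    assume "x \<in> sphere a R"
    then have "v x \<le> 0" using bd[of x] by (simp add: v_def dist_norm norm_minus_commute)
    with x(2)[OF z] \<open>v z > 0\<close> show False by simp
  qed
  with x have xb: "x \<in> ball a R" by (auto simp: less_le)
  have "- hessian v x \<in> psd_matrices"
    by (rule local_max_hessian[OF pv open_ball xb]) (auto intro: x(2))
  then have "0 \<le> Q \<bullet> (- hessian v x)" by (rule Q_psd)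
  moreover have "hessian v x = hessian u x + e *\<^sub>R (2 *\<^sub>R mat 1)"
    unfolding v_def[abs_def]
    by (subst hessian_add hessian_cmult,
      (intro real_polynomial_function.intros(2-4) u polynomial_norm_sq)+)+
      (simp add: hessian_norm_sq)
  ultimately have "0 \<le> - (Q \<bullet> hessian u x) - 2 * e * (Q \<bullet> mat 1)"
    by (simp add: inner_add_right inner_diff_right mult_ac)
  with L[OF xb] mult_pos_pos[OF \<open>e > 0\<close> Q_trace] show False by linarith
qed

end

section \<open>Polynomials of bounded degree as a finite-dimensional space\<close>

fun monomials :: "nat \<Rightarrow> (real^'n \<Rightarrow> real) set" where
  "monomials 0 = {\<lambda>x. 1}"
| "monomials (Suc d) = insert (\<lambda>x. 1) (\<Union>i. (\<lambda>b x. x $ i * b x) ` monomials d)"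

interpretation fun_space: vector_space "\<lambda>(c::real) (f::'a \<Rightarrow> real) x. c * f x"
  by unfold_locales (auto simp: fun_eq_iff algebra_simps)

interpretation fun_space: vector_space_pair "\<lambda>(c::real) (f::'a \<Rightarrow> real) x. c * f x" "\<lambda>(c::real) (f::'a \<Rightarrow> real) x. c * f x"
  by unfold_locales

lemma finite_monomials: "finite (monomials d)"
  by (induction d) auto

declare monomials.simps [simp del]

abbreviation polys :: "nat \<Rightarrow> (real^'n \<Rightarrow> real) set" where
  "polys d \<equiv> fun_space.span (monomials d)"

lemma polys_imp_real_polynomial_function: "f \<in> polys d \<Longrightarrow> real_polynomial_function f"
proof (induction rule: fun_space.span_induct_alt)
  case base
  then show ?case by (simp add: zero_fun_def real_polynomial_function.intros(2))
next
  case (step c b y)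
  have "real_polynomial_function b" using step(1)
    by (induction d arbitrary: b)
      (auto simp: monomials.simps intro!: real_polynomial_function.intros(2,4) polynomial_vec_nth)
  then show ?case using step(2) by (auto simp: plus_fun_def intro: real_polynomial_function.intros(3))
qed

lemma polys_add: "f \<in> polys d \<Longrightarrow> g \<in> polys d \<Longrightarrow> (\<lambda>x. f x + g x) \<in> polys d"
  using fun_space.span_add[of f _ g] by (simp add: plus_fun_def)

lemma polys_cmult: "f \<in> polys d \<Longrightarrow> (\<lambda>x. c * f x) \<in> polys d"
  by (rule fun_space.span_scale)

lemma polys_const: "(\<lambda>x. c) \<in> polys d"
proof -
  have "(\<lambda>x. 1) \<in> polys d" by (intro fun_space.span_base) (cases d; simp add: monomials.simps)
  from polys_cmult[OF this, of c] show ?thesis by simp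
qed

lemma polys_sum: "(\<And>i. i \<in> I \<Longrightarrow> f i \<in> polys d) \<Longrightarrow> (\<lambda>x. \<Sum>i\<in>I. f i x) \<in> polys d"
  by (induction I rule: infinite_finite_induct) (auto intro: polys_const polys_add)

lemma polys_Suc_mono: "f \<in> polys d \<Longrightarrow> f \<in> polys (Suc d)"
proof -
  have "monomials d \<subseteq> (monomials (Suc d) :: (real^'n \<Rightarrow> real) set)"
  proof (induction d)
    case (Suc d)
    show ?case
      unfolding monomials.simps(2)[of d] by (subst monomials.simps(2)) (use Suc in blast)
  qed (simp add: monomials.simps)
  then show "f \<in> polys d \<Longrightarrow> f \<in> polys (Suc d)" for f :: "real^'n \<Rightarrow> real"
    using fun_space.span_mono by blast
qed

lemma polys_mono: "d \<le> e \<Longrightarrow> f \<in> polys d \<Longrightarrow> f \<in> polys e"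
  by (induction rule: dec_induct) (auto intro: polys_Suc_mono)

lemma polys_vec_nth_mult: "f \<in> polys d \<Longrightarrow> (\<lambda>x. x $ i * f x) \<in> polys (Suc d)"
proof (induction rule: fun_space.span_induct_alt)
  case base
  then show ?case by (simp add: zero_fun_def polys_const)
next
  case (step c b y)
  then have "(\<lambda>x. x $ i * b x) \<in> polys (Suc d)" by (intro fun_space.span_base) (auto simp: monomials.simps(2))
  from polys_add[OF polys_cmult[OF this] step(2)] show ?case
    by (simp add: plus_fun_def algebra_simps)
qed

lemma polys_mult:
  assumes "f \<in> polys d" "g \<in> polys e"
  shows "(\<lambda>x. f x * g x) \<in> polys (d + e)"
  using assms(1)
proof (induction rule: fun_space.span_induct_alt)
  case base
  then show ?case by (simp add: zero_fun_def polys_const)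
next
  case (step c b y)
  from step(1) have "(\<lambda>x. b x * g x) \<in> polys (d + e)"
  proof (induction d arbitrary: b)
    case 0
    then show ?case using assms(2) by (simp add: monomials.simps)
  next
    case (Suc d)
    then consider "b = (\<lambda>x. 1)" | i b' where "b = (\<lambda>x. x $ i * b' x)" "b' \<in> monomials d" by (auto simp: monomials.simps(2))
    then show ?case
    proof cases
      case 1
      then show ?thesis using polys_mono[OF _ assms(2), of "Suc d + e"] by simp
    next
      case 2
      then show ?thesis using polys_vec_nth_mult[OF Suc.IH[OF 2(2)], of i] by (simp add: mult.assoc)
    qed
  qed
  from polys_add[OF polys_cmult[OF this, of c] step(2)] show ?case
    by (simp add: plus_fun_def algebra_simps)
qed

lemma polynomial_imp_polys:
  fixes f :: "real^'n \<Rightarrow> real"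
  assumes "real_polynomial_function f"
  obtains d where "f \<in> polys d"
  using assms
proof (induction arbitrary: thesis)
  case (linear f)
  have "f x = (\<Sum>i\<in>UNIV. f (axis i 1) * (x $ i * 1))" for x
  proof -
    interpret bounded_linear f by fact
    show ?thesis
      using arg_cong[OF basis_expansion[of x], of f]
      by (simp add: scalar_mult_eq_scaleR sum scaleR mult.commute)
  qed
  then have "f = (\<lambda>x. \<Sum>i\<in>UNIV. f (axis i 1) * (x $ i * 1))" by (rule ext)
  moreover have "\<dots> \<in> polys (Suc 0)"
    by (intro polys_sum polys_cmult polys_vec_nth_mult polys_const)
  ultimately have "f \<in> polys (Suc 0)" by metis
  then show ?case by (rule linear)
next
  case (const c)
  then show ?case using polys_const by blast
next
  case (add f g)
  obtain d e where "f \<in> polys d" "g \<in> polys e" using add.IH by metis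
  then have "(\<lambda>x. f x + g x) \<in> polys (max d e)"
    by (intro polys_add) (auto intro: polys_mono[rotated])
  then show ?case by (rule add.prems)
next
  case (mult f g)
  obtain d e where "f \<in> polys d" "g \<in> polys e" using mult.IH by metis
  from polys_mult[OF this] show ?case by (rule mult.prems)
qed

lemma partial_deriv_eq:
  "(f has_derivative D) (at x) \<Longrightarrow> partial_deriv i f x = D (axis i 1)"
  unfolding partial_deriv_def using frechet_derivative_at by metis

lemma polys_partial_deriv:
  assumes "f \<in> polys d"
  shows "partial_deriv i f \<in> polys (d - 1)"
proof -
  \<comment> \<open>Membership is carried through the induction because additivity of the partial
    derivative needs the partial sums to be differentiable.\<close>
  have "f \<in> polys d \<and> partial_deriv i f \<in> polys (d - 1)"
    using assms
  proof (induction rule: fun_space.span_induct_alt)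
    case base
    have "partial_deriv i (\<lambda>x. 0) = (\<lambda>x. 0)"
      by (intro ext, subst partial_deriv_eq[OF has_derivative_const]) simp
    then show ?case by (simp add: zero_fun_def polys_const)
  next
    case (step c b y)
    have one: "partial_deriv i (\<lambda>x. 1) = (\<lambda>x. 0)"
      by (intro ext, subst partial_deriv_eq[OF has_derivative_const]) simp
    have "partial_deriv i b \<in> polys (d - 1)" using step(1)
    proof (induction d arbitrary: b)
      case 0
      with one have "partial_deriv i b = (\<lambda>x. 0)" by (simp add: monomials.simps(1))
      then show ?case by (simp add: polys_const)
    next
      case (Suc d)
      then consider "b = (\<lambda>x. 1)" | j b' where "b = (\<lambda>x. x $ j * b' x)" "b' \<in> monomials d" by (auto simp: monomials.simps(2))
      then show ?case
      proof cases
        case 1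
        then show ?thesis using one by (simp add: polys_const)
      next
        case 2
        have b': "b' \<in> polys d" using 2(2) by (rule fun_space.span_base)
        have "partial_deriv i b = (\<lambda>x. axis i 1 $ j * b' x + x $ j * partial_deriv i b' x)"
        proof
          fix x
          have "(b has_derivative (\<lambda>v. x $ j * frechet_derivative b' (at x) v + v $ j * b' x)) (at x)"
            unfolding 2(1)
            using polys_imp_real_polynomial_function[OF b']
            by (intro has_derivative_mult bounded_linear_imp_has_derivative bounded_linear_vec_nth)
              (auto simp: frechet_derivative_works[symmetric] intro: polynomial_differentiable)
          from partial_deriv_eq[OF this]
          show "partial_deriv i b x = axis i 1 $ j * b' x + x $ j * partial_deriv i b' x"
            by (simp add: partial_deriv_def)
        qed
        moreover have "(\<lambda>x. x $ j * partial_deriv i b' x) \<in> polys d"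
        proof (cases d)
          \<comment> \<open>Truncated subtraction makes the induction hypothesis too weak here:
            multiplication by a coordinate would leave degree 1. But \<open>b'\<close> is constant,
            so the term vanishes.\<close>
          case 0
          with 2(2) one have "partial_deriv i b' = (\<lambda>x. 0)" by (simp add: monomials.simps(1))
          then show ?thesis by (simp add: polys_const)
        next
          case (Suc d')
          then show ?thesis using polys_vec_nth_mult[OF Suc.IH[OF 2(2)], of j] by simp
        qed
        ultimately show ?thesis using polys_add[OF polys_cmult[OF b']] by simp
      qed
    qed
    moreover have "partial_deriv i (\<lambda>x. c * b x + y x) = (\<lambda>x. c * partial_deriv i b x + partial_deriv i y x)"
    proof
      fix x
      have b: "b differentiable at x"
        using fun_space.span_base[OF step(1)] polys_imp_real_polynomial_function polynomial_differentiable by blast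
      have y: "y differentiable at x"
        using step(2) polys_imp_real_polynomial_function polynomial_differentiable by blast
      have "((\<lambda>x. c * b x + y x) has_derivative (\<lambda>v. c * frechet_derivative b (at x) v + frechet_derivative y (at x) v)) (at x)"
        using b y by (intro has_derivative_add has_derivative_mult_right) (auto simp: frechet_derivative_works[symmetric])
      from partial_deriv_eq[OF this] show "partial_deriv i (\<lambda>x. c * b x + y x) x = c * partial_deriv i b x + partial_deriv i y x"
        by (simp add: partial_deriv_def)
    qed
    ultimately show ?case
      unfolding plus_fun_def using polys_add[OF polys_cmult, of "partial_deriv i b" "d - 1" "partial_deriv i y" c] step
        polys_add[OF polys_cmult[OF fun_space.span_base[OF step(1)]], of y c] by simp
  qed
  then show ?thesis ..
qed


text \<open>Induction on the degree: the partial derivatives vanish on the ball and have lower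
  degree, hence vanish everywhere, so the polynomial is constant.\<close>

lemma polynomial_zero_on_ball:
  fixes f :: "real^'n \<Rightarrow> real"
  assumes "f \<in> polys d" "r > 0" "\<And>x. x \<in> ball a r \<Longrightarrow> f x = 0"
  shows "f x = 0"
  using assms(1,3)
proof (induction d arbitrary: f x)
  case 0
  have "f \<in> range (\<lambda>k x. k)"
    using 0(1) by (simp add: monomials.simps fun_space.span_singleton)
  then obtain k where "f = (\<lambda>x. k)" by blast
  with 0(2)[of a] \<open>r > 0\<close> show ?case by simp
next
  case (Suc d)
  have p: "real_polynomial_function f" using Suc.prems(1) by (rule polys_imp_real_polynomial_function)
  have "gradient f y = 0" for y
  proof -
    have "partial_deriv i f y = 0" for i
    proof (rule Suc.IH)
      show "partial_deriv i f \<in> polys d" using polys_partial_deriv[OF Suc.prems(1)] by simp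
      fix y assume y: "y \<in> ball a r"
      have "(f has_derivative (\<lambda>v. 0)) (at y)"
        by (rule has_derivative_transform_within_open[OF has_derivative_const open_ball y])
          (use Suc.prems(2) in auto)
      then show "partial_deriv i f y = 0" by (rule partial_deriv_eq)
    qed
    then show ?thesis by (simp add: gradient_def vec_eq_iff)
  qed
  then have "(f has_derivative (\<lambda>v. 0)) (at y)" for y
    using has_derivative_gradient[OF polynomial_differentiable[OF p], of y] by simp
  then obtain k where "\<And>y. f y = k"
    using has_derivative_zero_constant[of UNIV f] by auto
  with Suc.prems(2)[of a] \<open>r > 0\<close> show ?case by simp
qed

text \<open>An injective endomorphism of a finite-dimensional space is onto: the image of a basis is
  independent, and adding a vector outside its span would give too many independent vectors.
  Linearity of \<open>T\<close> is assumed on the span alone, as suits an operator built from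
  Hessians.\<close>

lemma fun_space_injective_imp_surjective:
  fixes B :: "('a \<Rightarrow> real) set" and T :: "('a \<Rightarrow> real) \<Rightarrow> 'a \<Rightarrow> real"
  assumes "finite B"
    and T: "\<And>f. f \<in> fun_space.span B \<Longrightarrow> T f \<in> fun_space.span B"
    and add: "\<And>f g. f \<in> fun_space.span B \<Longrightarrow> g \<in> fun_space.span B \<Longrightarrow> T (\<lambda>x. f x + g x) = (\<lambda>x. T f x + T g x)"
    and cmult: "\<And>f c. f \<in> fun_space.span B \<Longrightarrow> T (\<lambda>x. c * f x) = (\<lambda>x. c * T f x)"
    and ker: "\<And>f. f \<in> fun_space.span B \<Longrightarrow> T f = (\<lambda>x. 0) \<Longrightarrow> f = (\<lambda>x. 0)"
    and g: "g \<in> fun_space.span B"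
  shows "\<exists>f\<in>fun_space.span B. T f = g"
proof -
  obtain B' where B': "B' \<subseteq> B" "fun_space.independent B'" "B \<subseteq> fun_space.span B'"
    using fun_space.maximal_independent_subset[of B] by blast
  have sp: "fun_space.span B' = fun_space.span B"
    using B' by (metis fun_space.span_mono fun_space.span_minimal fun_space.subspace_span subset_antisym)
  \<comment> \<open>A globally linear map that agrees with \<open>T\<close> on the span, to which
    the theory of linear maps applies.\<close>
  define G where "G = fun_space.construct B' T"
  have lin: "Vector_Spaces.linear (\<lambda>c f x. c * f x) (\<lambda>c f x. c * f x) G"
    unfolding G_def by (rule fun_space.linear_construct[OF B'(2)])
  have zero: "T 0 = 0"
    using cmult[OF fun_space.span_zero, of 0] by (simp add: zero_fun_def)
  have GT: "f \<in> fun_space.span B' \<and> G f = T f" if "f \<in> fun_space.span B'" for f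
    using that
  proof (induction rule: fun_space.span_induct_alt)
    case base
    show ?case using fun_space.linear_0[OF lin] zero fun_space.span_zero by (simp add: zero_fun_def)
  next
    case (step c b y)
    have b: "b \<in> fun_space.span B'" using step(1) by (rule fun_space.span_base)
    have "G ((\<lambda>x. c * b x) + y) = (\<lambda>x. c * G b x) + G y"
      using fun_space.linear_add[OF lin] fun_space.linear_scale[OF lin] by simp
    also have "G b = T b" unfolding G_def by (rule fun_space.construct_basis[OF B'(2) step(1)])
    also have "(\<lambda>x. c * T b x) + G y = T ((\<lambda>x. c * b x) + y)"
      using add[of "\<lambda>x. c * b x" y] cmult[of b c] b step(2) fun_space.span_scale[OF b, of c]
      by (simp add: sp plus_fun_def)
    finally have "G ((\<lambda>x. c * b x) + y) = T ((\<lambda>x. c * b x) + y)" .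
    moreover have "(\<lambda>x. c * b x) + y \<in> fun_space.span B'"
      using b step(2) by (intro fun_space.span_add fun_space.span_scale) auto
    ultimately show ?case by blast
  qed
  have inj: "inj_on G (fun_space.span B')"
  proof (rule inj_onI)
    fix x y assume xy: "x \<in> fun_space.span B'" "y \<in> fun_space.span B'" "G x = G y"
    then have d: "x - y \<in> fun_space.span B'" by (intro fun_space.span_diff)
    have "G (x - y) = 0" using fun_space.linear_diff[OF lin] xy(3) by simp
    then have "x - y = (\<lambda>x. 0)" using ker[of "x - y"] GT[OF d] d by (simp add: sp zero_fun_def)
    then show "x = y" by (simp add: fun_eq_iff)
  qed
  have ind: "fun_space.independent (G ` B')"
    by (rule fun_space.linear_independent_injective_image[OF lin B'(2) inj])
  have sub: "G ` B' \<subseteq> fun_space.span B'"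
    using GT T sp fun_space.span_base by fastforce
  have fin: "finite B'" using B'(1) assms(1) finite_subset by blast
  have card: "card (G ` B') = card B'"
    using inj fun_space.span_superset by (intro card_image) (rule inj_on_subset)
  have "g \<in> fun_space.span (G ` B')"
  proof (rule ccontr)
    assume n: "g \<notin> fun_space.span (G ` B')"
    then have "fun_space.independent (insert g (G ` B'))"
      using ind by (simp add: fun_space.independent_insert)
    moreover have "insert g (G ` B') \<subseteq> fun_space.span B'" using sub g sp by simp
    ultimately have "card (insert g (G ` B')) \<le> card B'"
      using fun_space.independent_span_bound[OF fin] by blast
    moreover have "g \<notin> G ` B'" using n fun_space.span_base by blast
    ultimately show False using card fin by simp
  qed
  then obtain f where "f \<in> fun_space.span B'" "g = G f"
    using fun_space.linear_span_image[OF lin, of B'] by blast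
  then show ?thesis using GT[of f] sp by auto
qed

section \<open>The Dirichlet problem on a ball with polynomial data\<close>

context trace_operator
begin

lemma operator_polys:
  assumes "f \<in> polys d"
  shows "(\<lambda>z. Q \<bullet> hessian f z) \<in> polys (d - 2)"
proof -
  have "(\<lambda>z. Q \<bullet> hessian f z) = (\<lambda>z. \<Sum>i\<in>UNIV. \<Sum>j\<in>UNIV. Q $ i $ j * partial_deriv i (partial_deriv j f) z)"
    by (simp add: inner_vec_def hessian_def)
  also have "\<dots> \<in> polys (d - 2)"
  proof (intro polys_sum polys_cmult)
    fix i j
    have "partial_deriv i (partial_deriv j f) \<in> polys (d - 1 - 1)"
      by (intro polys_partial_deriv assms)
    then show "partial_deriv i (partial_deriv j f) \<in> polys (d - 2)"
      by (simp add: numeral_2_eq_2)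
  qed
  finally show ?thesis .
qed

text \<open>The map \<open>q \<mapsto> Q \<bullet> Hess ((R\<^sup>2 - |z - a|\<^sup>2) q)\<close> of \<open>polys d\<close> into itself is injective by the
  maximum principle, hence surjective because \<open>polys d\<close> has finite dimension.\<close>

lemma dirichlet_problem:
  assumes b: "real_polynomial_function b" and R: "R > 0"
  obtains p where "real_polynomial_function p" "\<And>z. Q \<bullet> hessian p z = 0"
    "\<And>z. z \<in> sphere a R \<Longrightarrow> p z = b z"
proof -
  obtain d where d: "b \<in> polys d" using polynomial_imp_polys[OF b] .
  define \<omega> where "\<omega> z = R\<^sup>2 + (- 1) * (norm (z - a))\<^sup>2" for z
  have p\<omega>: "real_polynomial_function \<omega>"
    unfolding \<omega>_def[abs_def]
    by (intro real_polynomial_function.intros(2,3) polynomial_cmult polynomial_norm_sq)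
  have "\<omega> \<in> polys 2"
  proof -
    have lin: "(\<lambda>z::real^'n. z $ i + (- a $ i)) \<in> polys 1" for i
      using polys_vec_nth_mult[OF polys_const[of 1 0]] by (intro polys_add polys_const) simp
    have "(\<lambda>z. R\<^sup>2 + (- 1) * (\<Sum>i\<in>UNIV. (z $ i + (- a $ i)) * (z $ i + (- a $ i)))) \<in> polys (1 + 1)"
      by (intro polys_add[OF polys_const] polys_cmult polys_sum polys_mult lin)
    moreover have "\<omega> = (\<lambda>z. R\<^sup>2 + (- 1) * (\<Sum>i\<in>UNIV. (z $ i + (- a $ i)) * (z $ i + (- a $ i))))"
      by (simp add: \<omega>_def fun_eq_iff power2_norm_eq_inner inner_vec_def)
    ultimately show ?thesis by (simp add: numeral_2_eq_2)
  qed
  define T where "T q = (\<lambda>z. Q \<bullet> hessian (\<lambda>z. \<omega> z * q z) z)" for q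
  note pp = polys_imp_real_polynomial_function real_polynomial_function.intros(4)[OF p\<omega>]
  have "\<exists>q\<in>polys d. T q = (\<lambda>z. Q \<bullet> hessian b z)"
  proof (rule fun_space_injective_imp_surjective)
    fix f :: "real^'n \<Rightarrow> real" assume f: "f \<in> polys d"
    \<comment> \<open>The factor of degree two and the operator of order two cancel in the degree,
      which makes \<open>T\<close> an endomorphism of \<open>polys d\<close>.\<close>
    have "(\<lambda>z. \<omega> z * f z) \<in> polys (2 + d)" by (rule polys_mult) fact+
    from operator_polys[OF this] show "T f \<in> polys d" unfolding T_def by simp
    show "T (\<lambda>x. c * f x) = (\<lambda>x. c * T f x)" for c
      using hessian_cmult[OF pp(2)[OF pp(1)[OF f]], of c] unfolding T_def
      by (simp add: mult.left_commute[of _ c])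
    show "T (\<lambda>x. f x + g x) = (\<lambda>x. T f x + T g x)" if g: "g \<in> polys d" for g
      using hessian_add[OF pp(2)[OF pp(1)[OF f]] pp(2)[OF pp(1)[OF g]]] unfolding T_def
      by (simp add: distrib_left inner_add_right)
    show "f = (\<lambda>x. 0)" if T0: "T f = (\<lambda>x. 0)"
    proof -
      have Q0: "Q \<bullet> hessian (\<lambda>z. \<omega> z * f z) z = 0" for z
        using T0 unfolding T_def by meson
      have om: "\<omega> z = 0" if "z \<in> sphere a R" for z
        using that by (simp add: \<omega>_def dist_norm norm_minus_commute)
      have "f z = 0" if z: "z \<in> ball a R" for z
      proof -
        have "\<omega> z * f z \<le> 0"
          by (rule maximum_principle[OF pp(2)[OF pp(1)[OF f]], of a R]) (use Q0 om z in auto)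
        moreover have "(-1) * (\<omega> z * f z) \<le> 0"
          by (rule maximum_principle[OF polynomial_cmult[OF pp(2)[OF pp(1)[OF f]]], of a R])
            (use om z in \<open>auto simp: hessian_cmult[OF pp(2)[OF pp(1)[OF f]], of "- 1", simplified] Q0\<close>)
        moreover have "\<omega> z > 0"
          using z R by (simp add: \<omega>_def dist_norm norm_minus_commute power_strict_mono)
        ultimately show ?thesis by (simp add: mult_le_0_iff zero_le_mult_iff)
      qed
      then have "f x = 0" for x
        using polynomial_zero_on_ball[OF f R] by blast
      then show ?thesis by (rule ext)
    qed
  next
    show "(\<lambda>z. Q \<bullet> hessian b z) \<in> polys d"
      by (rule polys_mono[OF _ operator_polys[OF d]]) simp
  qed (rule finite_monomials)
  then obtain q where q: "q \<in> polys d" "T q = (\<lambda>z. Q \<bullet> hessian b z)" by blast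
  \<comment> \<open>Since \<omega> vanishes on the sphere, the correction keeps the boundary values
    of \<open>b\<close>, while \<open>T q\<close> cancels the operator applied to
    \<open>b\<close>.\<close>
  define p where "p z = b z + (- 1) * (\<omega> z * q z)" for z
  note pq = pp(2)[OF pp(1)[OF q(1)]]
  show thesis
  proof (rule that)
    show "real_polynomial_function p"
      unfolding p_def[abs_def] by (intro real_polynomial_function.intros(3)[OF b] polynomial_cmult pq)
    show "Q \<bullet> hessian p z = 0" for z
    proof -
      have "hessian p z = hessian b z + (- 1) *\<^sub>R hessian (\<lambda>z. \<omega> z * q z) z"
        unfolding p_def[abs_def] hessian_add[OF b polynomial_cmult[OF pq]] hessian_cmult[OF pq] ..
      then show ?thesis using fun_cong[OF q(2), of z] by (simp add: T_def inner_diff_right)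
    qed
    show "p z = b z" if "z \<in> sphere a R" for z
      using that by (simp add: p_def \<omega>_def dist_norm norm_minus_commute)
  qed
qed

end

section \<open>Semicontinuity and comparison\<close>

lemma Bernstein_variance:
  assumes "n > 0"
  shows "(\<Sum>k\<le>n. (x - k / n)\<^sup>2 * Bernstein n k x) = x * (1 - x) / n"
proof -
  let ?b = "\<lambda>k. Bernstein n k x"
  \<comment> \<open>The square is expanded in 1, k and k (k - 1), whose Bernstein sums are known.
    The total is the variance of a binomial frequency.\<close>
  have "(x - k / n)\<^sup>2 * ?b k = x\<^sup>2 * ?b k + (1 / n\<^sup>2 - 2 * x / n) * (k * ?b k) + 1 / n\<^sup>2 * (k * (real k - 1) * ?b k)"
    for k :: nat
    using assms by (simp add: power2_eq_square field_simps)
  then have "(\<Sum>k\<le>n. (x - k / n)\<^sup>2 * ?b k) =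
      x\<^sup>2 * (\<Sum>k\<le>n. ?b k) + (1 / n\<^sup>2 - 2 * x / n) * (\<Sum>k\<le>n. k * ?b k)
      + 1 / n\<^sup>2 * (\<Sum>k\<le>n. k * (real k - 1) * ?b k)"
    by (simp add: sum.distrib sum_distrib_left del: sum_Bernstein sum_k_Bernstein sum_kk_Bernstein)
  also have "\<dots> = x\<^sup>2 + (1 / n\<^sup>2 - 2 * x / n) * (n * x) + 1 / n\<^sup>2 * (n * (real n - 1) * x\<^sup>2)"
    by simp
  also have "\<dots> = x * (1 - x) / n"
    using assms by (simp add: power2_eq_square field_simps)
  finally show ?thesis .
qed

lemma polynomial_Bernstein:
  assumes "real_polynomial_function f"
  shows "real_polynomial_function (\<lambda>z. Bernstein n k (f z))"
proof -
  have "real_polynomial_function (\<lambda>z. 1 + (- 1) * f z)"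
    using assms by (intro real_polynomial_function.intros(2,3) polynomial_cmult)
  then show ?thesis
    using assms unfolding Bernstein_def
    by (intro real_polynomial_function.intros(2,4) real_polynomial_function_power) auto
qed

context trace_operator
begin

text \<open>The boundary values of \<open>p i\<close> are products of Bernstein polynomials in the coordinates and \<open>pt i\<close>
  are the associated grid points of a cube around the ball; the last claim is Chebyshev's inequality.\<close>

lemma harmonic_kernel:
  fixes a :: "real^'n" and R \<eta> \<theta> :: real
  assumes R: "R > 0" and eta: "\<eta> > 0" and theta: "\<theta> > 0"
  obtains I :: "('n \<Rightarrow> nat) set" and pt :: "('n \<Rightarrow> nat) \<Rightarrow> real^'n" and p
  where "finite I"
    "\<And>i. i \<in> I \<Longrightarrow> real_polynomial_function (p i)"
    "\<And>i z. i \<in> I \<Longrightarrow> Q \<bullet> hessian (p i) z = 0"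
    "\<And>i z. i \<in> I \<Longrightarrow> z \<in> cball a R \<Longrightarrow> 0 \<le> p i z"
    "\<And>z. z \<in> cball a R \<Longrightarrow> (\<Sum>i\<in>I. p i z) = 1"
    "\<And>i. i \<in> I \<Longrightarrow> pt i \<in> cball a (CARD('n) * R)"
    "\<And>z. z \<in> sphere a R \<Longrightarrow> (\<Sum>i | i \<in> I \<and> \<eta> \<le> dist z (pt i). p i z) \<le> \<theta>"
proof -
  \<comment> \<open>Chebyshev's inequality will give far weights of at most
    \<open>CARD('n) * R\<^sup>2 / (N * \<eta>\<^sup>2)\<close>; this \<open>N\<close> brings them
    below \<theta>.\<close>
  define N where "N = Suc (nat \<lceil>CARD('n) * R\<^sup>2 / (\<eta>\<^sup>2 * \<theta>)\<rceil>)"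
  have N: "N > 0" by (simp add: N_def)
  have "CARD('n) * R\<^sup>2 / (\<eta>\<^sup>2 * \<theta>) \<le> N" unfolding N_def by linarith
  then have Nbig: "CARD('n) * R\<^sup>2 / N \<le> \<eta>\<^sup>2 * \<theta>"
    using N eta theta by (simp add: field_simps)
  define I where "I = PiE (UNIV :: 'n set) (\<lambda>_. {..N})"
  \<comment> \<open>Maps the cube of centre \<open>a\<close> and side \<open>2 * R\<close>, which
    contains the ball, to the unit cube; \<open>pt i\<close> below is the inverse image of the grid
    point \<open>i / N\<close>.\<close>
  define t where "t c z = (1 / (2 * R)) * (z $ c + (R - a $ c))" for c and z :: "real^'n"
  define b where "b i z = (\<Prod>c\<in>UNIV. Bernstein N (i c) (t c z))" for i z
  define pt where "pt i = (\<chi> c. a $ c + R * (2 * (i c / N) - 1))" for i :: "'n \<Rightarrow> nat"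
  have finI: "finite I" unfolding I_def by (intro finite_PiE) auto
  have t01: "0 \<le> t c z \<and> t c z \<le> 1" if "z \<in> cball a R" for c z
  proof -
    have "\<bar>(z - a) $ c\<bar> \<le> R"
      using that component_le_norm_cart[of "z - a" c] by (auto simp: dist_norm norm_minus_commute)
    then have "- R \<le> z $ c - a $ c" "z $ c - a $ c \<le> R" by auto
    then show ?thesis using R by (simp add: t_def field_simps)
  qed
  have rb: "real_polynomial_function (b i)" for i
    unfolding b_def[abs_def] t_def
    by (intro real_polynomial_function_prod polynomial_Bernstein
      polynomial_cmult real_polynomial_function.intros(2,3) polynomial_vec_nth finite)
  have b0: "0 \<le> b i z" if "z \<in> cball a R" for i z
    unfolding b_def using t01[OF that] by (intro prod_nonneg) (auto intro: Bernstein_nonneg)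
  have b1: "(\<Sum>i\<in>I. b i z) = 1" for z
    unfolding b_def I_def using prod_sum_PiE[of UNIV "\<lambda>_. {..N}" "\<lambda>c k. Bernstein N k (t c z)"] by simp
  have bvar: "(\<Sum>i\<in>I. b i z * (t c z - i c / N)\<^sup>2) \<le> 1 / (4 * N)" for c z
  proof -
    \<comment> \<open>The square is absorbed into the factor with index \<open>c\<close>. The sum
      over \<open>I\<close> then splits into one-dimensional sums, all equal to 1 except for one
      variance.\<close>
    define f where "f d k = Bernstein N k (t d z) * (if d = c then (t c z - k / N)\<^sup>2 else 1)" for d and k :: nat
    have "(\<Prod>d\<in>UNIV. f d (i d)) = b i z * (t c z - i c / N)\<^sup>2" for i
      unfolding f_def b_def by (simp add: prod.distrib)
    then have "(\<Sum>i\<in>I. b i z * (t c z - i c / N)\<^sup>2) = (\<Prod>d\<in>UNIV. \<Sum>k\<le>N. f d k)"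
      unfolding I_def by (subst prod_sum_PiE) auto
    also have "\<dots> = (\<Prod>d\<in>UNIV. if d = c then t c z * (1 - t c z) / N else 1)"
    proof (rule prod.cong[OF refl])
      fix d
      show "(\<Sum>k\<le>N. f d k) = (if d = c then t c z * (1 - t c z) / N else 1)"
        using Bernstein_variance[OF N, of "t c z"] by (auto simp: f_def mult.commute)
    qed
    also have "\<dots> = t c z * (1 - t c z) / N" by simp
    also have "t c z * (1 - t c z) \<le> 1 / 4"
      using zero_le_power2[of "2 * t c z - 1"] by (simp add: power2_eq_square algebra_simps)
    finally show ?thesis using N by (simp add: divide_right_mono)
  qed
  have far: "(\<Sum>i | i \<in> I \<and> \<eta> \<le> dist z (pt i). b i z) \<le> \<theta>" if z: "z \<in> cball a R" for z
  proof -
    have dist: "(dist z (pt i))\<^sup>2 = 4 * R\<^sup>2 * (\<Sum>c\<in>UNIV. (t c z - i c / N)\<^sup>2)" for i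
    proof -
      have "(z - pt i) $ c = 2 * R * (t c z - i c / N)" for c
        using R by (simp add: t_def pt_def field_simps)
      then have "(z - pt i) \<bullet> (z - pt i) = (\<Sum>c\<in>UNIV. (2 * R * (t c z - i c / N)) * (2 * R * (t c z - i c / N)))"
        by (subst inner_vec_def) simp
      also have "\<dots> = 4 * R\<^sup>2 * (\<Sum>c\<in>UNIV. (t c z - i c / N)\<^sup>2)"
        unfolding sum_distrib_left by (intro sum.cong) (simp_all add: power2_eq_square)
      finally show ?thesis by (simp add: dist_norm power2_norm_eq_inner)
    qed
    have "(\<Sum>i | i \<in> I \<and> \<eta> \<le> dist z (pt i). b i z) * \<eta>\<^sup>2 = (\<Sum>i | i \<in> I \<and> \<eta> \<le> dist z (pt i). b i z * \<eta>\<^sup>2)"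
      by (simp add: sum_distrib_right)
    also have "\<dots> \<le> (\<Sum>i | i \<in> I \<and> \<eta> \<le> dist z (pt i). b i z * (dist z (pt i))\<^sup>2)"
      using b0[OF z] eta by (intro sum_mono mult_left_mono power_mono) auto
    also have "\<dots> \<le> (\<Sum>i\<in>I. b i z * (dist z (pt i))\<^sup>2)"
      using b0[OF z] finI by (intro sum_mono2) auto
    also have "\<dots> = 4 * R\<^sup>2 * (\<Sum>c\<in>UNIV. \<Sum>i\<in>I. b i z * (t c z - i c / N)\<^sup>2)"
      unfolding dist by (subst sum.swap) (simp add: sum_distrib_left mult_ac)
    also have "\<dots> \<le> 4 * R\<^sup>2 * (\<Sum>c\<in>(UNIV::'n set). 1 / (4 * N))"
      by (intro mult_left_mono sum_mono bvar) auto
    also have "\<dots> = CARD('n) * R\<^sup>2 / N" by simp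
    also note Nbig
    finally show ?thesis using eta by (simp add: mult.commute)
  qed
  \<comment> \<open>The products \<open>b i\<close> have the right sign and sum but do not solve the
    equation. Their solutions with the same boundary values inherit sign and sum through the maximum
    principle.\<close>
  have "\<exists>p. real_polynomial_function p \<and> (\<forall>z. Q \<bullet> hessian p z = 0) \<and> (\<forall>z\<in>sphere a R. p z = b i z)" for i
    using dirichlet_problem[OF rb[of i] R, of a] by metis
  then obtain p where p: "\<And>i. real_polynomial_function (p i)" "\<And>i z. Q \<bullet> hessian (p i) z = 0"
    "\<And>i z. z \<in> sphere a R \<Longrightarrow> p i z = b i z"
    by metis
  show thesis
  proof (rule that[OF finI p(1,2)])
    fix i z assume z: "z \<in> cball a R"
    have "(- 1) * p i z \<le> 0"
      by (rule maximum_principle[OF polynomial_cmult[OF p(1)] _ _ z])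
        (use hessian_cmult[OF p(1), of "- 1"] p(2,3) b0 in \<open>auto simp: sphere_def cball_def\<close>)
    then show "0 \<le> p i z" by simp
  next
    fix z assume z: "z \<in> cball a R"
    define S where "S z = (\<Sum>i\<in>I. p i z) + (- 1)" for z
    have pS: "real_polynomial_function S"
      unfolding S_def[abs_def] by (intro real_polynomial_function.intros(2,3) real_polynomial_function_sum finI p)
    have LS: "Q \<bullet> hessian S x = 0" for x
      unfolding S_def[abs_def]
      by (subst hessian_add) (auto simp: hessian_sum[OF finI p(1)] inner_sum_right p(2)
        intro: real_polynomial_function.intros(2) real_polynomial_function_sum finI p(1))
    have bd: "S x = 0" if "x \<in> sphere a R" for x
      using that b1[of x] by (simp add: S_def p(3))
    have "S z \<le> 0" by (rule maximum_principle[OF pS _ _ z]) (simp_all add: LS bd)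
    moreover have "(- 1) * S z \<le> 0"
      by (rule maximum_principle[OF polynomial_cmult[OF pS] _ _ z])
        (use hessian_cmult[OF pS, of "- 1"] LS bd in auto)
    ultimately show "(\<Sum>i\<in>I. p i z) = 1" by (simp add: S_def)
  next
    fix i assume "i \<in> I"
    then have iN: "i c \<le> N" for c by (auto simp: I_def PiE_iff)
    \<comment> \<open>Grid points fill the cube and may lie outside the ball of radius
      \<open>R\<close>; the bound by the sum of the coordinates explains the radius
      \<open>CARD('n) * R\<close>.\<close>
    have "norm (pt i - a) \<le> (\<Sum>c\<in>UNIV. \<bar>(pt i - a) $ c\<bar>)" by (rule norm_le_l1_cart)
    also have "\<dots> \<le> (\<Sum>c\<in>(UNIV::'n set). R)"
    proof (rule sum_mono)
      fix c
      have "0 \<le> i c / N" "i c / N \<le> 1" using iN[of c] N by auto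
      then have "\<bar>2 * (i c / N) - 1\<bar> \<le> 1" by linarith
      then have "R * \<bar>2 * (i c / N) - 1\<bar> \<le> R * 1" using R by (intro mult_left_mono) auto
      then show "\<bar>(pt i - a) $ c\<bar> \<le> R" using R by (simp add: pt_def abs_mult)
    qed
    finally show "pt i \<in> cball a (CARD('n) * R)"
      by (simp add: dist_norm norm_minus_commute)
  next
    fix z assume z: "z \<in> sphere a R"
    then have "z \<in> cball a R" by simp
    from far[OF this] show "(\<Sum>i | i \<in> I \<and> \<eta> \<le> dist z (pt i). p i z) \<le> \<theta>"
      using p(3)[OF z] by simp
  qed
qed

end


section \<open>Upper semicontinuous functions\<close>

lemma usc_on_subset:
  assumes "usc_on X f" "Y \<subseteq> X"
  shows "usc_on Y f"
  unfolding usc_on_def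
proof
  fix c
  obtain T where T: "open T" "{x\<in>X. f x < c} = X \<inter> T"
    using assms(1) unfolding usc_on_def openin_open by blast
  have "{x\<in>Y. f x < c} = Y \<inter> T" using T(2) assms(2) by blast
  with T(1) show "openin (top_of_set Y) {x\<in>Y. f x < c}" unfolding openin_open by blast
qed

lemma usc_onD:
  assumes "usc_on X f" "x \<in> X" "f x < c"
  obtains T where "open T" "x \<in> T" "\<And>y. y \<in> X \<Longrightarrow> y \<in> T \<Longrightarrow> f y < c"
proof -
  obtain T where "open T" "{x\<in>X. f x < c} = X \<inter> T"
    using assms(1) unfolding usc_on_def openin_open by blast
  with assms(2,3) show thesis by (intro that[of T]) blast+
qed

lemma usc_on_eventually:
  assumes "usc_on X f" "x \<in> X" "f x < c" "\<And>n. s n \<in> X" "s \<longlonglongrightarrow> x"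
  shows "\<forall>\<^sub>F n in sequentially. f (s n) < c"
proof -
  obtain T where T: "open T" "x \<in> T" "\<And>y. y \<in> X \<Longrightarrow> y \<in> T \<Longrightarrow> f y < c"
    using usc_onD[OF assms(1-3)] by blast
  then have "\<forall>\<^sub>F n in sequentially. s n \<in> T" using assms(5) by (simp add: topological_tendstoD)
  then show ?thesis by eventually_elim (use T(3) assms(4) in auto)
qed

text \<open>Without a maximum the sets where \<open>f\<close> is below one of its values cover the
  compact set. A finite subcover misses the point with the largest of the finitely many
  values.\<close>

lemma usc_on_attains_sup:
  assumes "usc_on K f" "compact K" "K \<noteq> {}"
  obtains x where "x \<in> K" "\<And>y. y \<in> K \<Longrightarrow> f y \<le> f x"
proof -
  have "\<exists>x\<in>K. \<forall>y\<in>K. f y \<le> f x"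
  proof (rule ccontr)
    assume "\<not> ?thesis"
    then have ex: "\<exists>y\<in>K. f x < f y" if "x \<in> K" for x using that by (auto simp: not_le)
    have "\<exists>T. open T \<and> {x\<in>K. f x < f y} = K \<inter> T" for y
      using assms(1) unfolding usc_on_def openin_open by blast
    then obtain T where T: "\<And>y. open (T y)" "\<And>y. {x\<in>K. f x < f y} = K \<inter> T y" by metis
    have "K \<subseteq> (\<Union>y\<in>K. T y)" using ex T(2) by blast
    then obtain D where D: "D \<subseteq> K" "finite D" "K \<subseteq> (\<Union>y\<in>D. T y)"
      using compactE_image[OF assms(2), of K T] T(1) by metis
    then have "D \<noteq> {}" using assms(3) by auto
    then have "Max (f ` D) \<in> f ` D" using D(2) by (intro Max_in) auto
    then obtain y0 where y0: "y0 \<in> D" "f y0 = Max (f ` D)" by (metis imageE)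
    then obtain y where y: "y \<in> D" "y0 \<in> T y" using D by blast
    then have "f y0 < f y" using T(2)[of y] y0 D(1) by blast
    moreover have "f y \<le> f y0" using y0(2) y(1) D(2) by simp
    ultimately show False by simp
  qed
  then show thesis using that by blast
qed

lemma usc_on_diff_continuous:
  fixes \<phi> :: "'a::topological_space \<Rightarrow> real"
  assumes f: "usc_on X f" and c: "continuous_on X \<phi>"
  shows "usc_on X (\<lambda>x. f x - ereal (\<phi> x))"
  unfolding usc_on_def
proof
  fix c :: ereal
  let ?S = "{x\<in>X. f x - ereal (\<phi> x) < c}"
  have "\<exists>T. openin (top_of_set X) T \<and> x \<in> T \<and> T \<subseteq> ?S" if x: "x \<in> ?S" for x
  proof -
    have "f x < c + ereal (\<phi> x)" using x by (cases "f x"; cases c) auto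
    then obtain r where r: "f x < ereal r" "ereal r < c + ereal (\<phi> x)"
      using ereal_dense2 by blast
    have "openin (top_of_set X) {y\<in>X. ereal r < c + ereal (\<phi> y)}"
    proof (cases c)
      case (real d)
      then have "{y\<in>X. ereal r < c + ereal (\<phi> y)} = {y\<in>X. \<phi> y \<in> {r - d<..}}" by auto
      then show ?thesis using continuous_openin_preimage_gen[OF assms(2), of "{r - d<..}"]
        by (simp add: vimage_def Int_def)
    next
      case PInf
      then show ?thesis by simp
    next
      case MInf
      with r(2) show ?thesis by simp
    qed
    moreover have "openin (top_of_set X) {y\<in>X. f y < ereal r}" using f by (simp add: usc_on_def)
    ultimately have "openin (top_of_set X) ({y\<in>X. f y < ereal r} \<inter> {y\<in>X. ereal r < c + ereal (\<phi> y)})"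
      by (intro openin_Int)
    moreover have "x \<in> {y\<in>X. f y < ereal r} \<inter> {y\<in>X. ereal r < c + ereal (\<phi> y)}" using r x by auto
    moreover have "{y\<in>X. f y < ereal r} \<inter> {y\<in>X. ereal r < c + ereal (\<phi> y)} \<subseteq> ?S"
    proof clarify
      fix y assume "f y < ereal r" "ereal r < c + ereal (\<phi> y)"
      then have "f y < c + ereal (\<phi> y)" by simp
      then show "f y - ereal (\<phi> y) < c" by (cases "f y"; cases c) auto
    qed
    ultimately show ?thesis by blast
  qed
  then show "openin (top_of_set X) ?S" by (subst openin_subopen) blast
qed

lemma usc_on_bounded_above:
  assumes "usc_on K f" "compact K" "\<And>x. x \<in> K \<Longrightarrow> f x \<noteq> \<infinity>"
  obtains M where "\<And>x. x \<in> K \<Longrightarrow> f x < ereal M"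
proof (cases "K = {}")
  case False
  obtain x where x: "x \<in> K" "\<And>y. y \<in> K \<Longrightarrow> f y \<le> f x"
    using usc_on_attains_sup[OF assms(1,2) False] by blast
  have "f x < \<infinity>" using assms(3)[OF x(1)] by (simp add: less_le)
  then obtain M where "f x < ereal M" using ereal_dense2 by blast
  with x(2) show thesis by (intro that[of M]) (rule le_less_trans)
qed (use that in auto)

text \<open>Compactness: if no \<open>n\<close> works, violating points accumulate at some
  \<open>x\<close>. Where \<open>d x > 0\<close> the penalty tends to infinity against the upper
  bound of \<open>f\<close>; where \<open>d x = 0\<close> the strict inequality extends to a
  neighbourhood by semicontinuity.\<close>

lemma penalized_boundary:
  fixes d \<phi> :: "'a::metric_space \<Rightarrow> real"
  assumes f: "usc_on B f" "\<And>x. x \<in> B \<Longrightarrow> f x \<noteq> \<infinity>" and B: "compact B"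
    and cont: "continuous_on B d" "continuous_on B \<phi>" and d0: "\<And>x. x \<in> B \<Longrightarrow> 0 \<le> d x"
    and less: "\<And>x. x \<in> B \<Longrightarrow> d x = 0 \<Longrightarrow> f x < ereal (\<phi> x)"
  obtains n :: nat where "\<And>x. x \<in> B \<Longrightarrow> f x < ereal (\<phi> x + n * d x)"
proof -
  have "\<exists>n::nat. \<forall>x\<in>B. f x < ereal (\<phi> x + n * d x)"
  proof (rule ccontr)
    assume "\<not> ?thesis"
    then have "\<forall>n::nat. \<exists>x. x \<in> B \<and> ereal (\<phi> x + n * d x) \<le> f x" by (auto simp: not_less)
    then obtain s where s: "\<And>n::nat. s n \<in> B" "\<And>n. ereal (\<phi> (s n) + n * d (s n)) \<le> f (s n)"
      by metis
    obtain x r where x: "x \<in> B" "strict_mono (r :: nat \<Rightarrow> nat)" "(s \<circ> r) \<longlonglongrightarrow> x"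
      using compact_imp_seq_compact[OF B] s(1) unfolding seq_compact_def by metis
    have ld: "(\<lambda>n. d (s (r n))) \<longlonglongrightarrow> d x" and lp: "(\<lambda>n. \<phi> (s (r n))) \<longlonglongrightarrow> \<phi> x"
      using continuous_on_tendsto_compose[OF cont(1) x(3) x(1)] continuous_on_tendsto_compose[OF cont(2) x(3) x(1)] s(1)
      by (simp_all add: o_def)
    show False
    proof (cases "d x = 0")
      case True
      then obtain c where c: "f x < ereal c" "ereal c < ereal (\<phi> x)"
        using less[OF x(1)] ereal_dense2 by blast
      have "\<forall>\<^sub>F n in sequentially. f ((s \<circ> r) n) < ereal c"
        by (rule usc_on_eventually[OF f(1) x(1) c(1) _ x(3)]) (simp add: s(1))
      moreover have "\<forall>\<^sub>F n in sequentially. c < \<phi> (s (r n))"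
        using lp c(2) by (intro order_tendstoD(1)[of _ "\<phi> x"]) auto
      ultimately have "\<forall>\<^sub>F n in sequentially. False"
      proof eventually_elim
        case (elim n)
        have "ereal (\<phi> (s (r n))) \<le> ereal (\<phi> (s (r n)) + r n * d (s (r n)))"
          using d0[OF s(1)[of "r n"]] by simp
        also note s(2)[of "r n"]
        finally show ?case using elim by (simp add: o_def) (metis less_ereal.simps(1) order.strict_trans1 order.asym)
      qed
      then show False by simp
    next
      case False
      then have dx: "d x > 0" using d0[OF x(1)] by simp
      obtain M where M: "\<And>x. x \<in> B \<Longrightarrow> f x < ereal M" using usc_on_bounded_above[OF f(1) B f(2)] by blast
      have "\<forall>\<^sub>F n in sequentially. d x / 2 < d (s (r n))"
        using ld dx by (intro order_tendstoD(1)[of _ "d x"]) auto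
      moreover have "\<forall>\<^sub>F n in sequentially. \<phi> x - 1 < \<phi> (s (r n))"
        using lp by (intro order_tendstoD(1)[of _ "\<phi> x"]) auto
      moreover have "\<forall>\<^sub>F n in sequentially. (M - \<phi> x + 1) / (d x / 2) < real n"
        by (rule filterlim_real_sequentially[unfolded filterlim_at_top_dense, rule_format])
      ultimately have "\<forall>\<^sub>F n in sequentially. False"
      proof eventually_elim
        case (elim n)
        have "M - \<phi> x + 1 < real n * (d x / 2)" using elim(3) dx by (simp add: pos_divide_less_eq)
        also have "\<dots> \<le> real (r n) * d (s (r n))"
          using elim(1) dx seq_suble[OF x(2), of n] by (intro mult_mono) auto
        finally have "M < \<phi> (s (r n)) + r n * d (s (r n))" using elim(2) by simp
        then have "ereal M < f (s (r n))" using s(2)[of "r n"] by (meson less_ereal.simps(1) order.strict_trans2)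
        with M[OF s(1)[of "r n"]] show ?case by simp
      qed
      then show False by simp
    qed
  qed
  then show thesis using that by blast
qed

text \<open>The maximum of \<psi> minus the penalised function over \<open>K\<close> is non-negative
  because of \<open>p0\<close> and cannot lie in \<open>K - U\<close>, so a constant shift gives a
  test function at a point of \<open>U\<close>. There is no control over \<open>n\<close>;
  applications have to extract from the Hessian a quantity to which the penalty contributes
  nothing.\<close>

lemma penalized_comparison:
  fixes \<psi> :: "real^'n \<Rightarrow> ereal"
  assumes sub: "subharmonic_on G \<Omega> \<psi>" and K: "compact K" "K \<subseteq> \<Omega>" and U: "open U" "U \<subseteq> K"
    and poly: "real_polynomial_function \<phi>" "real_polynomial_function d"
    and d0: "\<And>p. p \<in> K \<Longrightarrow> 0 \<le> d p"
    and bd: "\<And>p. p \<in> K - U \<Longrightarrow> d p = 0 \<Longrightarrow> \<psi> p < ereal (\<phi> p)"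
    and p0: "p0 \<in> K" "d p0 = 0" "ereal (\<phi> p0) \<le> \<psi> p0"
  obtains n C p where "p \<in> U" "hessian (\<lambda>p. \<phi> p + n * d p + C) p \<in> G"
proof -
  have usc: "usc_on K \<psi>" and fin: "\<And>x. x \<in> K \<Longrightarrow> \<psi> x \<noteq> \<infinity>"
    using sub K(2) usc_on_subset unfolding subharmonic_on_def by blast+
  have "compact (K - U)" using K(1) U(1) by (rule compact_diff)
  then obtain n :: nat where n: "\<And>p. p \<in> K - U \<Longrightarrow> \<psi> p < ereal (\<phi> p + n * d p)"
    using penalized_boundary[of "K - U" \<psi> d \<phi>] usc_on_subset[OF usc, of "K - U"] fin d0 bd
      polynomial_continuous_on[OF poly(1)] polynomial_continuous_on[OF poly(2)]
    by (metis Diff_iff Diff_subset)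
  define \<Phi> where "\<Phi> p = \<phi> p + n * d p" for p
  have p\<Phi>: "real_polynomial_function \<Phi>"
    unfolding \<Phi>_def[abs_def] using poly by (intro real_polynomial_function.intros(3) polynomial_cmult)
  have "usc_on K (\<lambda>p. \<psi> p - ereal (\<Phi> p))"
    by (rule usc_on_diff_continuous[OF usc polynomial_continuous_on[OF p\<Phi>]])
  then obtain p where p: "p \<in> K" "\<And>q. q \<in> K \<Longrightarrow> \<psi> q - ereal (\<Phi> q) \<le> \<psi> p - ereal (\<Phi> p)"
    using usc_on_attains_sup[OF _ K(1), of "\<lambda>p. \<psi> p - ereal (\<Phi> p)"] p0(1) by blast
  have "0 \<le> \<psi> p0 - ereal (\<Phi> p0)" using p0 fin[OF p0(1)] by (cases "\<psi> p0") (auto simp: \<Phi>_def)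
  also have "\<dots> \<le> \<psi> p - ereal (\<Phi> p)" by (rule p(2)[OF p0(1)])
  finally have pos: "0 \<le> \<psi> p - ereal (\<Phi> p)" .
  \<comment> \<open>Non-negativity at the maximum excludes the value -\<infinity>, so the shift
    \<open>C\<close> is a real number.\<close>
  then obtain t where t: "\<psi> p = ereal t" using fin[OF p(1)] by (cases "\<psi> p") auto
  have pU: "p \<in> U"
  proof (rule ccontr)
    assume "p \<notin> U"
    then have "\<psi> p < ereal (\<Phi> p)" using n[of p] p(1) by (simp add: \<Phi>_def)
    with pos t show False by simp
  qed
  define C where "C = t - \<Phi> p"
  have pC: "real_polynomial_function (\<lambda>p. \<Phi> p + C)" by (intro real_polynomial_function.intros(2,3) p\<Phi>)
  have "\<psi> q \<le> ereal (\<Phi> q + C)" if "q \<in> U" for q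
    using p(2)[of q] that U(2) fin[of q] by (cases "\<psi> q") (auto simp: t C_def)
  then have "test_function \<Omega> \<psi> p (\<lambda>p. \<Phi> p + C)"
    unfolding test_function_def using U K(2) pU polynomial_smooth_on[OF pC, of U]
    by (intro conjI exI[of _ U]) (auto simp: t C_def)
  then have "hessian (\<lambda>p. \<Phi> p + C) p \<in> G"
    using sub pU U(2) K(2) unfolding subharmonic_on_def by blast
  with pU show thesis by (intro that[of p n C]) (auto simp: \<Phi>_def)
qed

section \<open>Convexity in the fibres and interpolation along graphs\<close>

lemma norm_sq_vec: "(norm (x :: real^'n))\<^sup>2 = (\<Sum>i\<in>UNIV. (x $ i)\<^sup>2)"
  unfolding power2_norm_eq_inner inner_vec_def by (simp add: power2_eq_square)

definition fst_part :: "real^('n::finite + 'm::finite) \<Rightarrow> real^'n" where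
  "fst_part p = (\<chi> i. p $ Inl i)"

definition snd_part :: "real^('n::finite + 'm::finite) \<Rightarrow> real^'m" where
  "snd_part p = (\<chi> j. p $ Inr j)"

lemma vjoin_nth [simp]: "vjoin x y $ Inl i = x $ i" "vjoin x y $ Inr j = y $ j"
  by (simp_all add: vjoin_def)

lemma fst_part_vjoin [simp]: "fst_part (vjoin x y) = x"
  and snd_part_vjoin [simp]: "snd_part (vjoin x y) = y"
  by (simp_all add: fst_part_def snd_part_def vec_eq_iff)

lemma vec_sum_eqI:
  fixes p q :: "'a^('n::finite + 'm::finite)"
  assumes "\<And>i. p $ Inl i = q $ Inl i" "\<And>j. p $ Inr j = q $ Inr j"
  shows "p = q"
proof -
  have "p $ k = q $ k" for k by (cases k) (auto simp: assms)
  then show ?thesis by (simp add: vec_eq_iff)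
qed

lemma vjoin_parts [simp]: "vjoin (fst_part p) (snd_part p) = p"
  by (rule vec_sum_eqI) (simp_all add: fst_part_def snd_part_def)

lemma vjoin_add_scaleR:
  "vjoin x y + s *\<^sub>R vjoin h k = vjoin (x + s *\<^sub>R h) (y + s *\<^sub>R k)"
  "vjoin x y - s *\<^sub>R vjoin h k = vjoin (x - s *\<^sub>R h) (y - s *\<^sub>R k)"
  by (rule vec_sum_eqI; simp)+

lemma sum_UNIV_Plus:
  fixes f :: "'n::finite + 'm::finite \<Rightarrow> 'b::comm_monoid_add"
  shows "(\<Sum>k\<in>UNIV. f k) = (\<Sum>i\<in>UNIV. f (Inl i)) + (\<Sum>j\<in>UNIV. f (Inr j))"
  unfolding UNIV_Plus_UNIV[symmetric] by (subst sum.Plus) (simp_all add: o_def)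

lemma linear_fst_part: "linear fst_part" and linear_snd_part: "linear snd_part"
  by (rule linearI; simp add: fst_part_def snd_part_def vec_eq_iff)+

lemma linear_vjoin: "linear (\<lambda>(x, y). vjoin x y)"
  by (rule linearI; clarsimp; rule vec_sum_eqI; simp)

lemma continuous_on_vjoin [continuous_intros]:
  assumes "continuous_on S f" "continuous_on S g"
  shows "continuous_on S (\<lambda>s. vjoin (f s) (g s))"
  using bounded_linear.continuous_on[OF linear_vjoin[unfolded linear_conv_bounded_linear] continuous_on_Pair[OF assms]]
  by simp

lemma continuous_on_fst_part [continuous_intros]:
  "continuous_on S f \<Longrightarrow> continuous_on S (\<lambda>s. fst_part (f s))"
  by (rule bounded_linear.continuous_on[OF linear_fst_part[unfolded linear_conv_bounded_linear]])

lemma continuous_on_snd_part [continuous_intros]: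
  "continuous_on S f \<Longrightarrow> continuous_on S (\<lambda>s. snd_part (f s))"
  by (rule bounded_linear.continuous_on[OF linear_snd_part[unfolded linear_conv_bounded_linear]])

lemma vjoin_in_times_space [simp]: "vjoin x y \<in> times_space X \<longleftrightarrow> x \<in> X"
  unfolding times_space_def by (auto) (metis fst_part_vjoin)

lemma compact_vjoin_box:
  assumes "compact A" "compact B"
  shows "compact {p. fst_part p \<in> A \<and> snd_part p \<in> B}"
proof -
  have "{p. fst_part p \<in> A \<and> snd_part p \<in> B} = (\<lambda>(x, y). vjoin x y) ` (A \<times> B)"
    by (auto intro!: image_eqI[where x="(fst_part _, snd_part _)"])
  moreover have "compact ((\<lambda>(x, y). vjoin x y) ` (A \<times> B))"
    by (intro compact_continuous_image linear_continuous_on linear_conv_bounded_linear[THEN iffD1]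
      linear_vjoin compact_Times assms)
  ultimately show ?thesis by simp
qed

lemma open_vjoin_box:
  assumes "open A" "open B"
  shows "open {p. fst_part p \<in> A \<and> snd_part p \<in> B}"
proof -
  have "open (fst_part -` A \<inter> snd_part -` B)"
    by (intro open_Int open_vimage assms continuous_intros)
  then show ?thesis by (simp add: vimage_def Int_def)
qed

lemma polynomial_fst_part:
  assumes "real_polynomial_function f"
  shows "real_polynomial_function (\<lambda>p. f (fst_part p))"
  using real_polynomial_function_compose[OF _ assms, of fst_part]
    polynomial_function_bounded_linear linear_fst_part
  by (auto simp: linear_conv_bounded_linear o_def)

lemma inner_vjoin: "vjoin x y \<bullet> p = x \<bullet> fst_part p + y \<bullet> snd_part p"
  by (simp add: inner_vec_def sum_UNIV_Plus fst_part_def snd_part_def)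

lemma inner_lower_block: "v \<bullet> (lower_block A *v v) = vjoin 0 v \<bullet> (A *v vjoin 0 v)"
proof -
  have "snd_part (A *v vjoin 0 v) = lower_block A *v v"
    by (simp add: vec_eq_iff snd_part_def lower_block_def matrix_vector_mult_def sum_UNIV_Plus)
  then show ?thesis by (simp add: inner_vjoin)
qed

lemma graph_matrix_mult: "graph_matrix \<Gamma> *v h = vjoin h (\<Gamma> *v h)"
proof (rule vec_sum_eqI)
  have "(\<Sum>j\<in>UNIV. mat 1 $ i $ j * h $ j) = h $ i" for i
    using matrix_vector_mul_lid[of h] by (metis (mono_tags, lifting) matrix_vector_mult_def vec_lambda_beta sum.cong)
  then show "(graph_matrix \<Gamma> *v h) $ Inl i = vjoin h (\<Gamma> *v h) $ Inl i" for i
    by (simp add: graph_matrix_def matrix_vector_mult_def)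
qed (simp add: graph_matrix_def matrix_vector_mult_def)

lemma inner_graph_pullback:
  "h \<bullet> (graph_pullback \<Gamma> A *v h) = vjoin h (\<Gamma> *v h) \<bullet> (A *v vjoin h (\<Gamma> *v h))"
proof -
  have "h \<bullet> (graph_pullback \<Gamma> A *v h) = h \<bullet> (transpose (graph_matrix \<Gamma>) *v (A *v (graph_matrix \<Gamma> *v h)))"
    by (simp add: graph_pullback_def matrix_vector_mul_assoc matrix_mul_assoc del: transpose_matrix_vector)
  also have "\<dots> = (graph_matrix \<Gamma> *v h) \<bullet> (A *v (graph_matrix \<Gamma> *v h))"
    using dot_lmul_matrix[of "A *v (graph_matrix \<Gamma> *v h)" "graph_matrix \<Gamma>" h] by (simp add: inner_commute)
  finally show ?thesis by (simp add: graph_matrix_mult)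
qed

text \<open>The fibre block of a test Hessian is positive semidefinite, so no strictly concave
  parabola on a segment of a fibre can be crossed from below. Convexity is stated for the strict
  epigraph because \<psi> may be -\<infinity>; Jensen's inequality then holds for finite convex
  combinations of points of a convex set.\<close>

lemma fibre_epigraph_convex:
  fixes \<psi> :: "real^('n::finite + 'm::finite) \<Rightarrow> ereal"
  assumes X: "open X" and sub: "subharmonic_on (star_psd F) (times_space X) \<psi>" and z: "z \<in> X"
  shows "convex {(y, b). \<psi> (vjoin z y) < ereal b}"
proof (rule convexI)
  let ?E = "{(y, b). \<psi> (vjoin z y) < ereal b}"
  fix pa pb :: "(real^'m) \<times> real" and s1 s0 :: real
  assume ab: "pa \<in> ?E" "pb \<in> ?E" and s: "0 \<le> s1" "0 \<le> s0" "s1 + s0 = 1"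
  obtain a \<alpha> b \<beta> where pab: "pa = (a, \<alpha>)" "pb = (b, \<beta>)" by (cases pa; cases pb)
  have less: "\<psi> (vjoin z a) < ereal \<alpha>" "\<psi> (vjoin z b) < ereal \<beta>" using ab pab by auto
  have s1: "s1 = 1 - s0" "s0 \<le> 1" using s by auto
  define v where "v = b - a"
  have eqs: "s1 *\<^sub>R pa + s0 *\<^sub>R pb = (a + s0 *\<^sub>R v, (1 - s0) * \<alpha> + s0 * \<beta>)"
    unfolding s1(1) pab v_def by (simp add: algebra_simps)
  have "\<psi> (vjoin z (a + s0 *\<^sub>R v)) < ereal ((1 - s0) * \<alpha> + s0 * \<beta>)"
  proof (cases "v = 0")
    case True
    have "\<psi> (vjoin z a) < ereal ((1 - s0) * \<alpha> + s0 * \<beta>)"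
    proof -
      have "a = b" using True by (simp add: v_def)
      then have "\<psi> (vjoin z a) < ereal (min \<alpha> \<beta>)" using less by (simp add: min_def)
      also have "min \<alpha> \<beta> = (1 - s0) * min \<alpha> \<beta> + s0 * min \<alpha> \<beta>" by (simp add: algebra_simps)
      also have "ereal \<dots> \<le> ereal ((1 - s0) * \<alpha> + s0 * \<beta>)"
        using s s1 by (simp del: distrib_right_numeral) (intro add_mono mult_left_mono; simp)
      finally show ?thesis .
    qed
    with True show ?thesis by simp
  next
    case False
    then have vv: "v \<bullet> v > 0" by simp
    show ?thesis
    proof (rule ccontr)
      assume n: "\<not> ?thesis"
      obtain r where r: "\<psi> (vjoin z b) < ereal r" "ereal r < ereal \<beta>" using less(2) ereal_dense2 by blast
      define \<kappa> where "\<kappa> = \<beta> - r"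
      have \<kappa>: "\<kappa> > 0" using r(2) by (simp add: \<kappa>_def)
      obtain R where R: "R > 0" "cball z R \<subseteq> X" using X z open_contains_cball by blast
      \<comment> \<open>Coordinate of the orthogonal projection to the line through \<open>a\<close>
        and \<open>b\<close>, equal to 0 at \<open>a\<close> and to 1 at \<open>b\<close>. Below,
        \<tau> is the same function written as a polynomial in all coordinates, and \<open>d\<close>
        is the squared distance to this line in the fibre over \<open>z\<close>.\<close>
      define \<sigma> where "\<sigma> y = ((y - a) \<bullet> v) / (v \<bullet> v)" for y
      define \<tau> where "\<tau> p = (\<Sum>j\<in>UNIV. (v $ j / (v \<bullet> v)) * (p $ Inr j + (- a $ j)))"
        for p :: "real^('n + 'm)"
      have \<tau>: "\<tau> p = \<sigma> (snd_part p)" for p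
        by (simp add: \<tau>_def \<sigma>_def inner_vec_def[of _ v] snd_part_def sum_divide_distrib mult.commute)
      \<comment> \<open>strictly concave along the segment; lowering it by \<open>\<kappa>\<close> at \<open>b\<close> keeps it above \<open>\<psi>\<close> there\<close>
      define \<phi> where "\<phi> p = \<alpha> + (\<beta> - \<alpha>) * \<tau> p + (- \<kappa>) * (\<tau> p)\<^sup>2" for p
      define d where "d p = (\<Sum>i\<in>UNIV. (p $ Inl i + (- z $ i))\<^sup>2)
        + (\<Sum>j\<in>UNIV. (p $ Inr j + (- a $ j) + (- v $ j) * \<tau> p)\<^sup>2)" for p
      have p\<tau>: "real_polynomial_function \<tau>"
        unfolding \<tau>_def[abs_def]
        by (intro real_polynomial_function_sum polynomial_cmult real_polynomial_function.intros(2,3)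
          polynomial_vec_nth finite)
      have p\<phi>: "real_polynomial_function \<phi>"
        unfolding \<phi>_def[abs_def]
        by (intro real_polynomial_function.intros(2,3) polynomial_cmult real_polynomial_function_power p\<tau>)
      have pd: "real_polynomial_function d"
        unfolding d_def[abs_def]
        by (intro real_polynomial_function.intros(2,3) real_polynomial_function_sum polynomial_cmult
          real_polynomial_function_power polynomial_vec_nth p\<tau> finite)
      have d: "d p = (norm (fst_part p - z))\<^sup>2 + (norm (snd_part p - a - \<sigma> (snd_part p) *\<^sub>R v))\<^sup>2" for p
        by (simp add: d_def \<tau> norm_sq_vec fst_part_def snd_part_def mult.commute)
      \<comment> \<open>A tube around the segment. Over the ball around \<open>z\<close>, the
        penalty vanishes on the boundary of the tube only at the two end points.\<close>
      define Y where "Y = {y. 0 \<le> \<sigma> y \<and> \<sigma> y \<le> 1 \<and> norm (y - a - \<sigma> y *\<^sub>R v) \<le> 1}"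
      define Yo where "Yo = {y. 0 < \<sigma> y \<and> \<sigma> y < 1 \<and> norm (y - a - \<sigma> y *\<^sub>R v) < 1}"
      have c\<sigma>: "continuous_on S \<sigma>" for S unfolding \<sigma>_def by (intro continuous_intros) (use vv in auto)
      have clY: "closed Y" unfolding Y_def
        by (intro closed_Collect_conj closed_Collect_le continuous_intros c\<sigma>)
      have opY: "open Yo" unfolding Yo_def
        by (intro open_Collect_conj open_Collect_less continuous_intros c\<sigma>)
      have "bounded Y"
      proof (rule boundedI)
        fix y assume y: "y \<in> Y"
        have "norm y \<le> norm (y - a - \<sigma> y *\<^sub>R v) + norm a + norm (\<sigma> y *\<^sub>R v)"
          using norm_triangle_ineq[of "y - a - \<sigma> y *\<^sub>R v" "a + \<sigma> y *\<^sub>R v"] norm_triangle_ineq[of a "\<sigma> y *\<^sub>R v"] by simp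
        also have "norm (\<sigma> y *\<^sub>R v) \<le> norm v" using y by (simp add: Y_def mult_left_le_one_le)
        finally show "norm y \<le> 1 + norm a + norm v" using y by (simp add: Y_def)
      qed
      with clY have cY: "compact Y" by (simp add: compact_eq_bounded_closed)
      have \<sigma>a: "\<sigma> (a + s *\<^sub>R v) = s" for s using vv by (simp add: \<sigma>_def)
      have s0: "0 < s0 \<and> s0 < 1"
      proof -
        have "s0 \<noteq> 0" using n less(1) by auto
        moreover have "s0 \<noteq> 1" using n less(2) by (auto simp: v_def)
        ultimately show ?thesis using s s1 by auto
      qed
      obtain N C p where p: "p \<in> {p. fst_part p \<in> ball z R \<and> snd_part p \<in> Yo}"
        "hessian (\<lambda>p. \<phi> p + N * d p + C) p \<in> star_psd F"
      proof (rule penalized_comparison[OF sub, of "{p. fst_part p \<in> cball z R \<and> snd_part p \<in> Y}"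
            "{p. fst_part p \<in> ball z R \<and> snd_part p \<in> Yo}" \<phi> d "vjoin z (a + s0 *\<^sub>R v)"])
        show "compact {p. fst_part p \<in> cball z R \<and> snd_part p \<in> Y}"
          by (intro compact_vjoin_box cY compact_cball)
        show "open {p. fst_part p \<in> ball z R \<and> snd_part p \<in> Yo}"
          by (intro open_vjoin_box opY open_ball)
        show "{p. fst_part p \<in> cball z R \<and> snd_part p \<in> Y} \<subseteq> times_space X"
        proof
          fix p assume "p \<in> {p. fst_part p \<in> cball z R \<and> snd_part p \<in> Y}"
          then have "vjoin (fst_part p) (snd_part p) \<in> times_space X"
            using R(2) by (subst vjoin_in_times_space) auto
          then show "p \<in> times_space X" by simp
        qed
        show "{p. fst_part p \<in> ball z R \<and> snd_part p \<in> Yo} \<subseteq> {p. fst_part p \<in> cball z R \<and> snd_part p \<in> Y}"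
          by (auto simp: Y_def Yo_def)
        show "\<psi> p < ereal (\<phi> p)"
          if p: "p \<in> {p. fst_part p \<in> cball z R \<and> snd_part p \<in> Y} - {p. fst_part p \<in> ball z R \<and> snd_part p \<in> Yo}"
            and "d p = 0" for p
        proof -
          have f: "fst_part p = z" and g: "snd_part p - a - \<sigma> (snd_part p) *\<^sub>R v = 0"
            using \<open>d p = 0\<close> unfolding d by (auto simp: add_nonneg_eq_0_iff)
          then have "\<sigma> (snd_part p) = 0 \<or> \<sigma> (snd_part p) = 1"
            using p R(1) by (auto simp: Y_def Yo_def)
          then show ?thesis
          proof
            assume \<sigma>: "\<sigma> (snd_part p) = 0"
            with f g have "p = vjoin z a" using vjoin_parts[of p] by simp
            with less(1) \<sigma> show ?thesis by (simp add: \<phi>_def \<tau>)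
          next
            assume \<sigma>: "\<sigma> (snd_part p) = 1"
            with g have "snd_part p = b" by (simp add: v_def)
            with f have "p = vjoin z b" using vjoin_parts[of p] by simp
            with r(1) \<sigma> show ?thesis by (simp add: \<phi>_def \<tau> \<kappa>_def)
          qed
        qed
        show "ereal (\<phi> (vjoin z (a + s0 *\<^sub>R v))) \<le> \<psi> (vjoin z (a + s0 *\<^sub>R v))"
        proof -
          have "\<phi> (vjoin z (a + s0 *\<^sub>R v)) \<le> (1 - s0) * \<alpha> + s0 * \<beta>"
            using \<kappa> by (simp add: \<phi>_def \<tau> \<sigma>a algebra_simps)
          then have "ereal (\<phi> (vjoin z (a + s0 *\<^sub>R v))) \<le> ereal ((1 - s0) * \<alpha> + s0 * \<beta>)" by simp
          also have "\<dots> \<le> \<psi> (vjoin z (a + s0 *\<^sub>R v))" using n by simp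
          finally show ?thesis .
        qed
      qed (use p\<phi> pd R s0 \<sigma>a in \<open>auto simp: d Y_def\<close>)
      let ?H = "hessian (\<lambda>p. \<phi> p + N * d p + C) p" and ?w = "vjoin 0 v :: real^('n + 'm)"
      have p\<Phi>: "real_polynomial_function (\<lambda>p. \<phi> p + N * d p + C)"
        by (intro real_polynomial_function.intros(2,3) polynomial_cmult p\<phi> pd)
      have \<tau>w: "\<tau> (p + s *\<^sub>R ?w) = \<tau> p + s" for s
      proof -
        have "snd_part (p + s *\<^sub>R ?w) = snd_part p + s *\<^sub>R v"
          by (simp add: snd_part_def vec_eq_iff)
        then show ?thesis using vv unfolding \<tau> \<sigma>_def
          by (simp add: inner_add_left inner_diff_left add_divide_distrib diff_divide_distrib)
      qed
      \<comment> \<open>Translation by \<open>v\<close> runs parallel to the line, so the penalty is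
        constant along it and \<open>N\<close> disappears from the second difference.\<close>
      have dw: "d (p + s *\<^sub>R ?w) = d p" for s
        unfolding d_def \<tau>w by (simp add: algebra_simps)
      have "second_difference (\<lambda>p. \<phi> p + N * d p + C) p ?w s = - 2 * \<kappa>" if "s \<noteq> 0" for s
      proof -
        have "\<phi> (p + s *\<^sub>R ?w) + \<phi> (p + (- s) *\<^sub>R ?w) - 2 * \<phi> p = - 2 * \<kappa> * s\<^sup>2"
          unfolding \<phi>_def \<tau>w by (simp add: power2_eq_square algebra_simps)
        then show ?thesis using that dw[of s] dw[of "- s"]
          by (simp add: second_difference_def field_simps)
      qed
      then have "(second_difference (\<lambda>p. \<phi> p + N * d p + C) p ?w \<longlongrightarrow> - 2 * \<kappa>) (at 0)"
        by (intro tendsto_eventually) (auto simp: eventually_at_filter)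
      from LIM_unique[OF this poly_second_difference_tendsto[OF p\<Phi>]]
      have "?w \<bullet> (?H *v ?w) = - 2 * \<kappa>" by simp
      moreover have "0 \<le> v \<bullet> (lower_block ?H *v v)"
        using p(2) by (simp add: star_psd_def psd_matrices_def)
      ultimately show False using \<kappa> by (simp add: inner_lower_block)
    qed
  qed
  with eqs show "s1 *\<^sub>R pa + s0 *\<^sub>R pb \<in> ?E" by simp
qed


section \<open>Penalties along graphs\<close>

lemma directional_difference_quotient_tendsto:
  assumes "real_polynomial_function f"
  shows "((\<lambda>s. (f (z + s *\<^sub>R h) - f z) / s) \<longlongrightarrow> gradient f z \<bullet> h) (at 0)"
proof -
  have D: "(f has_derivative (\<lambda>v. gradient f z \<bullet> v)) (at (z + 0 *\<^sub>R h))"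
    using has_derivative_gradient[OF polynomial_differentiable[OF assms], of z] by simp
  have L: "((\<lambda>s. z + s *\<^sub>R h) has_derivative (\<lambda>r. r *\<^sub>R h)) (at 0)"
    by (auto intro!: derivative_eq_intros)
  have "((\<lambda>s. f (z + s *\<^sub>R h)) has_real_derivative gradient f z \<bullet> h) (at 0)"
    using has_derivative_compose[OF L D] unfolding has_field_derivative_def
    by (rule has_derivative_eq_rhs) auto
  then show ?thesis by (simp add: DERIV_def)
qed

text \<open>Along the tangent of the graph of \<open>g\<close> the square \<open>(b - g z)\<^sup>2\<close> has no contribution of first order
  squared; the remaining term is linear in the Hessian of \<open>g\<close>.\<close>

lemma graph_penalty_second_difference:
  assumes g: "real_polynomial_function g" and y: "y = gradient g z \<bullet> h"
  shows "((\<lambda>s. ((b + s * y - g (z + s *\<^sub>R h))\<^sup>2 + (b - s * y - g (z - s *\<^sub>R h))\<^sup>2 - 2 * (b - g z)\<^sup>2) / s\<^sup>2)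
    \<longlongrightarrow> - 2 * (b - g z) * (h \<bullet> (hessian g z *v h))) (at 0)"
proof -
  \<comment> \<open>First-order remainders of \<open>g\<close> in the two directions, divided by
    \<open>s\<close>; they tend to 0 because \<open>y\<close> is the slope of the graph.\<close>
  define p where "p s = (g (z + s *\<^sub>R h) - g z) / s - y" for s
  define q where "q s = (g (z - s *\<^sub>R h) - g z) / s + y" for s
  have "(p \<longlongrightarrow> y - y) (at 0)"
    unfolding p_def y by (intro tendsto_diff directional_difference_quotient_tendsto g tendsto_const)
  moreover have "(q \<longlongrightarrow> - y + y) (at 0)"
    using directional_difference_quotient_tendsto[OF g, of z "- h"]
    unfolding q_def[abs_def] y by (intro tendsto_add tendsto_const) (simp_all)
  ultimately have "((\<lambda>s. - 2 * (b - g z) * second_difference g z h s + (p s)\<^sup>2 + (q s)\<^sup>2)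
    \<longlongrightarrow> - 2 * (b - g z) * (h \<bullet> (hessian g z *v h)) + 0\<^sup>2 + 0\<^sup>2) (at 0)"
    by (intro tendsto_add tendsto_power tendsto_mult tendsto_const poly_second_difference_tendsto g) simp_all
  moreover have "\<forall>\<^sub>F s in at 0. - 2 * (b - g z) * second_difference g z h s + (p s)\<^sup>2 + (q s)\<^sup>2 =
    ((b + s * y - g (z + s *\<^sub>R h))\<^sup>2 + (b - s * y - g (z - s *\<^sub>R h))\<^sup>2 - 2 * (b - g z)\<^sup>2) / s\<^sup>2"
    unfolding eventually_at_filter
  proof (intro always_eventually allI impI)
    fix s :: real assume s: "s \<noteq> 0"
    define A where "A = g (z + s *\<^sub>R h) - g z - s * y"
    define B where "B = g (z - s *\<^sub>R h) - g z + s * y"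
    have "p s = A / s" "q s = B / s" using s by (simp_all add: p_def q_def A_def B_def diff_divide_distrib add_divide_distrib)
    moreover have "second_difference g z h s = (A + B) / s\<^sup>2" by (simp add: second_difference_def A_def B_def)
    moreover have "b + s * y - g (z + s *\<^sub>R h) = (b - g z) - A" "b - s * y - g (z - s *\<^sub>R h) = (b - g z) - B"
      by (simp_all add: A_def B_def)
    moreover have "- 2 * e * ((A + B) / s\<^sup>2) + (A / s)\<^sup>2 + (B / s)\<^sup>2 = ((e - A)\<^sup>2 + (e - B)\<^sup>2 - 2 * e\<^sup>2) / s\<^sup>2" for e
      using s by (simp add: power_divide add_divide_distrib[symmetric] power2_eq_square algebra_simps)
    ultimately show "- 2 * (b - g z) * second_difference g z h s + (p s)\<^sup>2 + (q s)\<^sup>2 =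
      ((b + s * y - g (z + s *\<^sub>R h))\<^sup>2 + (b - s * y - g (z - s *\<^sub>R h))\<^sup>2 - 2 * (b - g z)\<^sup>2) / s\<^sup>2"
      by (simp only: times_divide_eq_right[symmetric])
  qed
  ultimately show ?thesis using tendsto_cong by fastforce
qed

context trace_operator
begin

text \<open>The comparison principle along the graph of a harmonic map. The terms
  \<open>t i * p i z\<close> are invisible to the operator, so the bound \<open>u\<close> plus these
  terms stays a strict supersolution for every choice of \<open>t\<close> and carries a bound from
  the sphere to the centre.\<close>

lemma interpolation:
  fixes \<psi> :: "real^('n + 'm::finite) \<Rightarrow> ereal" and y :: "'i \<Rightarrow> real^'m"
  assumes sub: "subharmonic_on (star_psd F) (times_space X) \<psi>"
    and F: "\<And>A. A \<in> F \<Longrightarrow> c \<le> Q \<bullet> A" and Fsym: "F \<subseteq> sym_matrices"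
    and R: "R > 0" "cball a R \<subseteq> X"
    and I: "finite I"
    and p: "\<And>i. i \<in> I \<Longrightarrow> real_polynomial_function (p i)"
      "\<And>i z. i \<in> I \<Longrightarrow> Q \<bullet> hessian (p i) z = 0"
      "\<And>i z. i \<in> I \<Longrightarrow> z \<in> cball a R \<Longrightarrow> 0 \<le> p i z"
      "\<And>z. z \<in> cball a R \<Longrightarrow> (\<Sum>i\<in>I. p i z) = 1"
    and u: "real_polynomial_function u" "\<And>z. Q \<bullet> hessian u z < c"
    and bd: "\<And>z. z \<in> sphere a R \<Longrightarrow>
      \<psi> (vjoin z (\<Sum>i\<in>I. p i z *\<^sub>R y i)) < ereal (u z + (\<Sum>i\<in>I. t i * p i z))"
  shows "\<psi> (vjoin a (\<Sum>i\<in>I. p i a *\<^sub>R y i)) < ereal (u a + (\<Sum>i\<in>I. t i * p i a))"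
proof (rule ccontr)
  assume n: "\<not> ?thesis"
  define w where "w z = u z + (\<Sum>i\<in>I. t i * p i z)" for z
  define g where "g j z = (\<Sum>i\<in>I. (y i $ j) * p i z)" for j z
  define \<gamma> where "\<gamma> z = (\<Sum>i\<in>I. p i z *\<^sub>R y i)" for z
  have \<gamma>: "\<gamma> z $ j = g j z" for z j by (simp add: \<gamma>_def g_def mult.commute)
  \<comment> \<open>The graph stays within radius \<open>B\<close>, so in the box of fibre radius
    \<open>B + 1\<close> it leaves the interior only over the sphere, where \<open>bd\<close>
    applies.\<close>
  define B where "B = (\<Sum>i\<in>I. norm (y i))"
  have \<gamma>B: "norm (\<gamma> z) \<le> B" if "z \<in> cball a R" for z
  proof -
    have "norm (\<gamma> z) \<le> (\<Sum>i\<in>I. norm (p i z *\<^sub>R y i))" unfolding \<gamma>_def by (rule norm_sum)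
    also have "\<dots> \<le> (\<Sum>i\<in>I. norm (y i))"
    proof (rule sum_mono)
      fix i assume i: "i \<in> I"
      have "p i z \<le> (\<Sum>i\<in>I. p i z)" using i I p(3) that by (intro member_le_sum) auto
      then have "p i z \<le> 1" using p(4)[OF that] by simp
      then show "norm (p i z *\<^sub>R y i) \<le> norm (y i)" using p(3)[OF i that] by (simp add: mult_left_le_one_le)
    qed
    finally show ?thesis by (simp add: B_def)
  qed
  have B0: "0 \<le> B" unfolding B_def by (intro sum_nonneg) auto
  have pw: "real_polynomial_function w" and pg: "\<And>j. real_polynomial_function (g j)"
    unfolding w_def[abs_def] g_def[abs_def]
    by (intro real_polynomial_function.intros(3) real_polynomial_function_sum polynomial_cmult I p u; assumption)+
  have Lw: "Q \<bullet> hessian w z < c" for z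
  proof -
    have "hessian w z = hessian u z + (\<Sum>i\<in>I. t i *\<^sub>R hessian (p i) z)"
      unfolding w_def[abs_def] using u(1) p(1) I
      by (simp add: hessian_add hessian_sum hessian_cmult real_polynomial_function_sum polynomial_cmult)
    then show ?thesis using u(2)[of z] by (simp add: inner_add_right inner_sum_right p(2))
  qed
  have Lg: "Q \<bullet> hessian (g j) z = 0" for j z
    unfolding g_def[abs_def] using p(1) I
    by (simp add: hessian_sum hessian_cmult polynomial_cmult inner_sum_right p(2))
  define d where "d q = (\<Sum>j\<in>UNIV. (q $ Inr j + (- 1) * g j (fst_part q))\<^sup>2)" for q
  have pd: "real_polynomial_function d"
    unfolding d_def[abs_def]
    by (intro real_polynomial_function_sum real_polynomial_function_power real_polynomial_function.intros(3)
      polynomial_cmult polynomial_fst_part pg polynomial_vec_nth finite)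
  have d: "d q = (norm (snd_part q - \<gamma> (fst_part q)))\<^sup>2" for q
    by (simp add: d_def norm_sq_vec snd_part_def \<gamma>)
  have pw': "real_polynomial_function (\<lambda>q. w (fst_part q))" by (intro polynomial_fst_part pw)
  have ball_a: "a \<in> cball a R" using R(1) by simp
  obtain N C q where q: "q \<in> {q. fst_part q \<in> ball a R \<and> snd_part q \<in> ball 0 (B + 1)}"
    "hessian (\<lambda>q. w (fst_part q) + N * d q + C) q \<in> star_psd F"
  proof (rule penalized_comparison[OF sub, of "{q. fst_part q \<in> cball a R \<and> snd_part q \<in> cball 0 (B + 1)}"
        "{q. fst_part q \<in> ball a R \<and> snd_part q \<in> ball 0 (B + 1)}" "\<lambda>q. w (fst_part q)" d "vjoin a (\<gamma> a)"])
    show "compact {q. fst_part q \<in> cball a R \<and> snd_part q \<in> cball (0::real^'m) (B + 1)}"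
      by (intro compact_vjoin_box compact_cball)
    show "open {q. fst_part q \<in> ball a R \<and> snd_part q \<in> ball (0::real^'m) (B + 1)}"
      by (intro open_vjoin_box open_ball)
    show "{q. fst_part q \<in> cball a R \<and> snd_part q \<in> cball (0::real^'m) (B + 1)} \<subseteq> times_space X"
    proof
      fix q assume "q \<in> {q. fst_part q \<in> cball a R \<and> snd_part q \<in> cball (0::real^'m) (B + 1)}"
      then have "vjoin (fst_part q) (snd_part q) \<in> times_space X"
        using R(2) by (subst vjoin_in_times_space) auto
      then show "q \<in> times_space X" by simp
    qed
    show "\<psi> q < ereal (w (fst_part q))"
      if q: "q \<in> {q. fst_part q \<in> cball a R \<and> snd_part q \<in> cball 0 (B + 1)} - {q. fst_part q \<in> ball a R \<and> snd_part q \<in> ball 0 (B + 1)}"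
        and "d q = 0" for q
    proof -
      have s: "snd_part q = \<gamma> (fst_part q)" using \<open>d q = 0\<close> by (simp add: d)
      then have "norm (snd_part q) < B + 1" using q \<gamma>B[of "fst_part q"] by auto
      then have "fst_part q \<in> sphere a R" using q by auto
      from bd[OF this] have "\<psi> (vjoin (fst_part q) (snd_part q)) < ereal (w (fst_part q))"
        unfolding s by (simp add: w_def \<gamma>_def)
      then show ?thesis by simp
    qed
    show "ereal (w (fst_part (vjoin a (\<gamma> a)))) \<le> \<psi> (vjoin a (\<gamma> a))"
      using n by (simp add: w_def \<gamma>_def)
  qed (use pw' pd R B0 \<gamma>B[OF ball_a] in \<open>auto simp: d\<close>)
  define z where "z = fst_part q"
  define b where "b = snd_part q"
  have qz: "q = vjoin z b" by (simp add: z_def b_def)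
  let ?H = "hessian (\<lambda>q. w (fst_part q) + N * d q + C) q"
  have p\<Phi>: "real_polynomial_function (\<lambda>q. w (fst_part q) + N * d q + C)"
    by (intro real_polynomial_function.intros(2,3) polynomial_cmult pw' pd)
  \<comment> \<open>For this \<open>\<Gamma>\<close> the penalty contributes to the pullback only multiples of the Hessians of the \<open>g j\<close>,
    which are orthogonal to \<open>Q\<close>; hence the bound does not depend on \<open>N\<close>.\<close>
  define \<Gamma> where "\<Gamma> = (\<chi> j. gradient (g j) z)"
  have \<Gamma>: "(\<Gamma> *v h) $ j = gradient (g j) z \<bullet> h" for h j
    by (simp add: \<Gamma>_def matrix_vector_mul_component)
  define M where "M = hessian w z + (\<Sum>j\<in>UNIV. (N * (- 2 * (b $ j - g j z))) *\<^sub>R hessian (g j) z)"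
  have pb: "graph_pullback \<Gamma> ?H \<in> F" using q(2) by (simp add: star_psd_def)
  have "graph_pullback \<Gamma> ?H = M"
  proof (rule sym_matrix_eqI)
    show "transpose (graph_pullback \<Gamma> ?H) = graph_pullback \<Gamma> ?H" using pb Fsym by (auto simp: sym_matrices_def)
    have tadd: "transpose (A + A') = transpose A + transpose A'"
      "transpose (r *\<^sub>R A) = r *\<^sub>R transpose A" for A A' :: "real^'n^'n" and r
      by (simp_all add: transpose_def vec_eq_iff)
    have tsum: "transpose (\<Sum>j\<in>J. f j) = (\<Sum>j\<in>J. transpose (f j))" for f :: "'m \<Rightarrow> real^'n^'n" and J
      by (simp add: transpose_def vec_eq_iff)
    show "transpose M = M"
      by (simp add: M_def tadd tsum poly_transpose_hessian[OF pw] poly_transpose_hessian[OF pg])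
    fix h :: "real^'n"
    let ?w = "vjoin h (\<Gamma> *v h)"
    have eq: "second_difference (\<lambda>q. w (fst_part q) + N * d q + C) q ?w s = second_difference w z h s +
      N * (\<Sum>j\<in>UNIV. ((b $ j + s * (\<Gamma> *v h) $ j - g j (z + s *\<^sub>R h))\<^sup>2
         + (b $ j - s * (\<Gamma> *v h) $ j - g j (z - s *\<^sub>R h))\<^sup>2 - 2 * (b $ j - g j z)\<^sup>2) / s\<^sup>2)" for s
    proof -
      have "(\<Sum>j\<in>UNIV. ((b $ j + s * (\<Gamma> *v h) $ j - g j (z + s *\<^sub>R h))\<^sup>2
         + (b $ j - s * (\<Gamma> *v h) $ j - g j (z - s *\<^sub>R h))\<^sup>2 - 2 * (b $ j - g j z)\<^sup>2) / s\<^sup>2)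
        = (d (q + s *\<^sub>R ?w) + d (q - s *\<^sub>R ?w) - 2 * d q) / s\<^sup>2"
        unfolding qz vjoin_add_scaleR d_def
        by (simp add: sum_divide_distrib sum.distrib sum_subtractf sum_distrib_left add_divide_distrib diff_divide_distrib)
      then show ?thesis
        unfolding second_difference_def
        by (simp only:) (simp add: qz vjoin_add_scaleR add_divide_distrib diff_divide_distrib distrib_left
          right_diff_distrib)
    qed
    have lim: "((\<lambda>s. second_difference w z h s +
      N * (\<Sum>j\<in>UNIV. ((b $ j + s * (\<Gamma> *v h) $ j - g j (z + s *\<^sub>R h))\<^sup>2
         + (b $ j - s * (\<Gamma> *v h) $ j - g j (z - s *\<^sub>R h))\<^sup>2 - 2 * (b $ j - g j z)\<^sup>2) / s\<^sup>2)) \<longlongrightarrow>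
      h \<bullet> (hessian w z *v h) + N * (\<Sum>j\<in>UNIV. - 2 * (b $ j - g j z) * (h \<bullet> (hessian (g j) z *v h)))) (at 0)"
      by (intro tendsto_add tendsto_mult tendsto_const tendsto_sum poly_second_difference_tendsto pw
        graph_penalty_second_difference pg \<Gamma>)
    have "(second_difference (\<lambda>q. w (fst_part q) + N * d q + C) q ?w \<longlongrightarrow>
      h \<bullet> (hessian w z *v h) + N * (\<Sum>j\<in>UNIV. - 2 * (b $ j - g j z) * (h \<bullet> (hessian (g j) z *v h)))) (at 0)"
      unfolding ext[OF eq] by (rule lim)
    from LIM_unique[OF poly_second_difference_tendsto[OF p\<Phi>] this]
    have "?w \<bullet> (?H *v ?w) = h \<bullet> (hessian w z *v h) + N * (\<Sum>j\<in>UNIV. - 2 * (b $ j - g j z) * (h \<bullet> (hessian (g j) z *v h)))" .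
    also have "\<dots> = h \<bullet> (M *v h)"
    proof -
      interpret mv: bounded_linear "\<lambda>A::real^'n^'n. A *v h"
        by (rule linear_conv_bounded_linear[THEN iffD1])
          (rule linearI; simp add: matrix_vector_mult_add_rdistrib scaleR_matrix_vector_assoc[symmetric])
      show ?thesis
        by (simp add: M_def mv.add mv.sum mv.scaleR inner_add_right inner_sum_right sum_distrib_left mult.assoc)
    qed
    finally show "h \<bullet> (graph_pullback \<Gamma> ?H *v h) = h \<bullet> (M *v h)" by (simp add: inner_graph_pullback)
  qed
  with F[OF pb] have "c \<le> Q \<bullet> M" by simp
  also have "Q \<bullet> M = Q \<bullet> hessian w z" by (simp add: M_def inner_add_right inner_sum_right Lg)
  finally show False using Lw[of z] by simp
qed

end

section \<open>The Prekopa-Leindler inequality for finitely many functions\<close>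

lemma emeasure_affine_image:
  fixes A :: "real set"
  assumes A: "compact A" and c: "c > 0"
  shows "emeasure lborel ((\<lambda>x. t + c * x) ` A) = ennreal c * emeasure lborel A"
proof -
  have cA: "compact ((\<lambda>x. t + c * x) ` A)"
    by (intro compact_continuous_image continuous_intros A)
  then have m: "(\<lambda>x. t + c * x) ` A \<in> sets borel" by (rule borel_compact)
  have "emeasure lborel ((\<lambda>x. t + c * x) ` A) = (\<integral>\<^sup>+x. indicator ((\<lambda>x. t + c * x) ` A) x \<partial>lborel)"
    using m by simp
  also have "\<dots> = \<bar>c\<bar> * (\<integral>\<^sup>+x. indicator ((\<lambda>x. t + c * x) ` A) (t + c * x) \<partial>lborel)"
    using c m by (intro nn_integral_real_affine) auto
  also have "(\<lambda>x. indicator ((\<lambda>x. t + c * x) ` A) (t + c * x) :: ennreal) = indicator A"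
    using c by (auto simp: fun_eq_iff indicator_def)
  finally show ?thesis using c borel_compact[OF A] by simp
qed

text \<open>The translates of \<open>A\<close> by the minimum of \<open>B\<close> and of
  \<open>B\<close> by the maximum of \<open>A\<close> both lie in the sumset and meet in at most one
  point.\<close>

lemma brunn_minkowski_two:
  fixes A B :: "real set"
  assumes A: "compact A" "A \<noteq> {}" and B: "compact B" "B \<noteq> {}"
  shows "emeasure lborel A + emeasure lborel B \<le> emeasure lborel {x + y | x y. x \<in> A \<and> y \<in> B}"
proof -
  let ?C = "{x + y | x y. x \<in> A \<and> y \<in> B}"
  obtain m where m: "m \<in> A" "\<And>x. x \<in> A \<Longrightarrow> x \<le> m" using compact_attains_sup[OF A] by blast
  obtain n where n: "n \<in> B" "\<And>x. x \<in> B \<Longrightarrow> n \<le> x" using compact_attains_inf[OF B] by blast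
  let ?P = "(\<lambda>x. n + 1 * x) ` A" and ?R = "(\<lambda>x. m + 1 * x) ` B"
  have cP: "compact ?P" and cR: "compact ?R"
    by (intro compact_continuous_image continuous_intros A B)+
  have mP: "?P \<in> sets borel" and mR: "?R \<in> sets borel" using cP cR by (auto intro: borel_compact)
  have "?P \<inter> ?R \<subseteq> {m + n}"
  proof
    fix x assume "x \<in> ?P \<inter> ?R"
    then obtain y z where "x = n + 1 * y" "y \<in> A" "x = m + 1 * z" "z \<in> B" by blast
    with m(2)[of y] n(2)[of z] show "x \<in> {m + n}" by simp
  qed
  then have "emeasure lborel (?P \<inter> ?R) \<le> emeasure lborel {m + n}"
    by (intro emeasure_mono) auto
  then have I: "emeasure lborel (?P \<inter> ?R) = 0" by simp
  have "emeasure lborel A + emeasure lborel B = emeasure lborel ?P + emeasure lborel ?R"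
    using emeasure_affine_image[OF A(1), of 1 n] emeasure_affine_image[OF B(1), of 1 m] by simp
  also have "\<dots> = emeasure lborel (?P \<union> ?R)"
    using emeasure_Un_Int[of ?P lborel ?R] mP mR I by simp
  also have "\<dots> \<le> emeasure lborel ?C"
  proof (rule emeasure_mono)
    show "?C \<in> sets lborel" using borel_compact[OF compact_sums[OF A(1) B(1)]] by simp
    show "?P \<union> ?R \<subseteq> ?C"
    proof (intro Un_least image_subsetI)
      show "n + 1 * x \<in> ?C" if "x \<in> A" for x
        using that n(1) by (simp add: add.commute[of n]) blast
      show "m + 1 * x \<in> ?C" if "x \<in> B" for x
        using that m(1) by simp blast
    qed
  qed
  finally show ?thesis .
qed

text \<open>A compact subset of the sumset is produced instead of the sumset itself; this keeps the
  induction on two-set sums and spares a separate proof of compactness.\<close>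

lemma brunn_minkowski_compact:
  fixes K :: "'i \<Rightarrow> real set"
  assumes "finite I" "\<And>i. i \<in> I \<Longrightarrow> compact (K i)" "\<And>i. i \<in> I \<Longrightarrow> K i \<noteq> {}"
  shows "\<exists>C. compact C \<and> C \<noteq> {} \<and> C \<subseteq> {\<Sum>i\<in>I. a i | a. \<forall>i\<in>I. a i \<in> K i} \<and>
    (\<Sum>i\<in>I. emeasure lborel (K i)) \<le> emeasure lborel C"
  using assms
proof (induction I)
  case empty
  show ?case by (intro exI[of _ "{0}"]) auto
next
  case (insert j I)
  then obtain C where C: "compact C" "C \<noteq> {}" "C \<subseteq> {\<Sum>i\<in>I. a i | a. \<forall>i\<in>I. a i \<in> K i}"
    "(\<Sum>i\<in>I. emeasure lborel (K i)) \<le> emeasure lborel C" by auto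
  let ?D = "{x + y | x y. x \<in> K j \<and> y \<in> C}"
  have "compact ?D" using compact_sums insert.prems(1) C(1) by blast
  moreover have "?D \<noteq> {}" using insert.prems(2) C(2) by blast
  moreover have "?D \<subseteq> {\<Sum>i\<in>insert j I. a i | a. \<forall>i\<in>insert j I. a i \<in> K i}"
  proof clarify
    fix x y assume x: "x \<in> K j" and "y \<in> C"
    then obtain a where a: "y = (\<Sum>i\<in>I. a i)" "\<forall>i\<in>I. a i \<in> K i" using C(3) by blast
    have "x + y = (\<Sum>i\<in>insert j I. (a(j := x)) i)"
      using insert.hyps unfolding a(1) by (simp add: sum.insert_if) (intro sum.cong, auto)
    then show "\<exists>a. x + y = (\<Sum>i\<in>insert j I. a i) \<and> (\<forall>i\<in>insert j I. a i \<in> K i)"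
      using x a(2) by (intro exI[of _ "a(j := x)"]) auto
  qed
  moreover have "(\<Sum>i\<in>insert j I. emeasure lborel (K i)) \<le> emeasure lborel ?D"
  proof -
    have "(\<Sum>i\<in>insert j I. emeasure lborel (K i)) \<le> emeasure lborel (K j) + emeasure lborel C"
      using insert.hyps C(4) by (simp add: add_left_mono)
    also have "\<dots> \<le> emeasure lborel ?D"
      using insert.prems C(1,2) by (intro brunn_minkowski_two) auto
    finally show ?thesis .
  qed
  ultimately show ?case by blast
qed

text \<open>Up to a null set a Borel set is a countable union of compact sets. A fixed point is
  added to each finite union to keep the approximations non-empty.\<close>

lemma compact_inner_approximation:
  fixes A :: "real set"
  assumes A: "A \<in> sets borel" "A \<noteq> {}"
  obtains K :: "nat \<Rightarrow> real set" where "\<And>n. compact (K n)" "\<And>n. K n \<noteq> {}" "\<And>n. K n \<subseteq> A"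
    "(\<lambda>n. emeasure lborel (K n)) \<longlonglongrightarrow> emeasure lborel A"
proof -
  obtain a where a: "a \<in> A" using A(2) by blast
  have "A \<in> sets lebesgue" using A(1) by simp
  then obtain C T where CT: "fsigma C" "T \<in> null_sets lebesgue" "C \<union> T = A"
    using lebesgue_set_almost_fsigma by metis
  obtain F :: "nat \<Rightarrow> real set" where F: "range F \<subseteq> Collect compact" "C = \<Union>(F ` UNIV)"
    using CT(1) fsigma_Union_compact by blast
  define G where "G n = insert a (\<Union>k\<le>n. F k)" for n
  have cG: "compact (G n)" for n
    unfolding G_def using F(1) by (intro compact_insert compact_UN) auto
  have GA: "G n \<subseteq> A" for n using a F(2) CT(3) by (auto simp: G_def)
  have incG: "incseq G" by (auto simp: incseq_def G_def)
  have "(\<Union>n. G n) = insert a C" using F(2) by (auto simp: G_def)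
  moreover have "(\<lambda>n. emeasure lborel (G n)) \<longlonglongrightarrow> emeasure lborel (\<Union>n. G n)"
    using cG incG by (intro Lim_emeasure_incseq) (auto intro: borel_compact)
  moreover have "emeasure lborel (insert a C) = emeasure lborel A"
  proof (rule antisym)
    have mC: "insert a C \<in> sets borel"
      using cG unfolding \<open>(\<Union>n. G n) = insert a C\<close>[symmetric] by (intro sets.countable_UN) (auto intro: borel_compact)
    show "emeasure lborel (insert a C) \<le> emeasure lborel A"
      using A(1) a CT(3) by (intro emeasure_mono) auto
    have "emeasure lebesgue A \<le> emeasure lebesgue (insert a C \<union> T)"
      using mC CT null_setsD2[OF CT(2)] by (intro emeasure_mono sets.Un) auto
    also have "\<dots> = emeasure lebesgue (insert a C)"
      using mC CT(2) by (intro emeasure_Un_null_set) auto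
    finally show "emeasure lborel A \<le> emeasure lborel (insert a C)"
      using A(1) mC by simp
  qed
  ultimately show thesis using cG GA by (intro that[of G]) (auto simp: G_def)
qed

text \<open>Sums of Borel sets need not be Borel, so the conclusion is about an arbitrary Borel set
  \<open>S\<close> that contains the weighted sums.\<close>

lemma brunn_minkowski:
  fixes A :: "'i \<Rightarrow> real set"
  assumes I: "finite I" and A: "\<And>i. i \<in> I \<Longrightarrow> A i \<in> sets borel" "\<And>i. i \<in> I \<Longrightarrow> A i \<noteq> {}"
    and l: "\<And>i. i \<in> I \<Longrightarrow> 0 < l i"
    and S: "S \<in> sets borel" "\<And>a. (\<And>i. i \<in> I \<Longrightarrow> a i \<in> A i) \<Longrightarrow> (\<Sum>i\<in>I. l i * a i) \<in> S"
  shows "(\<Sum>i\<in>I. ennreal (l i) * emeasure lborel (A i)) \<le> emeasure lborel S"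
proof -
  have "\<exists>K::nat \<Rightarrow> real set. (\<forall>n. compact (K n) \<and> K n \<noteq> {} \<and> K n \<subseteq> A i) \<and>
    (\<lambda>n. emeasure lborel (K n)) \<longlonglongrightarrow> emeasure lborel (A i)" if "i \<in> I" for i
    using compact_inner_approximation[OF A[OF that]] by metis
  then obtain K :: "'i \<Rightarrow> nat \<Rightarrow> real set" where K: "\<And>i n. i \<in> I \<Longrightarrow> compact (K i n)" "\<And>i n. i \<in> I \<Longrightarrow> K i n \<noteq> {}"
    "\<And>i n. i \<in> I \<Longrightarrow> K i n \<subseteq> A i" "\<And>i. i \<in> I \<Longrightarrow> (\<lambda>n. emeasure lborel (K i n)) \<longlonglongrightarrow> emeasure lborel (A i)"
    by metis
  have "(\<lambda>n. \<Sum>i\<in>I. ennreal (l i) * emeasure lborel (K i n)) \<longlonglongrightarrow> (\<Sum>i\<in>I. ennreal (l i) * emeasure lborel (A i))"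
    by (intro tendsto_sum ennreal_tendsto_cmult K(4)) auto
  then show ?thesis
  proof (rule LIMSEQ_le_const2, intro exI allI impI)
    fix n
    have cK: "compact ((\<lambda>x. 0 + l i * x) ` K i n)" if "i \<in> I" for i
      by (intro compact_continuous_image continuous_intros K(1) that)
    obtain C where C: "compact C" "C \<subseteq> {\<Sum>i\<in>I. a i | a. \<forall>i\<in>I. a i \<in> (\<lambda>x. 0 + l i * x) ` K i n}"
      "(\<Sum>i\<in>I. emeasure lborel ((\<lambda>x. 0 + l i * x) ` K i n)) \<le> emeasure lborel C"
      using brunn_minkowski_compact[OF I, of "\<lambda>i. (\<lambda>x. 0 + l i * x) ` K i n"] cK K(2) by blast
    have "(\<Sum>i\<in>I. ennreal (l i) * emeasure lborel (K i n)) = (\<Sum>i\<in>I. emeasure lborel ((\<lambda>x. 0 + l i * x) ` K i n))"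
      using K(1) l by (intro sum.cong refl emeasure_affine_image[symmetric])
    also note C(3)
    also have "emeasure lborel C \<le> emeasure lborel S"
    proof (rule emeasure_mono)
      show "C \<subseteq> S"
      proof
        fix x assume "x \<in> C"
        then obtain a where a: "x = (\<Sum>i\<in>I. a i)" "\<forall>i\<in>I. a i \<in> (\<lambda>x. 0 + l i * x) ` K i n" using C(2) by blast
        then have "\<forall>i\<in>I. \<exists>b\<in>K i n. a i = l i * b" by auto
        then obtain b where b: "\<And>i. i \<in> I \<Longrightarrow> b i \<in> K i n" "\<And>i. i \<in> I \<Longrightarrow> a i = l i * b i" by metis
        then have "x = (\<Sum>i\<in>I. l i * b i)" unfolding a(1) by (intro sum.cong) auto
        also have "\<dots> \<in> S" using b(1) K(3) by (intro S(2)) auto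
        finally show "x \<in> S" .
      qed
    qed (use S in simp)
    finally show "(\<Sum>i\<in>I. ennreal (l i) * emeasure lborel (K i n)) \<le> emeasure lborel S" .
  qed
qed

section \<open>Layer-cake formulas\<close>

lemma
  fixes P :: "real \<Rightarrow> real \<Rightarrow> bool"
  assumes [measurable]: "Measurable.pred (borel \<Otimes>\<^sub>M borel) (case_prod P)"
  shows borel_measurable_superlevel: "(\<lambda>y. emeasure lborel {u\<in>{0<..<1}. P y u}) \<in> borel_measurable borel"
    and nn_integral_superlevel: "(\<integral>\<^sup>+y. emeasure lborel {u\<in>{0<..<1}. P y u} \<partial>lborel) =
      (\<integral>\<^sup>+u. indicator {0<..<1} u * emeasure lborel {y. P y u} \<partial>lborel)"
proof -
  define f where "f y u = indicator {0<..<1} u * (if P y u then 1 else 0 :: ennreal)" for y u :: real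
  have m[measurable]: "(\<lambda>(y, u). f y u) \<in> borel_measurable (lborel \<Otimes>\<^sub>M lborel)"
    unfolding f_def by measurable
  have sec1[measurable]: "Measurable.pred borel (P y)" for y by measurable
  have sec2[measurable]: "Measurable.pred borel (\<lambda>y. P y u)" for u by measurable
  have eq: "emeasure lborel {u\<in>{0<..<1}. P y u} = (\<integral>\<^sup>+u. f y u \<partial>lborel)" for y
  proof -
    have "f y = indicator {u\<in>{0<..<1}. P y u}" by (auto simp: f_def fun_eq_iff indicator_def)
    moreover have "{u\<in>{0<..<1}. P y u} \<in> sets lborel" by measurable
    ultimately show "emeasure lborel {u\<in>{0<..<1}. P y u} = (\<integral>\<^sup>+u. f y u \<partial>lborel)" by simp
  qed
  show "(\<lambda>y. emeasure lborel {u\<in>{0<..<1}. P y u}) \<in> borel_measurable borel"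
    unfolding eq by measurable
  have "(\<integral>\<^sup>+y. emeasure lborel {u\<in>{0<..<1}. P y u} \<partial>lborel) = (\<integral>\<^sup>+y. \<integral>\<^sup>+u. f y u \<partial>lborel \<partial>lborel)"
    unfolding eq ..
  also have "\<dots> = (\<integral>\<^sup>+u. \<integral>\<^sup>+y. f y u \<partial>lborel \<partial>lborel)"
    by (rule lborel_pair.Fubini'[symmetric]) (rule m)
  also have "\<dots> = (\<integral>\<^sup>+u. indicator {0<..<1} u * emeasure lborel {y. P y u} \<partial>lborel)"
  proof (intro nn_integral_cong)
    fix u
    have "(\<integral>\<^sup>+y. f y u \<partial>lborel) = (\<integral>\<^sup>+y. indicator {0<..<1} u * indicator {y. P y u} y \<partial>lborel)"
      by (intro nn_integral_cong) (auto simp: f_def indicator_def)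
    also have "\<dots> = indicator {0<..<1} u * emeasure lborel {y. P y u}"
      by (subst nn_integral_cmult) auto
    finally show "(\<integral>\<^sup>+y. f y u \<partial>lborel) = indicator {0<..<1} u * emeasure lborel {y. P y u}" .
  qed
  finally show "(\<integral>\<^sup>+y. emeasure lborel {u\<in>{0<..<1}. P y u} \<partial>lborel) =
      (\<integral>\<^sup>+u. indicator {0<..<1} u * emeasure lborel {y. P y u} \<partial>lborel)" .
qed

text \<open>Levels are measured as fractions \<open>u\<close> of the bound \<open>m\<close>, so that
  functions with different bounds can be compared at the same \<open>u\<close>.\<close>

lemma layer_cake_bounded:
  fixes f :: "real \<Rightarrow> ennreal"
  assumes [measurable]: "f \<in> borel_measurable borel" and m: "m > 0" and le: "\<And>y. f y \<le> ennreal m"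
  shows "(\<integral>\<^sup>+y. f y \<partial>lborel) =
    ennreal m * (\<integral>\<^sup>+u. indicator {0<..<1} u * emeasure lborel {y. ennreal (u * m) < f y} \<partial>lborel)"
proof -
  have "f y = ennreal m * emeasure lborel {u\<in>{0<..<1}. ennreal (u * m) < f y}" for y
  proof -
    obtain r where r: "f y = ennreal r" "0 \<le> r" using le[of y] by (cases "f y") (auto simp: top_unique)
    with le[of y] m have "r \<le> m" by simp
    then have "{u\<in>{0<..<1}. ennreal (u * m) < f y} = {0<..<r / m}"
      using r m by (auto simp: ennreal_less_iff pos_less_divide_eq intro: less_le_trans)
        (smt (verit) mult_less_cancel_right2)
    then show ?thesis using r m by (simp add: ennreal_mult[symmetric])
  qed
  then have "(\<integral>\<^sup>+y. f y \<partial>lborel) = (\<integral>\<^sup>+y. ennreal m * emeasure lborel {u\<in>{0<..<1}. ennreal (u * m) < f y} \<partial>lborel)"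
    by (rule nn_integral_cong)
  also have "\<dots> = ennreal m * (\<integral>\<^sup>+y. emeasure lborel {u\<in>{0<..<1}. ennreal (u * m) < f y} \<partial>lborel)"
    by (intro nn_integral_cmult) (simp add: borel_measurable_superlevel)
  also have "\<dots> = ennreal m * (\<integral>\<^sup>+u. indicator {0<..<1} u * emeasure lborel {y. ennreal (u * m) < f y} \<partial>lborel)"
    by (subst nn_integral_superlevel) auto
  finally show ?thesis .
qed


text \<open>The counterpart for a function without a known bound: counting the levels below
  \<open>m\<close> only gives a lower bound. The levels are non-strict because that is what the
  Prekopa-Leindler hypothesis delivers.\<close>

lemma layer_cake_truncated:
  fixes f :: "real \<Rightarrow> ennreal"
  assumes [measurable]: "f \<in> borel_measurable borel" and m: "m > 0"
  shows "ennreal m * (\<integral>\<^sup>+u. indicator {0<..<1} u * emeasure lborel {y. ennreal (u * m) \<le> f y} \<partial>lborel)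
    \<le> (\<integral>\<^sup>+y. f y \<partial>lborel)"
proof -
  have "ennreal m * emeasure lborel {u\<in>{0<..<1}. ennreal (u * m) \<le> f y} \<le> f y" for y
  proof (cases "f y < ennreal m")
    case True
    then obtain r where r: "f y = ennreal r" "0 \<le> r" by (cases "f y") auto
    with m have "{u\<in>{0<..<1}. ennreal (u * m) \<le> f y} \<subseteq> {0..r / m}"
      by (auto simp: pos_le_divide_eq)
    then have "emeasure lborel {u\<in>{0<..<1}. ennreal (u * m) \<le> f y} \<le> emeasure lborel {0..r / m}"
      by (intro emeasure_mono) auto
    also have "\<dots> = ennreal (r / m)" using r m by simp
    finally have "ennreal m * emeasure lborel {u\<in>{0<..<1}. ennreal (u * m) \<le> f y} \<le> ennreal m * ennreal (r / m)"
      by (rule mult_left_mono) simp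
    also have "\<dots> = f y" using r m by (simp add: ennreal_mult[symmetric])
    finally show ?thesis .
  next
    case False
    have "emeasure lborel {u\<in>{0<..<1}. ennreal (u * m) \<le> f y} \<le> emeasure lborel {0<..<1::real}"
      by (intro emeasure_mono) auto
    then have "ennreal m * emeasure lborel {u\<in>{0<..<1}. ennreal (u * m) \<le> f y} \<le> ennreal m * 1"
      by (intro mult_left_mono) auto
    with False show ?thesis by simp
  qed
  then have "(\<integral>\<^sup>+y. ennreal m * emeasure lborel {u\<in>{0<..<1}. ennreal (u * m) \<le> f y} \<partial>lborel) \<le> (\<integral>\<^sup>+y. f y \<partial>lborel)"
    by (intro nn_integral_mono)
  moreover have "(\<integral>\<^sup>+y. ennreal m * emeasure lborel {u\<in>{0<..<1}. ennreal (u * m) \<le> f y} \<partial>lborel)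
    = ennreal m * (\<integral>\<^sup>+y. emeasure lborel {u\<in>{0<..<1}. ennreal (u * m) \<le> f y} \<partial>lborel)"
    by (intro nn_integral_cmult) (simp add: borel_measurable_superlevel)
  ultimately show ?thesis
    by (subst (asm) nn_integral_superlevel) auto
qed

text \<open>Extended non-negative reals have no real powers, so weighted geometric means are expressed through
  the numbers \<open>exp (s i)\<close> below the factors; this also covers the values \<open>0\<close> and \<open>\<infinity>\<close>.\<close>

lemma prekopa_leindler_bounded:
  fixes h :: "'i \<Rightarrow> real \<Rightarrow> ennreal"
  assumes I: "finite I" "I \<noteq> {}" and l: "\<And>i. i \<in> I \<Longrightarrow> 0 < l i" "sum l I = 1"
    and h[measurable]: "\<And>i. i \<in> I \<Longrightarrow> h i \<in> borel_measurable borel" and H[measurable]: "H \<in> borel_measurable borel"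
    and bdd: "\<And>i y. i \<in> I \<Longrightarrow> h i y \<le> ennreal b"
    and hyp: "\<And>y s. (\<And>i. i \<in> I \<Longrightarrow> ennreal (exp (s i)) < h i (y i)) \<Longrightarrow>
      ennreal (exp (\<Sum>i\<in>I. l i * s i)) \<le> H (\<Sum>i\<in>I. l i * y i)"
    and s: "\<And>i. i \<in> I \<Longrightarrow> ennreal (exp (s i)) < (\<integral>\<^sup>+y. h i y \<partial>lborel)"
  shows "ennreal (exp (\<Sum>i\<in>I. l i * s i)) \<le> (\<integral>\<^sup>+y. H y \<partial>lborel)"
proof -
  define M where "M i = (SUP y. h i y)" for i
  define \<sigma> where "\<sigma> i = ln (enn2real (M i))" for i
  have M: "M i = ennreal (exp (\<sigma> i))" if i: "i \<in> I" for i
  proof -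
    have "M i \<le> ennreal b" unfolding M_def by (intro SUP_least bdd i)
    then have fin: "M i < top" by (rule order.strict_trans1) simp
    have "M i \<noteq> 0"
    proof
      assume "M i = 0"
      then have "h i y = 0" for y unfolding M_def by (metis SUP_upper UNIV_I le_zero_eq)
      then show False using s[OF i] by simp
    qed
    with fin have "0 < enn2real (M i)" by (simp add: enn2real_positive_iff zero_less_iff_neq_zero)
    with fin show ?thesis by (simp add: \<sigma>_def)
  qed
  define m where "m = exp (\<Sum>i\<in>I. l i * \<sigma> i)"
  \<comment> \<open>Scaling each level by the supremum of its function makes all
    \<open>A i u\<close> with \<open>u < 1\<close> non-empty, as Brunn-Minkowski demands. The
    weights sum to 1, so the weighted geometric mean of these levels is
    \<open>u * m\<close>.\<close>
  define A where "A i u = {y. ennreal (u * exp (\<sigma> i)) < h i y}" for i and u :: real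
  define S where "S u = {y. ennreal (u * m) \<le> H y}" for u
  have BM: "(\<Sum>i\<in>I. ennreal (l i) * emeasure lborel (A i u)) \<le> emeasure lborel (S u)" if u: "0 < u" "u < 1" for u
  proof (rule brunn_minkowski[OF I(1)])
    fix i assume i: "i \<in> I"
    show "A i u \<in> sets borel" using i unfolding A_def by measurable
    have "ennreal (u * exp (\<sigma> i)) < M i" using u M[OF i] by (simp add: ennreal_less_iff)
    then show "A i u \<noteq> {}" unfolding M_def A_def by (simp add: less_SUP_iff)
  next
    show "S u \<in> sets borel" unfolding S_def by measurable
    fix a assume a: "\<And>i. i \<in> I \<Longrightarrow> a i \<in> A i u"
    have "ennreal (exp (\<Sum>i\<in>I. l i * (ln u + \<sigma> i))) \<le> H (\<Sum>i\<in>I. l i * a i)"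
      by (rule hyp) (use a u in \<open>auto simp: A_def exp_add\<close>)
    moreover have "exp (\<Sum>i\<in>I. l i * (ln u + \<sigma> i)) = u * m"
      using u l(2) by (simp add: m_def distrib_left sum.distrib sum_distrib_right[symmetric] exp_add)
    ultimately show "(\<Sum>i\<in>I. l i * a i) \<in> S u" by (simp add: S_def)
  qed (use l in auto)
  have [measurable]: "i \<in> I \<Longrightarrow> (\<lambda>u. indicator {0<..<1} u * emeasure lborel (A i u)) \<in> borel_measurable borel" for i
  proof -
    assume [measurable]: "i \<in> I"
    have "(\<lambda>u. indicator {0<..<1} u * (\<integral>\<^sup>+y. indicator {y. ennreal (u * exp (\<sigma> i)) < h i y} y \<partial>lborel)) \<in> borel_measurable borel"
      unfolding indicator_def by measurable
    moreover have "(\<integral>\<^sup>+y. indicator {y. ennreal (u * exp (\<sigma> i)) < h i y} y \<partial>lborel) = emeasure lborel (A i u)" for u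
      unfolding A_def by (subst nn_integral_indicator) auto
    ultimately show ?thesis by simp
  qed
  define J where "J i = (\<integral>\<^sup>+u. indicator {0<..<1} u * emeasure lborel (A i u) \<partial>lborel)" for i
  have J: "ennreal (exp (s i - \<sigma> i)) \<le> J i" if i: "i \<in> I" for i
  proof -
    have "h i y \<le> ennreal (exp (\<sigma> i))" for y unfolding M[OF i, symmetric] M_def by (rule SUP_upper) simp
    then have "(\<integral>\<^sup>+y. h i y \<partial>lborel) = ennreal (exp (\<sigma> i)) * J i"
      unfolding J_def A_def using i by (intro layer_cake_bounded) auto
    with s[OF i] have "ennreal (exp (s i)) \<le> ennreal (exp (\<sigma> i)) * J i" by simp
    then have "ennreal (exp (- \<sigma> i)) * ennreal (exp (s i)) \<le> ennreal (exp (- \<sigma> i)) * (ennreal (exp (\<sigma> i)) * J i)"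
      by (rule mult_left_mono) simp
    then show ?thesis
      by (simp add: mult.assoc[symmetric] ennreal_mult[symmetric] exp_add[symmetric])
  qed
  \<comment> \<open>Brunn-Minkowski on the line yields an arithmetic mean of the normalised
    integrals; convexity of \<open>exp\<close> bounds the geometric mean by it.\<close>
  have "exp (\<Sum>i\<in>I. l i * (s i - \<sigma> i)) \<le> (\<Sum>i\<in>I. l i * exp (s i - \<sigma> i))"
    using convex_on_sum[OF I exp_convex l(2), of "\<lambda>i. s i - \<sigma> i"] l(1) by (simp add: less_imp_le)
  then have "exp (\<Sum>i\<in>I. l i * s i) \<le> m * (\<Sum>i\<in>I. l i * exp (s i - \<sigma> i))"
    unfolding m_def by (simp add: right_diff_distrib sum_subtractf exp_diff pos_divide_le_eq mult.commute)
  then have "ennreal (exp (\<Sum>i\<in>I. l i * s i)) \<le> ennreal m * (\<Sum>i\<in>I. ennreal (l i) * ennreal (exp (s i - \<sigma> i)))"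
    using l(1) by (simp add: ennreal_mult[symmetric] less_imp_le sum_nonneg m_def)
  also have "\<dots> \<le> ennreal m * (\<Sum>i\<in>I. ennreal (l i) * J i)"
    by (intro mult_left_mono sum_mono J) auto
  also have "(\<Sum>i\<in>I. ennreal (l i) * J i) =
    (\<integral>\<^sup>+u. (\<Sum>i\<in>I. ennreal (l i) * (indicator {0<..<1} u * emeasure lborel (A i u))) \<partial>lborel)"
    unfolding J_def by (subst nn_integral_sum) (auto simp: nn_integral_cmult)
  also have "\<dots> \<le> (\<integral>\<^sup>+u. indicator {0<..<1} u * emeasure lborel (S u) \<partial>lborel)"
  proof (rule nn_integral_mono)
    fix u :: real
    show "(\<Sum>i\<in>I. ennreal (l i) * (indicator {0<..<1} u * emeasure lborel (A i u))) \<le>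
      indicator {0<..<1} u * emeasure lborel (S u)"
      using BM[of u] by (auto simp: indicator_def)
  qed
  also have "ennreal m * \<dots> \<le> (\<integral>\<^sup>+y. H y \<partial>lborel)"
    unfolding S_def by (rule layer_cake_truncated) (auto simp: m_def)
  finally show ?thesis by (simp add: mult_left_mono)
qed

text \<open>The bounds \<open>s\<close> are strict, so by monotone convergence they survive
  truncation of the \<open>h i\<close> at a common large height; \<open>hyp\<close> passes to the
  truncations because they are smaller.\<close>

lemma prekopa_leindler_real:
  fixes h :: "'i \<Rightarrow> real \<Rightarrow> ennreal"
  assumes I: "finite I" "I \<noteq> {}" and l: "\<And>i. i \<in> I \<Longrightarrow> 0 < l i" "sum l I = 1"
    and h[measurable]: "\<And>i. i \<in> I \<Longrightarrow> h i \<in> borel_measurable borel" and H: "H \<in> borel_measurable borel"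
    and hyp: "\<And>y s. (\<And>i. i \<in> I \<Longrightarrow> ennreal (exp (s i)) < h i (y i)) \<Longrightarrow>
      ennreal (exp (\<Sum>i\<in>I. l i * s i)) \<le> H (\<Sum>i\<in>I. l i * y i)"
    and s: "\<And>i. i \<in> I \<Longrightarrow> ennreal (exp (s i)) < (\<integral>\<^sup>+y. h i y \<partial>lborel)"
  shows "ennreal (exp (\<Sum>i\<in>I. l i * s i)) \<le> (\<integral>\<^sup>+y. H y \<partial>lborel)"
proof -
  have "\<forall>i\<in>I. \<exists>n::nat. ennreal (exp (s i)) < (\<integral>\<^sup>+y. min (h i y) (ennreal n) \<partial>lborel)"
  proof
    fix i assume i[measurable]: "i \<in> I"
    have "(SUP n. min (h i y) (ennreal (real n))) = h i y" for y
    proof -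
      have "(SUP n. min (h i y) (of_nat n)) = min (h i y) (SUP n. of_nat n)"
        by (simp add: inf_min[symmetric] inf_SUP)
      then show ?thesis by (simp add: ennreal_of_nat_eq_real_of_nat[symmetric] ennreal_SUP_of_nat_eq_top)
    qed
    then have "(\<integral>\<^sup>+y. h i y \<partial>lborel) = (\<integral>\<^sup>+y. (SUP n. min (h i y) (ennreal (real n))) \<partial>lborel)" by simp
    also have "\<dots> = (SUP n. \<integral>\<^sup>+y. min (h i y) (ennreal (real n)) \<partial>lborel)"
      by (rule nn_integral_monotone_convergence_SUP)
        (auto simp: incseq_def le_fun_def intro!: min.coboundedI2 min.mono ennreal_leI)
    finally show "\<exists>n::nat. ennreal (exp (s i)) < (\<integral>\<^sup>+y. min (h i y) (ennreal n) \<partial>lborel)"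
      using s[OF i] by (simp add: less_SUP_iff)
  qed
  then obtain n where n: "\<And>i. i \<in> I \<Longrightarrow> ennreal (exp (s i)) < (\<integral>\<^sup>+y. min (h i y) (ennreal (real (n i))) \<partial>lborel)"
    by metis
  define N where "N = Max (n ` I)"
  show ?thesis
  proof (rule prekopa_leindler_bounded[OF I l, where h = "\<lambda>i y. min (h i y) (ennreal (real N))" and b = "real N"])
    fix i assume i: "i \<in> I"
    have "n i \<le> N" using i I(1) by (simp add: N_def)
    then have "(\<integral>\<^sup>+y. min (h i y) (ennreal (real (n i))) \<partial>lborel) \<le> (\<integral>\<^sup>+y. min (h i y) (ennreal (real N)) \<partial>lborel)"
      by (intro nn_integral_mono min.mono ennreal_leI) auto
    with n[OF i] show "ennreal (exp (s i)) < (\<integral>\<^sup>+y. min (h i y) (ennreal (real N)) \<partial>lborel)" by simp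
  next
    fix y t assume "\<And>i. i \<in> I \<Longrightarrow> ennreal (exp (t i)) < min (h i (y i)) (ennreal (real N))"
    then show "ennreal (exp (\<Sum>i\<in>I. l i * t i)) \<le> H (\<Sum>i\<in>I. l i * y i)" by (intro hyp) auto
  qed (use H in auto)
qed

text \<open>Induction on the number of coordinates. If \<open>r i\<close> lies below the integral of
  a section of \<open>h i\<close>, the one-dimensional inequality for sections bounds the integral
  of a section of \<open>H\<close>: this is \<open>hyp\<close> for the partial integrals in one
  coordinate less.\<close>

lemma prekopa_leindler_PiM:
  fixes h :: "'i \<Rightarrow> ('b \<Rightarrow> real) \<Rightarrow> ennreal"
  assumes I: "finite I" "I \<noteq> {}" and l: "\<And>i. i \<in> I \<Longrightarrow> 0 < l i" "sum l I = 1" and J: "finite J"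
    and h: "\<And>i. i \<in> I \<Longrightarrow> h i \<in> borel_measurable (Pi\<^sub>M J (\<lambda>_. lborel))" and H: "H \<in> borel_measurable (Pi\<^sub>M J (\<lambda>_. lborel))"
    and hyp: "\<And>y s. (\<And>i. i \<in> I \<Longrightarrow> y i \<in> space (Pi\<^sub>M J (\<lambda>_. lborel))) \<Longrightarrow>
      (\<And>i. i \<in> I \<Longrightarrow> ennreal (exp (s i)) < h i (y i)) \<Longrightarrow>
      ennreal (exp (\<Sum>i\<in>I. l i * s i)) \<le> H (\<lambda>b\<in>J. \<Sum>i\<in>I. l i * y i b)"
    and s: "\<And>i. i \<in> I \<Longrightarrow> ennreal (exp (s i)) < (\<integral>\<^sup>+y. h i y \<partial>Pi\<^sub>M J (\<lambda>_. lborel))"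
  shows "ennreal (exp (\<Sum>i\<in>I. l i * s i)) \<le> (\<integral>\<^sup>+y. H y \<partial>Pi\<^sub>M J (\<lambda>_. lborel))"
  using J h H hyp s
proof (induction J arbitrary: h H s)
  interpret product_sigma_finite "\<lambda>_::'b. lborel :: real measure" ..
  case empty
  have "ennreal (exp (\<Sum>i\<in>I. l i * s i)) \<le> H (\<lambda>b\<in>{}. \<Sum>i\<in>I. l i * (\<lambda>_. undefined) b)"
    by (rule empty.prems(3)) (use empty.prems(4) in \<open>auto simp: nn_integral_empty space_PiM\<close>)
  then show ?case by (simp add: nn_integral_empty restrict_def)
next
  interpret product_sigma_finite "\<lambda>_::'b. lborel :: real measure" ..
  case (insert b J)
  let ?M = "Pi\<^sub>M J (\<lambda>_. lborel :: real measure)"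
  have upd[measurable]: "(\<lambda>(x, t). x(b := t)) \<in> measurable (?M \<Otimes>\<^sub>M lborel) (Pi\<^sub>M (insert b J) (\<lambda>_. lborel))"
    by (rule measurable_add_dim)
  have sec: "(\<lambda>t. x(b := t)) \<in> measurable borel (Pi\<^sub>M (insert b J) (\<lambda>_. lborel))" if "x \<in> space ?M" for x
    using measurable_compose[OF measurable_Pair1' upd, OF that] by simp
  have mi: "(\<lambda>x. \<integral>\<^sup>+t. f (x(b := t)) \<partial>lborel) \<in> borel_measurable ?M"
    if "f \<in> borel_measurable (Pi\<^sub>M (insert b J) (\<lambda>_. lborel))" for f :: "('b \<Rightarrow> real) \<Rightarrow> ennreal"
  proof -
    have "(\<lambda>(x, t). f (x(b := t))) \<in> borel_measurable (?M \<Otimes>\<^sub>M lborel)"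
      using measurable_compose[OF upd that] by (simp add: split_beta')
    then show ?thesis by (rule lborel.borel_measurable_nn_integral)
  qed
  have "ennreal (exp (\<Sum>i\<in>I. l i * s i)) \<le> (\<integral>\<^sup>+x. (\<integral>\<^sup>+t. H (x(b := t)) \<partial>lborel) \<partial>?M)"
  proof (rule insert.IH[where h = "\<lambda>i x. \<integral>\<^sup>+t. h i (x(b := t)) \<partial>lborel"])
    fix i assume i: "i \<in> I"
    show "(\<lambda>x. \<integral>\<^sup>+t. h i (x(b := t)) \<partial>lborel) \<in> borel_measurable ?M" by (intro mi insert.prems i)
    show "ennreal (exp (s i)) < (\<integral>\<^sup>+x. \<integral>\<^sup>+t. h i (x(b := t)) \<partial>lborel \<partial>?M)"
      using insert.prems(4)[OF i] by (simp only: product_nn_integral_insert[OF insert.hyps insert.prems(1)[OF i]])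
  next
    show "(\<lambda>x. \<integral>\<^sup>+t. H (x(b := t)) \<partial>lborel) \<in> borel_measurable ?M" by (intro mi insert.prems)
  next
    fix y :: "'i \<Rightarrow> 'b \<Rightarrow> real" and r
    assume y: "\<And>i. i \<in> I \<Longrightarrow> y i \<in> space ?M"
      and r: "\<And>i. i \<in> I \<Longrightarrow> ennreal (exp (r i)) < (\<integral>\<^sup>+t. h i ((y i)(b := t)) \<partial>lborel)"
    let ?z = "\<lambda>c\<in>J. \<Sum>i\<in>I. l i * y i c"
    have z: "?z \<in> space ?M" by (simp add: space_PiM)
    show "ennreal (exp (\<Sum>i\<in>I. l i * r i)) \<le> (\<integral>\<^sup>+t. H (?z(b := t)) \<partial>lborel)"
    proof (rule prekopa_leindler_real[OF I l, where h = "\<lambda>i t. h i ((y i)(b := t))"])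
      fix i assume i: "i \<in> I"
      show "(\<lambda>t. h i ((y i)(b := t))) \<in> borel_measurable borel"
        by (rule measurable_compose[OF sec[OF y[OF i]] insert.prems(1)[OF i]])
    next
      show "(\<lambda>t. H (?z(b := t))) \<in> borel_measurable borel"
        by (rule measurable_compose[OF sec[OF z] insert.prems(2)])
    next
      fix t q assume q: "\<And>i. i \<in> I \<Longrightarrow> ennreal (exp (q i)) < h i ((y i)(b := t i))"
      have "ennreal (exp (\<Sum>i\<in>I. l i * q i)) \<le> H (\<lambda>c\<in>insert b J. \<Sum>i\<in>I. l i * ((y i)(b := t i)) c)"
      proof (rule insert.prems(3))
        show "(y i)(b := t i) \<in> space (Pi\<^sub>M (insert b J) (\<lambda>_. lborel))" if "i \<in> I" for i
          using y[OF that] by (auto simp: space_PiM PiE_iff extensional_def)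
      qed (rule q)
      also have "(\<lambda>c\<in>insert b J. \<Sum>i\<in>I. l i * ((y i)(b := t i)) c) = ?z(b := \<Sum>i\<in>I. l i * t i)"
        using insert.hyps by (auto simp: fun_eq_iff restrict_def)
      finally show "ennreal (exp (\<Sum>i\<in>I. l i * q i)) \<le> H (?z(b := \<Sum>i\<in>I. l i * t i))" .
    qed (assumption | rule r)+
  qed
  then show ?case by (simp only: product_nn_integral_insert[OF insert.hyps insert.prems(2)])
qed

lemma prekopa_leindler:
  fixes h :: "'i \<Rightarrow> 'a::euclidean_space \<Rightarrow> ennreal"
  assumes I: "finite I" "I \<noteq> {}" and l: "\<And>i. i \<in> I \<Longrightarrow> 0 < l i" "sum l I = 1"
    and h: "\<And>i. i \<in> I \<Longrightarrow> h i \<in> borel_measurable borel" and H: "H \<in> borel_measurable borel"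
    and hyp: "\<And>y s. (\<And>i. i \<in> I \<Longrightarrow> ennreal (exp (s i)) < h i (y i)) \<Longrightarrow>
      ennreal (exp (\<Sum>i\<in>I. l i * s i)) \<le> H (\<Sum>i\<in>I. l i *\<^sub>R y i)"
    and s: "\<And>i. i \<in> I \<Longrightarrow> ennreal (exp (s i)) < (\<integral>\<^sup>+y. h i y \<partial>lborel)"
  shows "ennreal (exp (\<Sum>i\<in>I. l i * s i)) \<le> (\<integral>\<^sup>+y. H y \<partial>lborel)"
proof -
  let ?M = "Pi\<^sub>M Basis (\<lambda>_::'a. lborel :: real measure)" and ?e = "\<lambda>f. \<Sum>b\<in>Basis. f b *\<^sub>R b :: 'a"
  have e: "?e \<in> measurable ?M borel" by measurable
  have int: "(\<integral>\<^sup>+y. f y \<partial>lborel) = (\<integral>\<^sup>+x. f (?e x) \<partial>?M)" if "f \<in> borel_measurable borel" for f :: "'a \<Rightarrow> ennreal"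
    by (subst lborel_eq, subst nn_integral_distr) (use e that in auto)
  have "ennreal (exp (\<Sum>i\<in>I. l i * s i)) \<le> (\<integral>\<^sup>+x. H (?e x) \<partial>?M)"
  proof (rule prekopa_leindler_PiM[OF I l finite_Basis, where h = "\<lambda>i x. h i (?e x)"])
    fix i assume i: "i \<in> I"
    show "(\<lambda>x. h i (?e x)) \<in> borel_measurable ?M" by (rule measurable_compose[OF e h[OF i]])
    show "ennreal (exp (s i)) < (\<integral>\<^sup>+x. h i (?e x) \<partial>?M)" using s[OF i] int[OF h[OF i]] by simp
  next
    show "(\<lambda>x. H (?e x)) \<in> borel_measurable ?M" by (rule measurable_compose[OF e H])
    fix y :: "'i \<Rightarrow> 'a \<Rightarrow> real" and r assume "\<And>i. i \<in> I \<Longrightarrow> ennreal (exp (r i)) < h i (?e (y i))"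
    then have "ennreal (exp (\<Sum>i\<in>I. l i * r i)) \<le> H (\<Sum>i\<in>I. l i *\<^sub>R ?e (y i))" by (rule hyp)
    also have "(\<Sum>i\<in>I. l i *\<^sub>R ?e (y i)) = ?e (\<lambda>b\<in>Basis. \<Sum>i\<in>I. l i * y i b)"
      by (simp add: scaleR_sum_right scaleR_sum_left sum.swap[of _ Basis])
    finally show "ennreal (exp (\<Sum>i\<in>I. l i * r i)) \<le> H (?e (\<lambda>b\<in>Basis. \<Sum>i\<in>I. l i * y i b))" .
  qed
  then show ?thesis by (simp add: int[OF H])
qed

section \<open>Marginals\<close>

text \<open>Any hyperplane separating \<open>H\<close> from \<open>F\<close> works. \<open>F\<close>
  contains the rays in positive semidefinite directions, so \<open>Q\<close> is non-negative on
  these; and \<open>H\<close> plus a large multiple of the identity lies in \<open>F\<close>, so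
  \<open>Q\<close> is positive on the identity.\<close>

lemma convex_dirichlet_halfspace:
  fixes F :: "(real^'n^'n) set"
  assumes F: "convex_dirichlet_set F" and H: "H \<in> sym_matrices" "H \<notin> F"
  obtains Q c where "trace_operator Q" "\<And>A. A \<in> F \<Longrightarrow> c \<le> Q \<bullet> A" "Q \<bullet> H < c"
proof -
  have dir: "dirichlet_set F" and conv: "convex F" using F by (auto simp: convex_dirichlet_set_def)
  then have F': "F \<subseteq> sym_matrices" "F \<noteq> {}" "closed F" "\<And>A P. A \<in> F \<Longrightarrow> P \<in> psd_matrices \<Longrightarrow> A + P \<in> F"
    by (auto simp: dirichlet_set_def)
  obtain Q c where Q: "Q \<bullet> H < c" "\<And>A. A \<in> F \<Longrightarrow> c < Q \<bullet> A"
    using separating_hyperplane_closed_point[OF conv F'(3) H(2)] by blast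
  obtain A where A: "A \<in> F" using F'(2) by blast
  have psd: "0 \<le> Q \<bullet> P" if P: "P \<in> psd_matrices" for P
  proof (rule ccontr)
    assume n: "\<not> 0 \<le> Q \<bullet> P"
    \<comment> \<open>The parameter at which the ray from \<open>A\<close> in direction
      \<open>P\<close> meets the separating hyperplane.\<close>
    define t where "t = (Q \<bullet> A - c) / (- (Q \<bullet> P))"
    have "t \<ge> 0" using n Q(2)[OF A] by (simp add: t_def divide_nonneg_neg less_imp_le)
    then have "t *\<^sub>R P \<in> psd_matrices"
      using P by (auto simp: psd_matrices_def sym_matrices_def transpose_def vec_eq_iff
        scaleR_matrix_vector_assoc[symmetric])
    then have "c < Q \<bullet> (A + t *\<^sub>R P)" using Q(2) F'(4)[OF A] by blast
    also have "\<dots> = Q \<bullet> A + t * (Q \<bullet> P)" by (simp add: inner_add_right)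
    also have "t * (Q \<bullet> P) = c - Q \<bullet> A" using n by (simp add: t_def)
    also have "Q \<bullet> A + (c - Q \<bullet> A) = c" by simp
    finally show False by simp
  qed
  \<comment> \<open>An operator norm bound: adding \<open>B\<close> times the identity makes
    \<open>H - A\<close> positive semidefinite.\<close>
  obtain B where B: "\<And>v. norm ((H - A) *v v) \<le> norm v * B" "B > 0"
    using bounded_linear.pos_bounded[OF matrix_vector_mul_bounded_linear[of "H - A"]] by blast
  have "(H - A) + B *\<^sub>R mat 1 \<in> psd_matrices"
  proof -
    have "transpose ((H - A) + B *\<^sub>R mat 1) = (H - A) + B *\<^sub>R mat 1"
      using H(1) A F'(1) by (auto simp: sym_matrices_def transpose_def vec_eq_iff mat_def)
    moreover have "0 \<le> v \<bullet> (((H - A) + B *\<^sub>R mat 1) *v v)" for v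
    proof -
      have "\<bar>v \<bullet> ((H - A) *v v)\<bar> \<le> norm v * (norm v * B)"
        by (intro order_trans[OF Cauchy_Schwarz_ineq2] mult_left_mono B) auto
      also have "\<dots> = B * (v \<bullet> v)" by (simp add: dot_square_norm power2_eq_square)
      finally show ?thesis
        by (simp add: matrix_vector_mult_add_rdistrib scaleR_matrix_vector_assoc[symmetric] inner_add_right)
    qed
    ultimately show ?thesis by (simp add: psd_matrices_def sym_matrices_def)
  qed
  from F'(4)[OF A this] have "H + B *\<^sub>R mat 1 \<in> F" by simp
  then have "c < Q \<bullet> H + B * (Q \<bullet> mat 1)" using Q(2)[of "H + B *\<^sub>R mat 1"] by (simp add: inner_add_right)
  with Q(1) B(2) have "0 < Q \<bullet> mat 1" by (smt (verit) zero_less_mult_pos)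
  with psd have "trace_operator Q" by (simp add: trace_operator_def)
  with Q show thesis by (intro that[of Q c]) (auto simp: less_imp_le)
qed

section \<open>The extended exponential and Fatou's lemma\<close>

lemma exp_neg_ereal [simp]: "exp_neg (ereal r) = ennreal (exp (- r))"
  by (simp add: exp_neg_def)

lemma exp_neg_antimono: "a \<le> b \<Longrightarrow> exp_neg b \<le> exp_neg a"
  by (cases a; cases b) (auto simp: exp_neg_def intro: ennreal_leI)

lemma exp_neg_diff: "t \<noteq> \<infinity> \<Longrightarrow> exp_neg (t - ereal r) = ennreal (exp r) * exp_neg t"
  by (cases t) (auto simp: exp_neg_def ennreal_mult[symmetric] exp_add[symmetric] ennreal_mult_top)

lemma exp_neg_pos: "t \<noteq> \<infinity> \<Longrightarrow> 0 < exp_neg t"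
  by (auto simp: exp_neg_def)

lemma less_exp_negD: "ennreal (exp r) < exp_neg t \<Longrightarrow> t < ereal (- r)"
  by (cases t) (auto simp: exp_neg_def ennreal_less_iff)

lemma neg_log_ge_iff: "ereal c \<le> neg_log t \<longleftrightarrow> t \<le> ennreal (exp (- c))"
proof (cases t)
  case (real r)
  then show ?thesis
    by (cases "r = 0") (auto simp: neg_log_def ln_ge_iff[symmetric] le_minus_iff ln_le_cancel_iff[of r "exp (- c)", symmetric])
qed (auto simp: neg_log_def top_unique)

lemma neg_log_le_iff: "neg_log t \<le> ereal c \<longleftrightarrow> ennreal (exp (- c)) \<le> t"
proof (cases t)
  case (real r)
  then show ?thesis
    by (cases "r = 0") (auto simp: neg_log_def ln_ge_iff[symmetric] minus_le_iff)
qed (auto simp: neg_log_def)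

lemma measurable_exp_neg [measurable]: "exp_neg \<in> borel_measurable borel"
  unfolding exp_neg_def by measurable

lemma exp_neg_le_if_less:
  assumes "\<And>a. t < ereal a \<Longrightarrow> ennreal (exp (- a)) \<le> L"
  shows "exp_neg t \<le> L"
proof (cases t)
  case (real r)
  have "(\<lambda>n. ennreal (exp (- (r + inverse (real (Suc n)))))) \<longlonglongrightarrow> ennreal (exp (- (r + 0)))"
    by (intro tendsto_ennrealI tendsto_intros LIMSEQ_inverse_real_of_nat)
  then have "ennreal (exp (- (r + 0))) \<le> L"
    by (rule LIMSEQ_le_const2, intro exI allI impI assms) (simp add: real del: of_nat_Suc)
  with real show ?thesis by simp
next
  case MInf
  have "of_nat n \<le> L" for n :: nat
  proof -
    have "of_nat n \<le> ennreal (exp (- (- real n)))"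
      using exp_ge_add_one_self[of "real n"] by (simp add: ennreal_of_nat_eq_real_of_nat del: exp_ge_add_one_self)
    also have "\<dots> \<le> L" by (rule assms) (simp add: MInf)
    finally show ?thesis .
  qed
  then have "(SUP n. of_nat n) \<le> L" by (intro SUP_least)
  then show ?thesis by (simp add: ennreal_SUP_of_nat_eq_top top_unique)
qed (simp add: exp_neg_def)

text \<open>The lower bound on the \<open>k n\<close> is assumed in the form in which upper
  semicontinuity supplies it, through real numbers \<open>a\<close> above \<open>f y\<close>; this
  treats the value -\<infinity> on the same footing.\<close>

lemma fatou_exp_neg:
  fixes k :: "nat \<Rightarrow> 'a::euclidean_space \<Rightarrow> ennreal"
  assumes "\<And>n. k n \<in> borel_measurable borel"
    and "\<And>y a. f y < ereal a \<Longrightarrow> \<forall>\<^sub>F n in sequentially. ennreal (exp (- a)) \<le> k n y"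
    and "\<And>n. (\<integral>\<^sup>+y. k n y \<partial>lborel) \<le> C"
  shows "(\<integral>\<^sup>+y. exp_neg (f y) \<partial>lborel) \<le> C"
proof -
  have "(\<integral>\<^sup>+y. exp_neg (f y) \<partial>lborel) \<le> (\<integral>\<^sup>+y. liminf (\<lambda>n. k n y) \<partial>lborel)"
    by (intro nn_integral_mono exp_neg_le_if_less Liminf_bounded assms(2))
  also have "\<dots> \<le> liminf (\<lambda>n. \<integral>\<^sup>+y. k n y \<partial>lborel)"
    by (intro nn_integral_liminf) (use assms(1) in simp)
  also have "\<dots> \<le> liminf (\<lambda>n::nat. C)"
    by (intro Liminf_mono always_eventually allI assms(3))
  finally show ?thesis by (simp add: Liminf_const)
qed

section \<open>Semicontinuity, measurability and finiteness of marginals\<close>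

lemma usc_on_sequentialI:
  fixes X :: "'a::first_countable_topology set"
  assumes "\<And>x s c. x \<in> X \<Longrightarrow> (\<And>n. s n \<in> X) \<Longrightarrow> s \<longlonglongrightarrow> x \<Longrightarrow> (\<And>n. ereal c \<le> f (s n)) \<Longrightarrow> ereal c \<le> f x"
  shows "usc_on X f"
  unfolding usc_on_def
proof
  fix c
  have real: "openin (top_of_set X) {x\<in>X. f x < ereal r}" for r
  proof -
    have "closedin (top_of_set X) {x\<in>X. ereal r \<le> f x}"
      unfolding closedin_limpt islimpt_sequential using assms by (auto; blast)
    then have "openin (top_of_set X) (X - {x\<in>X. ereal r \<le> f x})" by (simp add: closedin_def)
    moreover have "X - {x\<in>X. ereal r \<le> f x} = {x\<in>X. f x < ereal r}" by auto
    ultimately show ?thesis by simp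
  qed
  have "{x\<in>X. f x < c} = (\<Union>r\<in>{r. ereal r \<le> c}. {x\<in>X. f x < ereal r})"
  proof (intro subset_antisym subsetI)
    fix x assume "x \<in> {x\<in>X. f x < c}"
    moreover from this obtain r where "f x < ereal r" "ereal r < c" using ereal_dense2 by blast
    ultimately show "x \<in> (\<Union>r\<in>{r. ereal r \<le> c}. {x\<in>X. f x < ereal r})" by (auto intro: less_imp_le)
  qed (auto intro: less_le_trans)
  then show "openin (top_of_set X) {x\<in>X. f x < c}" using real by auto
qed

text \<open>The supremum over a compact set of base points is again upper semicontinuous in
  \<open>y\<close>: near-maximising base points accumulate, so superlevel sets are closed.\<close>

lemma usc_on_fibre_measurable:
  fixes \<Psi> :: "real^('n::finite + 'm::finite) \<Rightarrow> ereal"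
  assumes "usc_on (times_space X) \<Psi>" "compact C" "C \<subseteq> X"
  shows "(\<lambda>y. SUP z\<in>C. \<Psi> (vjoin z y)) \<in> borel_measurable borel"
proof (rule borel_measurableI_less)
  fix c
  have "closed {y. c \<le> (SUP z\<in>C. \<Psi> (vjoin z y))}"
    unfolding closed_sequential_limits
  proof (intro allI impI, elim conjE)
    fix s y assume s: "\<forall>n. s n \<in> {y. c \<le> (SUP z\<in>C. \<Psi> (vjoin z y))}" "s \<longlonglongrightarrow> y"
    show "y \<in> {y. c \<le> (SUP z\<in>C. \<Psi> (vjoin z y))}"
    proof (rule ccontr)
      assume "\<not> ?thesis"
      then obtain r where r: "(SUP z\<in>C. \<Psi> (vjoin z y)) < ereal r" "ereal r < c"
        using ereal_dense2 by (auto simp: not_le)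
      have "\<exists>z\<in>C. ereal r < \<Psi> (vjoin z (s n))" for n
      proof -
        have "ereal r < (SUP z\<in>C. \<Psi> (vjoin z (s n)))" using s(1) r(2) by (auto intro: less_le_trans)
        then show ?thesis by (simp add: less_SUP_iff)
      qed
      then obtain z where z: "\<And>n. z n \<in> C" "\<And>n. ereal r < \<Psi> (vjoin (z n) (s n))" by metis
      obtain x q where x: "x \<in> C" "strict_mono (q :: nat \<Rightarrow> nat)" "(z \<circ> q) \<longlonglongrightarrow> x"
        using compact_imp_seq_compact[OF assms(2)] z(1) unfolding seq_compact_def by metis
      have lim: "(\<lambda>n. vjoin ((z \<circ> q) n) ((s \<circ> q) n)) \<longlonglongrightarrow> vjoin x y"
      proof -
        have "isCont (\<lambda>(x, y). vjoin x y :: real^('n + 'm)) (x, y)"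
          by (rule linear_continuous_at[OF linear_vjoin[unfolded linear_conv_bounded_linear]])
        moreover have "(\<lambda>n. ((z \<circ> q) n, (s \<circ> q) n)) \<longlonglongrightarrow> (x, y)"
          by (intro tendsto_Pair x(3) LIMSEQ_subseq_LIMSEQ[OF s(2) x(2)])
        ultimately show ?thesis using isCont_tendsto_compose by fastforce
      qed
      have "\<Psi> (vjoin x y) < ereal r"
        using r(1) x(1) by (meson SUP_upper order.strict_trans1)
      moreover have "vjoin ((z \<circ> q) n) ((s \<circ> q) n) \<in> times_space X" for n using z(1) assms(3) by auto
      moreover have "vjoin x y \<in> times_space X" using x(1) assms(3) by auto
      ultimately have "\<forall>\<^sub>F n in sequentially. \<Psi> (vjoin ((z \<circ> q) n) ((s \<circ> q) n)) < ereal r"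
        by (intro usc_on_eventually[OF assms(1) _ _ _ lim])
      then obtain n where "\<Psi> (vjoin ((z \<circ> q) n) ((s \<circ> q) n)) < ereal r"
        using eventually_happens trivial_limit_sequentially by blast
      with z(2)[of "q n"] show False by simp
    qed
  qed
  then have "open (- {y. c \<le> (SUP z\<in>C. \<Psi> (vjoin z y))})" by (simp add: open_Compl)
  moreover have "- {y. c \<le> (SUP z\<in>C. \<Psi> (vjoin z y))} = {y. (SUP z\<in>C. \<Psi> (vjoin z y)) < c}" by auto
  ultimately show "{y\<in>space borel. (SUP z\<in>C. \<Psi> (vjoin z y)) < c} \<in> sets borel" by simp
qed

lemma usc_on_slice_measurable:
  fixes \<Psi> :: "real^('n::finite + 'm::finite) \<Rightarrow> ereal"
  assumes "usc_on (times_space X) \<Psi>" "z \<in> X"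
  shows "(\<lambda>y. \<Psi> (vjoin z y)) \<in> borel_measurable borel"
  using usc_on_fibre_measurable[OF assms(1), of "{z}"] assms(2) by simp

text \<open>Since \<open>exp_neg\<close> reverses order, the integrand is lower semicontinuous in
  \<open>x\<close>; Fatou's lemma passes this to the integral, and \<open>neg_log\<close> reverses
  the order again.\<close>

lemma marginal_usc:
  fixes \<psi> :: "real^('n::finite + 'm::finite) \<Rightarrow> ereal"
  assumes usc: "usc_on (times_space X) \<psi>"
  shows "usc_on X (\<lambda>x. neg_log (\<integral>\<^sup>+ y. exp_neg (\<psi> (vjoin x y)) \<partial>lborel))"
proof (rule usc_on_sequentialI)
  fix x s c
  assume x: "x \<in> X" and s: "\<And>n. s n \<in> X" "s \<longlonglongrightarrow> x"
    and c: "\<And>n. ereal c \<le> neg_log (\<integral>\<^sup>+ y. exp_neg (\<psi> (vjoin (s n) y)) \<partial>lborel)"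
  have "(\<integral>\<^sup>+ y. exp_neg (\<psi> (vjoin x y)) \<partial>lborel) \<le> ennreal (exp (- c))"
  proof (rule fatou_exp_neg[where k = "\<lambda>n y. exp_neg (\<psi> (vjoin (s n) y))"])
    show "(\<lambda>y. exp_neg (\<psi> (vjoin (s n) y))) \<in> borel_measurable borel" for n
      by (rule measurable_compose[OF usc_on_slice_measurable[OF usc s(1)] measurable_exp_neg])
    show "(\<integral>\<^sup>+ y. exp_neg (\<psi> (vjoin (s n) y)) \<partial>lborel) \<le> ennreal (exp (- c))" for n
      using c[of n] by (simp add: neg_log_ge_iff)
    fix y a assume a: "\<psi> (vjoin x y) < ereal a"
    have "(\<lambda>n. vjoin (s n) y) \<longlonglongrightarrow> vjoin x y"
      using continuous_on_tendsto_compose[of UNIV "\<lambda>x. vjoin x y", OF _ s(2)] by (simp add: continuous_intros)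
    then have "\<forall>\<^sub>F n in sequentially. \<psi> (vjoin (s n) y) < ereal a"
      by (intro usc_on_eventually[OF usc _ a]) (use x s in auto)
    then show "\<forall>\<^sub>F n in sequentially. ennreal (exp (- a)) \<le> exp_neg (\<psi> (vjoin (s n) y))"
      by eventually_elim (metis exp_neg_antimono exp_neg_ereal less_imp_le)
  qed
  then show "ereal c \<le> neg_log (\<integral>\<^sup>+ y. exp_neg (\<psi> (vjoin x y)) \<partial>lborel)"
    by (simp add: neg_log_ge_iff)
qed

text \<open>The integrand is strictly positive everywhere, so its integral is not 0.\<close>

lemma marginal_neq_infinity:
  fixes \<psi> :: "real^('n::finite + 'm::finite) \<Rightarrow> ereal"
  assumes "usc_on (times_space X) \<psi>" "\<And>p. p \<in> times_space X \<Longrightarrow> \<psi> p \<noteq> \<infinity>" "x \<in> X"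
  shows "neg_log (\<integral>\<^sup>+ y. exp_neg (\<psi> (vjoin x y)) \<partial>lborel) \<noteq> \<infinity>"
proof
  assume "neg_log (\<integral>\<^sup>+ y. exp_neg (\<psi> (vjoin x y)) \<partial>lborel) = \<infinity>"
  then have "(\<integral>\<^sup>+ y. exp_neg (\<psi> (vjoin x y)) \<partial>lborel) = 0"
    by (simp add: neg_log_def split: if_splits)
  moreover have "(\<lambda>y. exp_neg (\<psi> (vjoin x y))) \<in> borel_measurable lborel"
    using measurable_compose[OF usc_on_slice_measurable[OF assms(1,3)] measurable_exp_neg] by simp
  ultimately have "AE y in lborel. exp_neg (\<psi> (vjoin x y)) = 0" by (simp add: nn_integral_0_iff_AE)
  moreover have "exp_neg (\<psi> (vjoin x y)) \<noteq> 0" for y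
    using exp_neg_pos[of "\<psi> (vjoin x y)"] assms(2,3) by force
  ultimately have "AE y::real^'m in lborel. False" by simp
  then have "emeasure lborel (UNIV :: (real^'m) set) = 0"
    by (simp add: AE_iff_measurable[where N = UNIV])
  then show False by simp
qed

text \<open>These weights approximate \<open>exp_neg (\<Psi> (vjoin z y))\<close> as \<open>k \<rightarrow> \<infinity>\<close>. A lower bound on such a weight
  bounds \<open>\<Psi> (vjoin z' y)\<close> from above for all \<open>z'\<close> near \<open>z\<close>.\<close>

definition regularized_weight ::
  "(real^('n::finite + 'm::finite) \<Rightarrow> ereal) \<Rightarrow> nat \<Rightarrow> real^'n \<Rightarrow> real^'m \<Rightarrow> ennreal" where
  "regularized_weight \<Psi> k z y = indicator (ball 0 (real k)) y *
     exp_neg (max (SUP z'\<in>cball z (1 / (real k + 1)). \<Psi> (vjoin z' y)) (- ereal (real k)))"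

lemma regularized_weight_measurable:
  assumes "usc_on (times_space X) \<Psi>" "cball z (1 / (real k + 1)) \<subseteq> X"
  shows "regularized_weight \<Psi> k z \<in> borel_measurable borel"
proof -
  have "(\<lambda>y. SUP z'\<in>cball z (1 / (real k + 1)). \<Psi> (vjoin z' y)) \<in> borel_measurable borel"
    by (rule usc_on_fibre_measurable[OF assms(1) compact_cball assms(2)])
  then show ?thesis
    unfolding regularized_weight_def[abs_def]
    by (intro borel_measurable_times_ennreal borel_measurable_indicator borel_open open_ball
      measurable_compose[OF _ measurable_exp_neg] borel_measurable_max borel_measurable_const)
qed

text \<open>Each ingredient of the weight gives one conclusion: the cutoff bounds \<open>y\<close>,
  the maximum with \<open>- k\<close> bounds the level, and the supremum controls all nearby base
  points. These are the three premises of \<open>key\<close> in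
  \<open>no_strict_test_polynomial\<close>.\<close>

lemma less_regularized_weightD:
  assumes "ennreal (exp r) < regularized_weight \<Psi> k z y"
  shows "norm y < k" "- real k < - r" "\<And>z'. dist z z' \<le> 1 / (real k + 1) \<Longrightarrow> \<Psi> (vjoin z' y) < ereal (- r)"
proof -
  show "norm y < k"
  proof (rule ccontr)
    assume "\<not> norm y < k"
    with assms show False by (simp add: regularized_weight_def)
  qed
  then have "ennreal (exp r) < exp_neg (max (SUP z'\<in>cball z (1 / (real k + 1)). \<Psi> (vjoin z' y)) (- ereal (real k)))"
    using assms by (simp add: regularized_weight_def)
  from less_exp_negD[OF this]
  have *: "(SUP z'\<in>cball z (1 / (real k + 1)). \<Psi> (vjoin z' y)) < ereal (- r)" "- ereal (real k) < ereal (- r)"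
    by auto
  from *(2) show "- real k < - r" by simp
  show "\<Psi> (vjoin z' y) < ereal (- r)" if "dist z z' \<le> 1 / (real k + 1)" for z'
    using *(1) that by (intro le_less_trans[OF _ *(1)] SUP_upper) simp
qed

text \<open>By semicontinuity the bound \<open>a\<close> holds on a whole neighbourhood of
  \<open>z\<close>, which finally contains the shrinking balls around \<open>s n\<close>. The moving
  centres are needed for the compactness argument that follows.\<close>

lemma regularized_weight_lower_bound:
  fixes \<Psi> :: "real^('n::finite + 'm::finite) \<Rightarrow> ereal"
  assumes X: "open X" and usc: "usc_on (times_space X) \<Psi>" and z: "z \<in> X" "s \<longlonglongrightarrow> z"
    and q: "filterlim q at_top sequentially" and a: "\<Psi> (vjoin z y) < ereal a"
  shows "\<forall>\<^sub>F n in sequentially. ennreal (exp (- a)) \<le> regularized_weight \<Psi> (q n) (s n) y"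
proof -
  obtain T where T: "open T" "vjoin z y \<in> T" "\<And>p. p \<in> times_space X \<Longrightarrow> p \<in> T \<Longrightarrow> \<Psi> p < ereal a"
    using usc_onD[OF usc _ a] z(1) by auto
  have "open ((\<lambda>x. vjoin x y) -` T \<inter> X)"
    by (intro open_Int open_vimage T X continuous_intros)
  then obtain \<tau> where \<tau>: "\<tau> > 0" "ball z \<tau> \<subseteq> (\<lambda>x. vjoin x y) -` T \<inter> X"
    using T(2) z(1) openE by blast
  have less: "\<Psi> (vjoin x y) < ereal a" if "dist z x < \<tau>" for x
    using \<tau>(2) that by (intro T(3)) (auto simp: subset_iff)
  have "\<forall>\<^sub>F n in sequentially. dist (s n) z < \<tau> / 2"
    using z(2) \<tau>(1) by (intro tendstoD) auto
  moreover have "\<forall>\<^sub>F n in sequentially. max (norm y) (max (- a) (2 / \<tau>)) < real (q n)"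
    by (rule filterlim_at_top_dense[THEN iffD1, OF filterlim_compose[OF filterlim_real_sequentially q], rule_format])
  ultimately show ?thesis
  proof eventually_elim
    case (elim n)
    then have "2 / \<tau> < real (q n) + 1" by auto
    then have small: "1 / (real (q n) + 1) < \<tau> / 2"
      using \<tau>(1) by (simp add: field_simps)
    have "(SUP z'\<in>cball (s n) (1 / (real (q n) + 1)). \<Psi> (vjoin z' y)) \<le> ereal a"
    proof (rule SUP_least)
      fix x assume x: "x \<in> cball (s n) (1 / (real (q n) + 1))"
      have "dist z x \<le> dist (s n) z + dist (s n) x"
        using dist_triangle[of z x "s n"] by (simp add: dist_commute)
      also have "\<dots> < \<tau>" using elim(1) x small by simp
      finally show "\<Psi> (vjoin x y) \<le> ereal a" using less[of x] by simp
    qed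
    moreover have "- ereal (real (q n)) \<le> ereal a" using elim(2) by simp
    ultimately have "max (SUP z'\<in>cball (s n) (1 / (real (q n) + 1)). \<Psi> (vjoin z' y)) (- ereal (real (q n))) \<le> ereal a"
      by (rule max.boundedI)
    from exp_neg_antimono[OF this] show ?case
      using elim(2) by (simp add: regularized_weight_def)
  qed
qed

text \<open>One \<open>k\<close> serves all centres: otherwise bad centres accumulate at some
  \<open>z\<close>, and Fatou's lemma contradicts \<open>big\<close> there.\<close>

lemma regularized_weight_integral_uniform:
  fixes \<Psi> :: "real^('n::finite + 'm::finite) \<Rightarrow> ereal"
  assumes X: "open X" and usc: "usc_on (times_space X) \<Psi>" and r: "r > 0" "cball a (2 * r) \<subseteq> X"
    and big: "\<And>z. z \<in> cball a r \<Longrightarrow> C < (\<integral>\<^sup>+y. exp_neg (\<Psi> (vjoin z y)) \<partial>lborel)"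
  obtains k :: nat where "k > 0" "1 / (real k + 1) < r"
    "\<And>z. z \<in> cball a r \<Longrightarrow> C < (\<integral>\<^sup>+y. regularized_weight \<Psi> k z y \<partial>lborel)"
proof -
  \<comment> \<open>From \<open>k0\<close> on the balls in the weights have radius below
    \<open>r\<close>, so those with centre in \<open>cball a r\<close> stay inside
    \<open>cball a (2 * r)\<close>.\<close>
  obtain k0 :: nat where k0: "1 / r < real k0" using reals_Archimedean2 by blast
  have k0': "k > 0 \<and> 1 / (real k + 1) < r" if "k0 \<le> k" for k :: nat
  proof -
    have "0 < 1 / r" using r(1) by simp
    then have "1 / r < real k" "real k > 0" using k0 that by linarith+
    then show ?thesis using r(1) by (simp add: field_simps) 
  qed
  have "\<exists>k\<ge>k0. \<forall>z\<in>cball a r. C < (\<integral>\<^sup>+y. regularized_weight \<Psi> k z y \<partial>lborel)"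
  proof (rule ccontr)
    assume "\<not> ?thesis"
    then have "\<forall>n. \<exists>z\<in>cball a r. (\<integral>\<^sup>+y. regularized_weight \<Psi> (k0 + n) z y \<partial>lborel) \<le> C"
      by (metis le_add1 not_less)
    then obtain s where s: "\<And>n. s n \<in> cball a r" "\<And>n. (\<integral>\<^sup>+y. regularized_weight \<Psi> (k0 + n) (s n) y \<partial>lborel) \<le> C"
      by metis
    obtain z q where z: "z \<in> cball a r" "strict_mono (q :: nat \<Rightarrow> nat)" "(s \<circ> q) \<longlonglongrightarrow> z"
      using compact_imp_seq_compact[OF compact_cball[of a r]] s(1) unfolding seq_compact_def by metis
    have sub: "cball x (1 / (real (k0 + n) + 1)) \<subseteq> X" if "x \<in> cball a r" for x and n :: nat
    proof
      fix y assume "y \<in> cball x (1 / (real (k0 + n) + 1))"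
      with k0'[of "k0 + n"] that have "dist a y \<le> 2 * r"
        using dist_triangle[of a y x] by simp
      then show "y \<in> X" using r(2) by auto
    qed
    have zX: "z \<in> X" using sub[OF z(1), of 0] by (auto simp: subset_iff)
    have "(\<integral>\<^sup>+y. exp_neg (\<Psi> (vjoin z y)) \<partial>lborel) \<le> C"
    proof (rule fatou_exp_neg[where k = "\<lambda>n. regularized_weight \<Psi> (k0 + q n) (s (q n))"])
      show "regularized_weight \<Psi> (k0 + q n) (s (q n)) \<in> borel_measurable borel" for n
        by (rule regularized_weight_measurable[OF usc sub[OF s(1)]])
      show "\<forall>\<^sub>F n in sequentially. ennreal (exp (- b)) \<le> regularized_weight \<Psi> (k0 + q n) (s (q n)) y"
        if "\<Psi> (vjoin z y) < ereal b" for y b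
      proof (rule regularized_weight_lower_bound[OF X usc zX _ _ that])
        show "(\<lambda>n. s (q n)) \<longlonglongrightarrow> z" using z(3) by (simp add: o_def)
        show "filterlim (\<lambda>n. k0 + q n) at_top sequentially"
          using filterlim_subseq[OF z(2)] by (rule filterlim_at_top_mono) (simp add: always_eventually)
      qed
    qed (rule s(2))
    with big[OF z(1)] show False by simp
  qed
  then show thesis using that k0' by blast
qed

context trace_operator
begin

text \<open>After subtracting \<open>g\<close>, the integral of \<open>exp_neg\<close> is at least 1
  near \<open>a\<close> and at most 1 at \<open>a\<close>. Interpolation followed by
  Prekopa-Leindler would make the integral at \<open>a\<close> exceed 1, by comparing it with
  integrals over nearby fibres.\<close>

lemma no_strict_test_polynomial:
  fixes \<psi> :: "real^('n + 'm::finite) \<Rightarrow> ereal"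
  assumes X: "open X" and sub: "subharmonic_on (star_psd F) (times_space X) \<psi>"
    and F: "F \<subseteq> sym_matrices" "\<And>A. A \<in> F \<Longrightarrow> c \<le> Q \<bullet> A"
    and g: "real_polynomial_function g" "\<And>z. Q \<bullet> hessian g z = c'" "c' < c"
    and d: "d > 0" "ball a d \<subseteq> X"
    and le: "\<And>z. z \<in> ball a d \<Longrightarrow> neg_log (\<integral>\<^sup>+ y. exp_neg (\<psi> (vjoin z y)) \<partial>lborel) \<le> ereal (g z)"
    and ge: "ereal (g a) \<le> neg_log (\<integral>\<^sup>+ y. exp_neg (\<psi> (vjoin a y)) \<partial>lborel)"
  shows False
proof -
  define \<Psi> where "\<Psi> p = \<psi> p - ereal (g (fst_part p))" for p
  have usc\<psi>: "usc_on (times_space X) \<psi>" and fin: "\<And>p. p \<in> times_space X \<Longrightarrow> \<psi> p \<noteq> \<infinity>"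
    using sub by (auto simp: subharmonic_on_def)
  have usc: "usc_on (times_space X) \<Psi>"
    unfolding \<Psi>_def[abs_def]
    by (intro usc_on_diff_continuous usc\<psi> polynomial_continuous_on polynomial_fst_part g)
  have finX: "\<psi> (vjoin z y) \<noteq> \<infinity>" if "z \<in> X" for z y using fin that by simp
  have int: "(\<integral>\<^sup>+ y. exp_neg (\<Psi> (vjoin z y)) \<partial>lborel) = ennreal (exp (g z)) * (\<integral>\<^sup>+ y. exp_neg (\<psi> (vjoin z y)) \<partial>lborel)"
    if "z \<in> X" for z
  proof -
    have "(\<lambda>y. exp_neg (\<psi> (vjoin z y))) \<in> borel_measurable lborel"
      using measurable_compose[OF usc_on_slice_measurable[OF usc\<psi> that] measurable_exp_neg] by simp
    then show ?thesis by (simp add: \<Psi>_def exp_neg_diff finX[OF that] nn_integral_cmult)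
  qed
  have ge1: "1 \<le> (\<integral>\<^sup>+ y. exp_neg (\<Psi> (vjoin z y)) \<partial>lborel)" if z: "z \<in> ball a d" for z
  proof -
    have "ennreal (exp (- g z)) \<le> (\<integral>\<^sup>+ y. exp_neg (\<psi> (vjoin z y)) \<partial>lborel)"
      using le[OF z] by (simp add: neg_log_le_iff)
    then have "ennreal (exp (g z)) * ennreal (exp (- g z)) \<le> ennreal (exp (g z)) * (\<integral>\<^sup>+ y. exp_neg (\<psi> (vjoin z y)) \<partial>lborel)"
      by (rule mult_left_mono) simp
    then show ?thesis using int[of z] z d(2) by (auto simp: ennreal_mult[symmetric] exp_add[symmetric])
  qed
  have aX: "a \<in> X" using d by auto
  have le1: "(\<integral>\<^sup>+ y. exp_neg (\<Psi> (vjoin a y)) \<partial>lborel) \<le> 1"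
  proof -
    have "(\<integral>\<^sup>+ y. exp_neg (\<psi> (vjoin a y)) \<partial>lborel) \<le> ennreal (exp (- g a))"
      using ge by (simp add: neg_log_ge_iff)
    then have "ennreal (exp (g a)) * (\<integral>\<^sup>+ y. exp_neg (\<psi> (vjoin a y)) \<partial>lborel) \<le> ennreal (exp (g a)) * ennreal (exp (- g a))"
      by (rule mult_left_mono) simp
    then show ?thesis using int[OF aX] by (simp add: ennreal_mult[symmetric] exp_add[symmetric])
  qed
  define \<rho> where "\<rho> = d / 4"
  \<comment> \<open>The grid points of the kernel lie within \<open>CARD('n) * R = \<rho>\<close> of
    \<open>a\<close>, where the lower bound on the integrals is available.\<close>
  define R where "R = \<rho> / CARD('n)"
  \<comment> \<open>Adding \<sigma> times the squared distance raises the operator by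
    \<open>2 * \<sigma> * (Q \<bullet> mat 1)\<close>, half of the gap \<open>c - c'\<close>. The
    resulting drop from the sphere to the centre is \<beta>.\<close>
  define \<sigma> where "\<sigma> = (c - c') / (4 * (Q \<bullet> mat 1))"
  define \<beta> where "\<beta> = \<sigma> * R\<^sup>2"
  have \<rho>: "\<rho> > 0" "cball a (2 * \<rho>) \<subseteq> X" "cball a \<rho> \<subseteq> ball a d"
  proof -
    show "\<rho> > 0" "cball a \<rho> \<subseteq> ball a d" using d(1) by (auto simp: \<rho>_def)
    have "cball a (2 * \<rho>) \<subseteq> ball a d" using d(1) by (auto simp: \<rho>_def)
    with d(2) show "cball a (2 * \<rho>) \<subseteq> X" by blast
  qed
  have R: "R > 0" "R \<le> \<rho>" "CARD('n) * R = \<rho>"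
  proof -
    show "R > 0" using \<rho>(1) by (simp add: R_def)
    show "CARD('n) * R = \<rho>" by (simp add: R_def)
    have "1 * R \<le> CARD('n) * R" using \<open>R > 0\<close> by (intro mult_right_mono) (auto simp: Suc_leI)
    then show "R \<le> \<rho>" by (simp add: R_def)
  qed
  have \<sigma>: "\<sigma> > 0" using g(3) Q_trace by (simp add: \<sigma>_def)
  have \<beta>: "\<beta> > 0" using \<sigma> R(1) by (simp add: \<beta>_def)
  obtain k :: nat where k: "k > 0" "1 / (real k + 1) < \<rho>"
    "\<And>z. z \<in> cball a \<rho> \<Longrightarrow> ennreal (exp (- (\<beta> / 4))) < (\<integral>\<^sup>+y. regularized_weight \<Psi> k z y \<partial>lborel)"
  proof (rule regularized_weight_integral_uniform[OF X usc \<rho>(1,2), of "ennreal (exp (- (\<beta> / 4)))"])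
    fix z assume "z \<in> cball a \<rho>"
    with \<rho>(3) have "1 \<le> (\<integral>\<^sup>+ y. exp_neg (\<Psi> (vjoin z y)) \<partial>lborel)" by (intro ge1) auto
    moreover have "ennreal (exp (- (\<beta> / 4))) < 1" using \<beta> by (simp add: ennreal_less_one_iff)
    ultimately show "ennreal (exp (- (\<beta> / 4))) < (\<integral>\<^sup>+ y. exp_neg (\<Psi> (vjoin z y)) \<partial>lborel)"
      by (rule order.strict_trans2[rotated])
  qed (use that in blast)
  have "compact {p. fst_part p \<in> cball a \<rho> \<and> snd_part p \<in> cball (0::real^'m) k}"
    by (intro compact_vjoin_box compact_cball)
  moreover have subX: "p \<in> times_space X" if "fst_part p \<in> cball a \<rho>" for p :: "real^('n + 'm)"
  proof -
    have "vjoin (fst_part p) (snd_part p) \<in> times_space X"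
      using that \<rho>(2) \<rho>(1) by (subst vjoin_in_times_space) auto
    then show ?thesis by simp
  qed
  moreover have "\<Psi> p \<noteq> \<infinity>" if "p \<in> times_space X" for p
    using fin[OF that] by (cases "\<psi> p") (auto simp: \<Psi>_def)
  ultimately obtain M0 where M0: "\<And>p. p \<in> {p. fst_part p \<in> cball a \<rho> \<and> snd_part p \<in> cball (0::real^'m) k} \<Longrightarrow> \<Psi> p < ereal M0"
    using usc_on_bounded_above[of "{p. fst_part p \<in> cball a \<rho> \<and> snd_part p \<in> cball (0::real^'m) k}" \<Psi>]
      usc_on_subset[OF usc] by (metis (no_types, lifting) mem_Collect_eq subsetI)
  define M where "M = max M0 0"
  have M: "\<Psi> (vjoin z y) < ereal M" if "z \<in> cball a \<rho>" "norm y \<le> k" for z y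
  proof -
    have "\<Psi> (vjoin z y) < ereal M0" by (rule M0) (use that in auto)
    also have "\<dots> \<le> ereal M" by (simp add: M_def)
    finally show ?thesis .
  qed
  \<comment> \<open>On the sphere a far index costs at most \<open>M + k\<close>, the excess of the
    crude bound \<open>M\<close> over a level that is at least \<open>- k\<close>. With far weight
    at most \<theta> the total cost is at most \<open>\<beta> / 4\<close>.\<close>
  define \<theta> where "\<theta> = (\<beta> / 4) / (M + k + 1)"
  have M0': "0 \<le> M" by (simp add: M_def)
  then have Mk: "0 < M + k + 1" by (simp add: add_nonneg_pos)
  have \<theta>: "\<theta> > 0" "(M + k) * \<theta> \<le> \<beta> / 4"
  proof -
    show "\<theta> > 0" using \<beta> Mk by (simp add: \<theta>_def)
    then have "(M + k) * \<theta> \<le> (M + k + 1) * \<theta>" by (intro mult_right_mono) auto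
    also have "\<dots> = \<beta> / 4" unfolding \<theta>_def using Mk by (intro nonzero_mult_div_cancel_left[THEN trans[OF times_divide_eq_right]]) simp
    finally show "(M + k) * \<theta> \<le> \<beta> / 4" .
  qed
  obtain I and pt :: "('n \<Rightarrow> nat) \<Rightarrow> real^'n" and p where ker: "finite I"
    "\<And>i. i \<in> I \<Longrightarrow> real_polynomial_function (p i)"
    "\<And>i z. i \<in> I \<Longrightarrow> Q \<bullet> hessian (p i) z = 0"
    "\<And>i z. i \<in> I \<Longrightarrow> z \<in> cball a R \<Longrightarrow> 0 \<le> p i z"
    "\<And>z. z \<in> cball a R \<Longrightarrow> (\<Sum>i\<in>I. p i z) = 1"
    "\<And>i. i \<in> I \<Longrightarrow> pt i \<in> cball a \<rho>"
    "\<And>z. z \<in> sphere a R \<Longrightarrow> (\<Sum>i | i \<in> I \<and> 1 / (real k + 1) \<le> dist z (pt i). p i z) \<le> \<theta>"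
  proof -
    have pos: "0 < 1 / (real k + 1)" by simp
    show thesis
    proof (rule harmonic_kernel[OF R(1) pos \<theta>(1), where a = a, unfolded R(3)], goal_cases)
      case (1 I p pt)
      then show thesis by (rule that)
    qed
  qed
  \<comment> \<open>the strictness gains \<open>\<beta>\<close> at the centre, of which \<open>\<beta> / 4\<close> is spent on the sphere\<close>
  define E where "E = - (3 / 4) * \<beta>"
  define u where "u z = g z + (\<beta> / 4 + \<sigma> * ((norm (z - a))\<^sup>2 + (- R\<^sup>2)))" for z
  have pu: "real_polynomial_function u"
    unfolding u_def[abs_def]
    by (intro real_polynomial_function.intros(2,3) polynomial_cmult polynomial_norm_sq g)
  have Lu: "Q \<bullet> hessian u z < c" for z
  proof -
    have "hessian u z = hessian g z + \<sigma> *\<^sub>R (2 *\<^sub>R mat 1)"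
      unfolding u_def[abs_def]
      by (subst hessian_add hessian_cmult,
        (intro real_polynomial_function.intros(2-3) g(1) polynomial_cmult polynomial_norm_sq)+)+
        (simp add: hessian_norm_sq)
    then have "Q \<bullet> hessian u z = c' + (c - c') / 2"
      using Q_trace by (simp add: inner_add_right g(2) \<sigma>_def)
    with g(3) show ?thesis by (simp add: field_simps)
  qed
  have key: "\<Psi> (vjoin a (\<Sum>i\<in>I. p i a *\<^sub>R y i)) < ereal (E + (\<Sum>i\<in>I. t i * p i a))"
    if y: "\<And>i. i \<in> I \<Longrightarrow> norm (y i) \<le> k" and t: "\<And>i. i \<in> I \<Longrightarrow> - real k \<le> t i"
      and near: "\<And>i z. i \<in> I \<Longrightarrow> z \<in> cball a \<rho> \<Longrightarrow> dist z (pt i) < 1 / (real k + 1) \<Longrightarrow> \<Psi> (vjoin z (y i)) < ereal (t i)"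
    for y :: "('n \<Rightarrow> nat) \<Rightarrow> real^'m" and t
  proof -
    have "\<psi> (vjoin a (\<Sum>i\<in>I. p i a *\<^sub>R y i)) < ereal (u a + (\<Sum>i\<in>I. t i * p i a))"
    proof (rule interpolation[OF sub F(2) F(1) R(1) _ ker(1-5) pu Lu])
      show "cball a R \<subseteq> X" using R(2) \<rho>(1,2) by (auto simp: subset_iff)
      fix z assume z: "z \<in> sphere a R"
      then have zR: "z \<in> cball a R" and z\<rho>: "z \<in> cball a \<rho>" using R(2) by auto
      have zX: "z \<in> X" using z\<rho> \<rho>(1,2) by (auto simp: subset_iff)
      define far where "far i \<longleftrightarrow> 1 / (real k + 1) \<le> dist z (pt i)" for i
      \<comment> \<open>Near the grid point the assumed level is available, elsewhere just the bound
        \<open>M\<close>. Convexity in the fibre then bounds \<psi> at the mean of the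
        \<open>y i\<close> by the mean of these bounds.\<close>
      define b where "b i = (if far i then M else t i)" for i
      have "(y i, g z + b i) \<in> {(y, b). \<psi> (vjoin z y) < ereal b}" if i: "i \<in> I" for i
      proof -
        have "\<Psi> (vjoin z (y i)) < ereal (b i)"
          using M[OF z\<rho> y[OF i]] near[OF i z\<rho>] by (auto simp: b_def far_def)
        then show ?thesis by (cases "\<psi> (vjoin z (y i))") (auto simp: \<Psi>_def)
      qed
      from convex_sum[OF ker(1) fibre_epigraph_convex[OF X sub zX] ker(5)[OF zR] ker(4)[OF _ zR] this]
      have "(\<Sum>i\<in>I. p i z *\<^sub>R (y i, g z + b i)) \<in> {(y, b). \<psi> (vjoin z y) < ereal b}" .
      then have "\<psi> (vjoin z (\<Sum>i\<in>I. p i z *\<^sub>R y i)) < ereal (\<Sum>i\<in>I. p i z * (g z + b i))"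
        by (simp add: sum_prod scaleR_prod_def)
      also have "(\<Sum>i\<in>I. p i z * (g z + b i)) = g z + (\<Sum>i\<in>I. p i z * b i)"
        using ker(5)[OF zR] by (simp add: distrib_left sum.distrib sum_distrib_right[symmetric])
      also have "(\<Sum>i\<in>I. p i z * b i) \<le> (\<Sum>i\<in>I. t i * p i z + (if far i then (M + k) * p i z else 0))"
      proof (rule sum_mono)
        fix i assume i: "i \<in> I"
        have "p i z * M \<le> p i z * (t i + (M + k))"
          using ker(4)[OF i zR] t[OF i] by (intro mult_left_mono) auto
        then show "p i z * b i \<le> t i * p i z + (if far i then (M + k) * p i z else 0)"
          by (simp add: b_def algebra_simps)
      qed
      also have "\<dots> = (\<Sum>i\<in>I. t i * p i z) + (M + k) * (\<Sum>i | i \<in> I \<and> far i. p i z)"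
        using ker(1) unfolding sum.distrib sum_distrib_left by (subst sum.inter_filter) simp_all
      also have "\<dots> \<le> (\<Sum>i\<in>I. t i * p i z) + (M + k) * \<theta>"
        using ker(7)[OF z] M0' by (intro add_left_mono mult_left_mono) (auto simp: far_def)
      also have "\<dots> \<le> (\<Sum>i\<in>I. t i * p i z) + \<beta> / 4" using \<theta>(2) by simp
      finally show "\<psi> (vjoin z (\<Sum>i\<in>I. p i z *\<^sub>R y i)) < ereal (u z + (\<Sum>i\<in>I. t i * p i z))"
        using z by (simp add: u_def dist_norm norm_minus_commute algebra_simps)
    qed
    moreover have "u a = g a + E" by (simp add: u_def E_def \<beta>_def)
    ultimately show ?thesis
      by (cases "\<psi> (vjoin a (\<Sum>i\<in>I. p i a *\<^sub>R y i))") (auto simp: \<Psi>_def)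
  qed
  \<comment> \<open>Prekopa-Leindler needs positive weights; weights that vanish at \<open>a\<close>
    are dropped.\<close>
  define J where "J = {i\<in>I. 0 < p i a}"
  have aR: "a \<in> cball a R" using R(1) by simp
  have J0: "p i a = 0" if "i \<in> I - J" for i using ker(4)[of i a] aR that by (auto simp: J_def)
  have J: "finite J" "sum (\<lambda>i. p i a) J = 1"
  proof -
    show "finite J" using ker(1) by (simp add: J_def)
    have "sum (\<lambda>i. p i a) J = (\<Sum>i\<in>I. p i a)"
      using ker(1) J0 by (intro sum.mono_neutral_left) (auto simp: J_def)
    then show "sum (\<lambda>i. p i a) J = 1" using ker(5)[OF aR] by simp
  qed
  have J1: "J \<noteq> {}" using J(2) by auto
  have mH: "(\<lambda>y. exp_neg (\<Psi> (vjoin a y))) \<in> borel_measurable borel"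
    by (rule measurable_compose[OF usc_on_slice_measurable[OF usc aX] measurable_exp_neg])
  have "ennreal (exp (\<Sum>i\<in>J. p i a * (- (\<beta> / 4)))) \<le>
    (\<integral>\<^sup>+ y. ennreal (exp E) * exp_neg (\<Psi> (vjoin a y)) \<partial>lborel)"
  proof (rule prekopa_leindler[OF J(1) J1 _ J(2), where h = "\<lambda>i. regularized_weight \<Psi> k (pt i)"])
    fix i assume i: "i \<in> J"
    then show "0 < p i a" by (simp add: J_def)
    have iI: "i \<in> I" using i by (simp add: J_def)
    have "cball (pt i) (1 / (real k + 1)) \<subseteq> X"
    proof
      fix x assume "x \<in> cball (pt i) (1 / (real k + 1))"
      then have "dist a x \<le> 2 * \<rho>" using dist_triangle[of a x "pt i"] ker(6)[OF iI] k(2) by simp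
      then show "x \<in> X" using \<rho>(2) by auto
    qed
    then show "regularized_weight \<Psi> k (pt i) \<in> borel_measurable borel"
      by (rule regularized_weight_measurable[OF usc])
    show "ennreal (exp (- (\<beta> / 4))) < (\<integral>\<^sup>+ y. regularized_weight \<Psi> k (pt i) y \<partial>lborel)"
      by (rule k(3)[OF ker(6)[OF iI]])
  next
    show "(\<lambda>y. ennreal (exp E) * exp_neg (\<Psi> (vjoin a y))) \<in> borel_measurable borel"
      using mH by measurable
  next
    fix y :: "('n \<Rightarrow> nat) \<Rightarrow> real^'m" and s
    assume s: "\<And>i. i \<in> J \<Longrightarrow> ennreal (exp (s i)) < regularized_weight \<Psi> k (pt i) (y i)"
    note sD = less_regularized_weightD[OF s]
    \<comment> \<open>Indices outside \<open>J\<close> have weight 0 at \<open>a\<close> but still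
      enter \<open>key\<close>, whose premises concern all of \<open>I\<close>; the fibre point 0
      with level \<open>M\<close> satisfies them.\<close>
    define y' where "y' i = (if i \<in> J then y i else 0)" for i
    define t where "t i = (if i \<in> J then - s i else M)" for i
    have "\<Psi> (vjoin a (\<Sum>i\<in>I. p i a *\<^sub>R y' i)) < ereal (E + (\<Sum>i\<in>I. t i * p i a))"
    proof (rule key)
      fix i assume i: "i \<in> I"
      show "norm (y' i) \<le> k" using sD(1)[of i] by (auto simp: y'_def)
      show "- real k \<le> t i" using sD(2)[of i] M0' by (auto simp: t_def)
      fix z assume "z \<in> cball a \<rho>" "dist z (pt i) < 1 / (real k + 1)"
      then show "\<Psi> (vjoin z (y' i)) < ereal (t i)"
        using sD(3)[of i z] M[of z 0] by (auto simp: y'_def t_def dist_commute)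
    qed
    also have "(\<Sum>i\<in>I. p i a *\<^sub>R y' i) = (\<Sum>i\<in>J. p i a *\<^sub>R y i)"
      using ker(1) J0 by (intro sum.mono_neutral_cong_right) (auto simp: J_def y'_def)
    also have "(\<Sum>i\<in>I. t i * p i a) = (\<Sum>i\<in>J. - (p i a * s i))"
      using ker(1) J0 by (intro sum.mono_neutral_cong_right) (auto simp: J_def t_def)
    finally have "\<Psi> (vjoin a (\<Sum>i\<in>J. p i a *\<^sub>R y i)) \<le> ereal (E - (\<Sum>i\<in>J. p i a * s i))"
      by (simp add: sum_negf)
    from exp_neg_antimono[OF this]
    have "ennreal (exp E) * ennreal (exp (- (E - (\<Sum>i\<in>J. p i a * s i)))) \<le>
      ennreal (exp E) * exp_neg (\<Psi> (vjoin a (\<Sum>i\<in>J. p i a *\<^sub>R y i)))"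
      by (intro mult_left_mono) auto
    then show "ennreal (exp (\<Sum>i\<in>J. p i a * s i)) \<le> ennreal (exp E) * exp_neg (\<Psi> (vjoin a (\<Sum>i\<in>J. p i a *\<^sub>R y i)))"
      by (simp add: ennreal_mult[symmetric] exp_add[symmetric])
  qed
  also have "\<dots> = ennreal (exp E) * (\<integral>\<^sup>+ y. exp_neg (\<Psi> (vjoin a y)) \<partial>lborel)"
    using mH by (intro nn_integral_cmult) simp
  also have "\<dots> \<le> ennreal (exp E) * 1" by (intro mult_left_mono le1) simp
  finally have "exp (\<Sum>i\<in>J. p i a * (- (\<beta> / 4))) \<le> exp E" by simp
  moreover have "(\<Sum>i\<in>J. p i a * (- (\<beta> / 4))) = - (\<beta> / 4)"
    unfolding sum_distrib_right[symmetric] J(2) by simp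
  ultimately show False using \<beta> by (simp add: E_def)
qed

end

theorem theorem1p6:
  fixes X :: "(real^'n) set"
    and F :: "(real^'n^'n) set"
    and \<psi> :: "real^('n::finite + 'm::finite) \<Rightarrow> ereal"
  assumes "open X"
    and "convex_dirichlet_set F"
    and "subharmonic_on (star_psd F) (times_space X) \<psi>"
  shows "subharmonic_on F X
    (\<lambda>x. neg_log (\<integral>\<^sup>+ y. exp_neg (\<psi> (vjoin x y)) \<partial>lborel))"
proof -
  let ?f = "\<lambda>x. neg_log (\<integral>\<^sup>+ y. exp_neg (\<psi> (vjoin x y)) \<partial>lborel)"
  have usc: "usc_on (times_space X) \<psi>" and fin: "\<And>p. p \<in> times_space X \<Longrightarrow> \<psi> p \<noteq> \<infinity>"
    using assms(3) by (auto simp: subharmonic_on_def)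
  have "hessian g x \<in> F" if x: "x \<in> X" and g: "test_function X ?f x g" for x g
  proof (rule ccontr)
    assume n: "hessian g x \<notin> F"
    obtain U where U: "open U" "x \<in> U" "U \<subseteq> X" "smooth_on g U" "\<And>z. z \<in> U \<Longrightarrow> ?f z \<le> ereal (g z)"
      and gx: "ereal (g x) = ?f x"
      using g by (auto simp: test_function_def)
    have C2: "Ck_on (Suc (Suc 0)) g U" using U(4) unfolding smooth_on_def by blast
    have sym: "transpose (hessian g x) = hessian g x" by (rule transpose_hessian[OF U(1,2) C2])
    then obtain Q c where Q: "trace_operator Q" "\<And>A. A \<in> F \<Longrightarrow> c \<le> Q \<bullet> A" "Q \<bullet> hessian g x < c"
      using convex_dirichlet_halfspace[OF assms(2) _ n] by (auto simp: sym_matrices_def)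
    interpret trace_operator Q by (rule Q(1))
    \<comment> \<open>The term \<open>e * (norm (z - x))\<^sup>2\<close> raises the operator by half
      of the gap, so \<open>G\<close> below ends at the midpoint of
      \<open>Q \<bullet> hessian g x\<close> and \<open>c\<close>.\<close>
    define e where "e = (c - Q \<bullet> hessian g x) / (4 * (Q \<bullet> mat 1))"
    have e: "e > 0" using Q(3) Q_trace by (simp add: e_def)
    obtain d where d: "d > 0" "ball x d \<subseteq> U" "\<And>w. norm w < d \<Longrightarrow>
      \<bar>g (x + w) - g x - gradient g x \<bullet> w - (w \<bullet> (hessian g x *v w)) / 2\<bar> \<le> e * (norm w)\<^sup>2"
      using second_order_taylor[OF U(1,2) C2 e] by metis
    define q where "q z = g x + gradient g x \<bullet> (z - x) + ((z - x) \<bullet> (hessian g x *v (z - x))) / 2" for z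
    \<comment> \<open>The quadratic term dominates the Taylor error, so \<open>G\<close> lies above
      \<open>g\<close> on the ball and touches it at \<open>x\<close>; unlike \<open>g\<close> it
      has a constant Hessian.\<close>
    define G where "G z = q z + e * (norm (z - x))\<^sup>2" for z
    have pq: "real_polynomial_function q" unfolding q_def[abs_def] by (rule hessian_quadratic(1)[OF sym])
    have pG: "real_polynomial_function G"
      unfolding G_def[abs_def]
      by (intro real_polynomial_function.intros(3) polynomial_cmult polynomial_norm_sq pq)
    have LG: "Q \<bullet> hessian G z = (Q \<bullet> hessian g x + c) / 2" for z
    proof -
      have "hessian G z = hessian q z + e *\<^sub>R (2 *\<^sub>R mat 1)"
        unfolding G_def[abs_def]
        by (subst hessian_add[OF pq polynomial_cmult[OF polynomial_norm_sq]])
          (simp add: hessian_cmult[OF polynomial_norm_sq] hessian_norm_sq)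
      also have "hessian q z = hessian g x" unfolding q_def[abs_def] by (rule hessian_quadratic(2)[OF sym])
      finally show ?thesis using Q_trace by (simp add: inner_add_right e_def field_simps)
    qed
    show False
    proof (rule no_strict_test_polynomial[OF assms(1,3) _ Q(2) pG LG _ d(1)])
      show "F \<subseteq> sym_matrices" using assms(2) by (auto simp: convex_dirichlet_set_def dirichlet_set_def)
      show "(Q \<bullet> hessian g x + c) / 2 < c" using Q(3) by simp
      show "ball x d \<subseteq> X" using d(2) U(3) by blast
      show "?f z \<le> ereal (G z)" if z: "z \<in> ball x d" for z
      proof -
        have "g z \<le> G z" using d(3)[of "z - x"] z by (simp add: G_def q_def dist_norm norm_minus_commute)
        moreover have "?f z \<le> ereal (g z)" using z d(2) by (intro U(5)) auto
        ultimately show ?thesis by (meson ereal_less_eq(3) order_trans)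
      qed
      show "ereal (G x) \<le> ?f x" using gx by (simp add: G_def q_def)
    qed
  qed
  then show ?thesis
    unfolding subharmonic_on_def
    using marginal_usc[OF usc] marginal_neq_infinity[OF usc fin] by blast
qed

end
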